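(* Let $\Gamma$ be a torsion-free finitely generated nilpotent group. There exists a positive finitely additive probability measure $\mu$ on $\widehat\Gamma$, supported on the set $\widehat\Gamma_{\mathrm{fin}}$ of (equivalence classes of) finite-dimensional irreducible unitary representations of $\Gamma$, such that for every $f\in\ell^1(\Gamma)$ and every $\sigma\in\Gamma$, $$ f(\sigma)=\int_{\widehat\Gamma_{\mathrm{fin}}}\frac{1}{\dim\pi}\operatorname{Tr}\bigl(\pi(\sigma^{-1})\pi(f)\bigr)\,d\mu(\pi), $$ and the associated Plancherel identity also holds: for every $f\in\ell^1(\Gamma)$, $$ \sum_{\gamma\in\Gamma}|f(\gamma)|^2=\int_{\widehat\Gamma_{\mathrm{fin}}}\frac{1}{\dim\pi}\operatorname{Tr}\bigl(\pi(f)^*\pi(f)\bigr)\,d\mu(\pi). $$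
   Context: $\widehat\Gamma$ is the set of unitary equivalence classes of irreducible unitary representations of the discrete group $\Gamma$. For $f\in\ell^1(\Gamma)$ and a unitary representation $\pi$, $\pi(f)=\sum_{\gamma\in\Gamma}f(\gamma)\pi(\gamma)$. A positive finitely additive probability measure on a set is a finitely additive function $\mu\ge0$ on the Boolean algebra of all its subsets with total mass $1$; the integral of a bounded function is the associated positive norm-one linear functional on bounded functions. "Supported on $\widehat\Gamma_{\mathrm{fin}}$" means $\mu(\widehat\Gamma\setminus\widehat\Gamma_{\mathrm{fin}})=0$. (Countable additivity is not claimed.) *)

theory Defs
  imports
    "HOL-Analysis.Analysis"
    "HOL-Algebra.Generated_Groups"
    "HOL-Library.Function_Algebras"
    "HOL-Library.Disjoint_Sets"
begin

section \<open>Groups\<close>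

definition torsion_free :: "('a, 'b) monoid_scheme \<Rightarrow> bool" where
  "torsion_free G \<longleftrightarrow>
     (\<forall>x\<in>carrier G. \<forall>n::nat. 0 < n \<longrightarrow> x [^]\<^bsub>G\<^esub> n = \<one>\<^bsub>G\<^esub> \<longrightarrow> x = \<one>\<^bsub>G\<^esub>)"

definition finitely_generated :: "('a, 'b) monoid_scheme \<Rightarrow> bool" where
  "finitely_generated G \<longleftrightarrow> (\<exists>S. finite S \<and> S \<subseteq> carrier G \<and> generate G S = carrier G)"

primrec lower_central_series :: "('a, 'b) monoid_scheme \<Rightarrow> nat \<Rightarrow> 'a set" where
  "lower_central_series G 0 = carrier G"
| "lower_central_series G (Suc n) =
     generate G (\<Union>x \<in> lower_central_series G n. \<Union>y \<in> carrier G.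
       {x \<otimes>\<^bsub>G\<^esub> y \<otimes>\<^bsub>G\<^esub> inv\<^bsub>G\<^esub> x \<otimes>\<^bsub>G\<^esub> inv\<^bsub>G\<^esub> y})"

definition nilpotent :: "('a, 'b) monoid_scheme \<Rightarrow> bool" where
  "nilpotent G \<longleftrightarrow> (\<exists>n. lower_central_series G n = {\<one>\<^bsub>G\<^esub>})"


section \<open>Complex Hilbert spaces\<close>

text \<open>
  Hilbert spaces are realised as closed subspaces of the sequence spaces \<open>ell2 I\<close>. As every
  Hilbert space is isometrically isomorphic to some \<open>ell2 I\<close>, this loses no generality.
  Operators on such a subspace \<open>H\<close> are functions on the ambient type; only their values on \<open>H\<close>
  matter.
\<close>

definition fscale :: "complex \<Rightarrow> ('i \<Rightarrow> complex) \<Rightarrow> 'i \<Rightarrow> complex" where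
  "fscale c x = (\<lambda>i. c * x i)"

global_interpretation fvs: vector_space "fscale :: complex \<Rightarrow> ('i \<Rightarrow> complex) \<Rightarrow> 'i \<Rightarrow> complex"
  by standard (auto simp: fscale_def fun_eq_iff algebra_simps)

definition ell2 :: "'i set \<Rightarrow> ('i \<Rightarrow> complex) set" where
  "ell2 I = {x. (\<forall>i. i \<notin> I \<longrightarrow> x i = 0) \<and> (\<lambda>i. (cmod (x i))\<^sup>2) summable_on UNIV}"

definition l2_inner :: "('i \<Rightarrow> complex) \<Rightarrow> ('i \<Rightarrow> complex) \<Rightarrow> complex" where
  "l2_inner x y = (\<Sum>\<^sub>\<infinity>i. x i * cnj (y i))"

definition l2_norm :: "('i \<Rightarrow> complex) \<Rightarrow> real" where
  "l2_norm x = sqrt (\<Sum>\<^sub>\<infinity>i. (cmod (x i))\<^sup>2)"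

definition closed_subspace :: "'i set \<Rightarrow> ('i \<Rightarrow> complex) set \<Rightarrow> bool" where
  "closed_subspace I H \<longleftrightarrow> H \<subseteq> ell2 I \<and> fvs.subspace H \<and>
     (\<forall>X. \<forall>x\<in>ell2 I. (\<forall>n::nat. X n \<in> H) \<longrightarrow> (\<lambda>n. l2_norm (X n - x)) \<longlonglongrightarrow> 0 \<longrightarrow> x \<in> H)"

definition unitary_map ::
  "('i \<Rightarrow> complex) set \<Rightarrow> ('j \<Rightarrow> complex) set \<Rightarrow> (('i \<Rightarrow> complex) \<Rightarrow> 'j \<Rightarrow> complex) \<Rightarrow> bool" where
  "unitary_map H K U \<longleftrightarrow>
     (\<forall>u\<in>H. \<forall>v\<in>H. U (u + v) = U u + U v) \<and>
     (\<forall>c. \<forall>v\<in>H. U (fscale c v) = fscale c (U v)) \<and>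
     bij_betw U H K \<and>
     (\<forall>u\<in>H. \<forall>v\<in>H. l2_inner (U u) (U v) = l2_inner u v)"

definition hilbert_adjoint ::
  "('i \<Rightarrow> complex) set \<Rightarrow> (('i \<Rightarrow> complex) \<Rightarrow> 'i \<Rightarrow> complex) \<Rightarrow> ('i \<Rightarrow> complex) \<Rightarrow> 'i \<Rightarrow> complex" where
  "hilbert_adjoint H T v = (THE w. w \<in> H \<and> (\<forall>u\<in>H. l2_inner (T u) v = l2_inner u w))"

definition finite_dimensional :: "('i \<Rightarrow> complex) set \<Rightarrow> bool" where
  "finite_dimensional H \<longleftrightarrow> (\<exists>B. finite B \<and> fvs.span B = H)"

definition orthonormal_basis :: "('i \<Rightarrow> complex) set \<Rightarrow> ('i \<Rightarrow> complex) set \<Rightarrow> bool" where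
  "orthonormal_basis H B \<longleftrightarrow> finite B \<and> fvs.span B = H \<and>
     (\<forall>u\<in>B. \<forall>v\<in>B. l2_inner u v = (if u = v then 1 else 0))"

text \<open>Trace on a finite-dimensional space, where it does not depend on the chosen basis.\<close>

definition op_trace ::
  "('i \<Rightarrow> complex) set \<Rightarrow> (('i \<Rightarrow> complex) \<Rightarrow> 'i \<Rightarrow> complex) \<Rightarrow> complex" where
  "op_trace H T = (\<Sum>b\<in>(SOME B. orthonormal_basis H B). l2_inner (T b) b)"


section \<open>Unitary representations and the unitary dual\<close>

type_synonym ('a, 'i) rep = "('i \<Rightarrow> complex) set \<times> ('a \<Rightarrow> ('i \<Rightarrow> complex) \<Rightarrow> 'i \<Rightarrow> complex)"

definition unitary_rep :: "('a, 'b) monoid_scheme \<Rightarrow> 'i set \<Rightarrow> ('a, 'i) rep \<Rightarrow> bool" where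
  "unitary_rep G I = (\<lambda>(H, \<pi>). closed_subspace I H \<and>
     (\<forall>g\<in>carrier G. unitary_map H H (\<pi> g)) \<and>
     (\<forall>g\<in>carrier G. \<forall>h\<in>carrier G. \<forall>v\<in>H. \<pi> (g \<otimes>\<^bsub>G\<^esub> h) v = \<pi> g (\<pi> h v)))"

definition irreducible_rep :: "('a, 'b) monoid_scheme \<Rightarrow> 'i set \<Rightarrow> ('a, 'i) rep \<Rightarrow> bool" where
  "irreducible_rep G I = (\<lambda>(H, \<pi>). unitary_rep G I (H, \<pi>) \<and> H \<noteq> {0} \<and>
     (\<forall>K. closed_subspace I K \<longrightarrow> K \<subseteq> H \<longrightarrow> (\<forall>g\<in>carrier G. \<pi> g ` K \<subseteq> K) \<longrightarrow> K = {0} \<or> K = H))"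

definition unitarily_equivalent ::
  "('a, 'b) monoid_scheme \<Rightarrow> ('a, 'i) rep \<Rightarrow> ('a, 'j) rep \<Rightarrow> bool" where
  "unitarily_equivalent G = (\<lambda>(H, \<pi>) (K, \<rho>).
     \<exists>U. unitary_map H K U \<and> (\<forall>g\<in>carrier G. \<forall>v\<in>H. U (\<pi> g v) = \<rho> g (U v)))"

text \<open>
  An irreducible unitary representation of \<open>G\<close> is cyclic, so the orbit of any nonzero vector
  spans a dense subspace, and the Hilbert dimension is at most the cardinality of \<open>G\<close>. Hence
  every irreducible unitary representation, on whatever Hilbert space, is unitarily equivalent
  to one on a closed subspace of \<open>ell2 (carrier G)\<close>, and the following set of classes is the
  whole unitary dual.
\<close>

definition irreps :: "('a, 'b) monoid_scheme \<Rightarrow> ('a, 'a) rep set" where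
  "irreps G = {r. irreducible_rep G (carrier G) r}"

definition unitary_dual :: "('a, 'b) monoid_scheme \<Rightarrow> ('a, 'a) rep set set" where
  "unitary_dual G =
     irreps G // {(r, s). r \<in> irreps G \<and> s \<in> irreps G \<and> unitarily_equivalent G r s}"

definition fin_dual :: "('a, 'b) monoid_scheme \<Rightarrow> ('a, 'a) rep set set" where
  "fin_dual G = {c \<in> unitary_dual G. \<forall>(H, \<pi>)\<in>c. finite_dimensional H}"

text \<open>
  The operator \<open>\<pi>(f)\<close>, the sum of \<open>f \<gamma> \<cdot> \<pi> \<gamma>\<close> over the group. For \<open>f\<close> in \<open>\<ell>\<^sup>1\<close> the series converges
  in operator norm, so its value at a vector \<open>v\<close> can be computed coordinate by coordinate.
\<close>

definition rep_ell1 ::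
  "('a, 'b) monoid_scheme \<Rightarrow> ('a \<Rightarrow> ('i \<Rightarrow> complex) \<Rightarrow> 'i \<Rightarrow> complex) \<Rightarrow> ('a \<Rightarrow> complex) \<Rightarrow>
   ('i \<Rightarrow> complex) \<Rightarrow> 'i \<Rightarrow> complex" where
  "rep_ell1 G \<pi> f v = (\<lambda>i. \<Sum>\<^sub>\<infinity>\<gamma>\<in>carrier G. f \<gamma> * \<pi> \<gamma> v i)"

definition normalized_trace ::
  "('i \<Rightarrow> complex) set \<Rightarrow> (('i \<Rightarrow> complex) \<Rightarrow> 'i \<Rightarrow> complex) \<Rightarrow> complex" where
  "normalized_trace H T = 1 / of_nat (fvs.dim H) * op_trace H T"

text \<open>
  Evaluates a function of representations at a class through a representative; used only for
  functions that are invariant under unitary equivalence.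
\<close>

definition on_class :: "(('i \<Rightarrow> complex) set \<Rightarrow> ('a \<Rightarrow> ('i \<Rightarrow> complex) \<Rightarrow> 'i \<Rightarrow> complex) \<Rightarrow> complex) \<Rightarrow>
   ('a, 'i) rep set \<Rightarrow> complex" where
  "on_class F c = (case (SOME r. r \<in> c) of (H, \<pi>) \<Rightarrow> F H \<pi>)"


section \<open>Finitely additive probability measures\<close>

definition fin_add_prob :: "'x set \<Rightarrow> ('x set \<Rightarrow> real) \<Rightarrow> bool" where
  "fin_add_prob X \<mu> \<longleftrightarrow> (\<forall>A\<subseteq>X. 0 \<le> \<mu> A) \<and> additive (Pow X) \<mu> \<and> \<mu> X = 1"

text \<open>
  Integral over \<open>A\<close> of a bounded real function: the supremum of the lower sums over finite
  partitions of \<open>A\<close>. Since the measure is defined on all subsets, this agrees with the infimum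
  of the upper sums, so on bounded functions it is the unique positive linear functional whose
  value at the indicator of \<open>B\<close> is the measure of \<open>B\<close>.
\<close>

definition fa_integral_real :: "('x set \<Rightarrow> real) \<Rightarrow> 'x set \<Rightarrow> ('x \<Rightarrow> real) \<Rightarrow> real" where
  "fa_integral_real \<mu> A g =
     Sup {(\<Sum>B\<in>P. \<mu> B * Inf (g ` B)) | P. finite P \<and> partition_on A P}"

definition fa_integral :: "('x set \<Rightarrow> real) \<Rightarrow> 'x set \<Rightarrow> ('x \<Rightarrow> complex) \<Rightarrow> complex" where
  "fa_integral \<mu> A g =
     Complex (fa_integral_real \<mu> A (\<lambda>x. Re (g x))) (fa_integral_real \<mu> A (\<lambda>x. Im (g x)))"

end

theory Submission
  imports Defs
begin

text \<open>
  A finitely generated nilpotent group is residually finite. For a normal subgroup \<open>N\<close> of finite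
  index, split the regular representation of \<open>G/N\<close> into irreducible subrepresentations \<open>\<pi>\<^sub>j\<close>;
  comparing traces shows that the weights \<open>dim \<pi>\<^sub>j / |G/N|\<close> form a finitely supported probability
  measure on the finite-dimensional dual whose average of normalised characters is the indicator
  of \<open>N\<close>. Let \<open>N\<close> avoid larger and larger finite sets of nontrivial elements: by Tychonoff the
  measures have a cluster point \<open>\<mu>\<close> in the product space of all functions from the power set to
  \<open>[0, 1]\<close>, which is a finitely additive probability measure whose integral of the normalised
  characters is the indicator of the identity. Both identities follow by dominated convergence.

  For residual finiteness, take a normal subgroup maximal among those avoiding a finite set \<open>F\<close> of
  nontrivial elements. In the quotient every nontrivial normal subgroup meets the image of \<open>F\<close>, so
  the centre is torsion; then the whole quotient is torsion, and hence finite.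
\<close>

section \<open>Residual finiteness\<close>

text \<open>Only normalised characters enter. For finite-dimensional \<open>\<pi>\<close> the
  integrand of the inversion formula is the series of \<open>f \<gamma>\<close> times the normalised
  character at \<open>inv \<sigma> \<otimes> \<gamma>\<close>; averaging over a finite quotient
  replaces the character by the indicator of \<open>N\<close>, and the limit leaves the single term
  \<open>\<gamma> = \<sigma>\<close>. The Plancherel integrand is in turn the series of
  \<open>cnj (f \<gamma>)\<close> times the inversion integrand at \<open>\<gamma>\<close>, so the
  second identity is the first one fed through dominated convergence again. The compactness argument
  controls only finitely many sets at a time, hence finite additivity. Bounded functions are still
  integrated correctly, because their lower sums come from finite partitions. On the group side the
  lower central series of the hypothesis is exchanged for the upper one, whose steps are centres of
  quotients: a torsion centre spreads torsion upwards, and finiteness then comes back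
  downwards.\<close>

primrec upper_central_series :: "('a, 'b) monoid_scheme \<Rightarrow> nat \<Rightarrow> 'a set" where
  "upper_central_series G 0 = {\<one>\<^bsub>G\<^esub>}"
| "upper_central_series G (Suc n) =
     {x \<in> carrier G. \<forall>y\<in>carrier G. x \<otimes>\<^bsub>G\<^esub> y \<otimes>\<^bsub>G\<^esub> inv\<^bsub>G\<^esub> x \<otimes>\<^bsub>G\<^esub> inv\<^bsub>G\<^esub> y \<in> upper_central_series G n}"

lemma (in normal) group_hom_rcoset: "group_hom G (G Mod H) (\<lambda>x. H #> x)"
  by (simp add: group_hom_def group_hom_axioms_def factorgroup_is_group r_coset_hom_Mod is_group)

lemma (in normal) rcos_eq_iff:
  assumes "x \<in> carrier G" "y \<in> carrier G"
  shows "H #> x = H #> y \<longleftrightarrow> x \<otimes> inv y \<in> H"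
  by (metis assms is_group is_subgroup group.repr_independence group.rcos_self rcos_module)

text \<open>Turns statements on commutators into statements on commuting cosets, so that membership
  in the next term of the upper central series reads as centrality in
  \<open>G Mod H\<close>.\<close>

lemma (in normal) commutator_in_iff:
  assumes "x \<in> carrier G" "y \<in> carrier G"
  shows "x \<otimes> y \<otimes> inv x \<otimes> inv y \<in> H \<longleftrightarrow>
    (H #> x) \<otimes>\<^bsub>G Mod H\<^esub> (H #> y) = (H #> y) \<otimes>\<^bsub>G Mod H\<^esub> (H #> x)"
proof -
  interpret q: group_hom G "G Mod H" "\<lambda>x. H #> x" by (rule group_hom_rcoset)
  have "(H #> x) \<otimes>\<^bsub>G Mod H\<^esub> (H #> y) = H #> (x \<otimes> y)"
    "(H #> y) \<otimes>\<^bsub>G Mod H\<^esub> (H #> x) = H #> (y \<otimes> x)"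
    using assms by (simp_all only: q.hom_mult)
  moreover have "(x \<otimes> y) \<otimes> inv (y \<otimes> x) = x \<otimes> y \<otimes> inv x \<otimes> inv y"
    using assms by (simp add: inv_mult_group m_assoc)
  ultimately show ?thesis using assms by (simp only: rcos_eq_iff m_closed)
qed

lemma (in group) inv_comm_of_comm:
  assumes "x \<otimes> y = y \<otimes> x" "x \<in> carrier G" "y \<in> carrier G"
  shows "inv x \<otimes> y = y \<otimes> inv x"
  using assms by (metis inv_closed inv_solve_left' inv_solve_right m_assoc m_closed)

text \<open>By \<open>commutator_in_iff\<close> this set is the preimage of the centre of
  \<open>G Mod H\<close>; the subgroup laws and normality are therefore checked on cosets.\<close>

lemma (in normal) normal_centralizer_mod:
  "{x \<in> carrier G. \<forall>y\<in>carrier G. x \<otimes> y \<otimes> inv x \<otimes> inv y \<in> H} \<lhd> G" (is "?Z \<lhd> G")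
proof -
  let ?Q = "G Mod H" let ?q = "\<lambda>x. H #> x"
  interpret q: group_hom G ?Q ?q by (rule group_hom_rcoset)
  have Z: "x \<in> ?Z \<longleftrightarrow> x \<in> carrier G \<and> (\<forall>y\<in>carrier G. ?q x \<otimes>\<^bsub>?Q\<^esub> ?q y = ?q y \<otimes>\<^bsub>?Q\<^esub> ?q x)" for x
    by (auto simp: commutator_in_iff)
  have sub: "subgroup ?Z G"
  proof
    show "?Z \<subseteq> carrier G" by auto
    show "\<one> \<in> ?Z" unfolding Z by (metis one_closed q.hom_closed q.hom_one q.H.l_one q.H.r_one)
    fix x assume x: "x \<in> ?Z"
    show "inv x \<in> ?Z"
      unfolding Z
    proof (intro conjI ballI)
      show "inv x \<in> carrier G" using x by auto
      fix y assume y: "y \<in> carrier G"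
      have 1: "?q x \<in> carrier ?Q" "?q y \<in> carrier ?Q" "?q x \<otimes>\<^bsub>?Q\<^esub> ?q y = ?q y \<otimes>\<^bsub>?Q\<^esub> ?q x"
        using x y unfolding Z by (auto intro: q.hom_closed)
      have "inv\<^bsub>?Q\<^esub> (?q x) \<otimes>\<^bsub>?Q\<^esub> ?q y = ?q y \<otimes>\<^bsub>?Q\<^esub> inv\<^bsub>?Q\<^esub> (?q x)"
        by (rule q.H.inv_comm_of_comm[OF 1(3,1,2)])
      then show "?q (inv x) \<otimes>\<^bsub>?Q\<^esub> ?q y = ?q y \<otimes>\<^bsub>?Q\<^esub> ?q (inv x)"
        using x by (simp add: Z q.hom_inv)
    qed
    fix x' assume x': "x' \<in> ?Z"
    show "x \<otimes> x' \<in> ?Z"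
      unfolding Z
    proof (intro conjI ballI)
      show "x \<otimes> x' \<in> carrier G" using x x' by auto
      fix y assume y: "y \<in> carrier G"
      have "?q x \<in> carrier ?Q" "?q y \<in> carrier ?Q" "?q x' \<in> carrier ?Q"
        "?q x \<otimes>\<^bsub>?Q\<^esub> ?q y = ?q y \<otimes>\<^bsub>?Q\<^esub> ?q x" "?q x' \<otimes>\<^bsub>?Q\<^esub> ?q y = ?q y \<otimes>\<^bsub>?Q\<^esub> ?q x'"
        using x x' y unfolding Z by (auto intro: q.hom_closed)
      moreover have "?q (x \<otimes> x') = ?q x \<otimes>\<^bsub>?Q\<^esub> ?q x'"
        using x x' by (intro q.hom_mult) auto
      ultimately show "?q (x \<otimes> x') \<otimes>\<^bsub>?Q\<^esub> ?q y = ?q y \<otimes>\<^bsub>?Q\<^esub> ?q (x \<otimes> x')"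
        by (metis q.H.m_assoc)
    qed
  qed
  show ?thesis
  proof (rule normal_invI[OF sub])
    fix g x assume g: "g \<in> carrier G" and x: "x \<in> ?Z"
    then have xc: "x \<in> carrier G" by auto
    have 1: "?q x \<in> carrier ?Q" "?q g \<in> carrier ?Q" "?q x \<otimes>\<^bsub>?Q\<^esub> ?q g = ?q g \<otimes>\<^bsub>?Q\<^esub> ?q x"
      using x g unfolding Z by (auto intro: q.hom_closed)
    have "?q (g \<otimes> x \<otimes> inv g) = ?q g \<otimes>\<^bsub>?Q\<^esub> ?q x \<otimes>\<^bsub>?Q\<^esub> inv\<^bsub>?Q\<^esub> (?q g)"
      using xc g by (simp only: q.hom_mult q.hom_inv m_closed inv_closed)
    also have "\<dots> = ?q x"
      using 1 by (simp only: 1(3)[symmetric] q.H.m_assoc q.H.r_inv q.H.r_one q.H.inv_closed)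
    finally have "?q (g \<otimes> x \<otimes> inv g) = ?q x" .
    moreover have "g \<otimes> x \<otimes> inv g \<in> carrier G" using xc g by simp
    ultimately show "g \<otimes> x \<otimes> inv g \<in> ?Z" using x unfolding Z by metis
  qed
qed

lemma (in group) normal_upper_central_series: "upper_central_series G n \<lhd> G"
proof (induction n)
  case 0
  show ?case by (simp add: one_is_normal)
next
  case (Suc n)
  then interpret N: normal "upper_central_series G n" G .
  show ?case using N.normal_centralizer_mod by simp
qed

text \<open>Induction on the distance \<open>j\<close> from the bottom of the lower series:
  commutators of an element of term \<open>c - Suc j\<close> lie in term \<open>c - j\<close>, hence
  by induction in the upper term \<open>j\<close>, which puts the element itself into the upper term
  \<open>Suc j\<close>.\<close>

lemma (in group) upper_central_series_eq_carrier:
  assumes "lower_central_series G c = {\<one>}"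
  shows "upper_central_series G c = carrier G"
proof -
  have sub: "subgroup (upper_central_series G k) G" for k
    by (rule normal_imp_subgroup[OF normal_upper_central_series])
  have "j \<le> c \<Longrightarrow> lower_central_series G (c - j) \<subseteq> upper_central_series G j" for j
  proof (induction j)
    case 0
    then show ?case using assms by simp
  next
    case (Suc j)
    let ?L = "lower_central_series G (c - Suc j)"
    let ?C = "\<Union>x \<in> ?L. \<Union>y \<in> carrier G. {x \<otimes> y \<otimes> inv x \<otimes> inv y}"
    have "c - j = Suc (c - Suc j)" using Suc.prems by simp
    then have L: "lower_central_series G (c - j) = generate G ?C" by simp
    have "?C \<subseteq> generate G ?C" by (rule subsetI, rule generate.incl)
    also have "generate G ?C \<subseteq> upper_central_series G j"
      using Suc.IH[OF Suc_leD[OF Suc.prems]] unfolding L .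
    finally have C: "?C \<subseteq> upper_central_series G j" .
    have "?L \<subseteq> carrier G"
    proof (cases "c - Suc j")
      case (Suc k)
      have "generate G (\<Union>x \<in> lower_central_series G k. \<Union>y \<in> carrier G. {x \<otimes> y \<otimes> inv x \<otimes> inv y})
        \<subseteq> carrier G" if "lower_central_series G k \<subseteq> carrier G" for k
        using that by (intro generate_incl) auto
      then have "lower_central_series G k \<subseteq> carrier G" for k by (induction k) auto
      then show ?thesis .
    qed simp
    then show ?case using C by auto
  qed
  from this[of c] have "carrier G \<subseteq> upper_central_series G c" by simp
  then show ?thesis using subgroup.subset[OF sub] by blast
qed

text \<open>Surjectivity matters because the commutator condition in \<open>H\<close> quantifies
  over all of \<open>carrier H\<close>, so each \<open>Y\<close> has to be lifted to
  \<open>G\<close>. Used to carry nilpotency over to a quotient.\<close>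

lemma (in group_hom) upper_central_series_surj_hom:
  assumes surj: "h ` carrier G = carrier H"
  shows "h ` upper_central_series G n \<subseteq> upper_central_series H n"
proof (induction n)
  case 0
  then show ?case by simp
next
  case (Suc n)
  have "h x \<in> upper_central_series H (Suc n)" if x: "x \<in> upper_central_series G (Suc n)" for x
  proof -
    have xc: "x \<in> carrier G" using x by simp
    have "h x \<otimes>\<^bsub>H\<^esub> Y \<otimes>\<^bsub>H\<^esub> inv\<^bsub>H\<^esub> (h x) \<otimes>\<^bsub>H\<^esub> inv\<^bsub>H\<^esub> Y \<in> upper_central_series H n"
      if "Y \<in> carrier H" for Y
    proof -
      have "Y \<in> h ` carrier G" using that unfolding surj .
      then obtain y where y: "Y = h y" "y \<in> carrier G" by (rule imageE)
      have "x \<otimes> y \<otimes> inv x \<otimes> inv y \<in> upper_central_series G n" using x y by simp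
      then have "h (x \<otimes> y \<otimes> inv x \<otimes> inv y) \<in> upper_central_series H n"
        using Suc by blast
      moreover have "h (x \<otimes> y \<otimes> inv x \<otimes> inv y) =
        h x \<otimes>\<^bsub>H\<^esub> h y \<otimes>\<^bsub>H\<^esub> inv\<^bsub>H\<^esub> (h x) \<otimes>\<^bsub>H\<^esub> inv\<^bsub>H\<^esub> (h y)"
        using xc y by (simp only: hom_mult hom_inv G.m_closed G.inv_closed)
      ultimately show ?thesis using y by simp
    qed
    moreover have "h x \<in> carrier H" using xc by (rule hom_closed)
    ultimately show ?thesis unfolding upper_central_series.simps by blast
  qed
  then show ?case by blast
qed

section \<open>Torsion and finiteness in nilpotent groups\<close>

lemma (in group) commute_generate:
  assumes "S \<subseteq> carrier G" "x \<in> carrier G" "\<And>s. s \<in> S \<Longrightarrow> x \<otimes> s = s \<otimes> x" "y \<in> generate G S"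
  shows "x \<otimes> y = y \<otimes> x"
  using assms(4)
proof (induction rule: generate.induct)
  case one
  show ?case using assms by simp
next
  case (incl h)
  then show ?case using assms by simp
next
  case (inv h)
  then have h: "h \<in> carrier G" "x \<otimes> h = h \<otimes> x" using assms by auto
  then show ?case using assms(2) by (metis inv_comm_of_comm)
next
  case (eng h1 h2)
  then have "h1 \<in> carrier G" "h2 \<in> carrier G" using generate_in_carrier[OF assms(1)] by auto
  then show ?case using eng assms(2) by (metis m_assoc)
qed

text \<open>Moving one \<open>x\<close> past \<open>s\<close> produces one factor \<open>c\<close>,
  and since \<open>c\<close> commutes with both it can be collected in front. Applied in a quotient
  with \<open>c\<close> a commutator: an exponent that kills \<open>c\<close> makes that power of
  \<open>x\<close> commute with \<open>s\<close>.\<close>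

lemma (in group) pow_commute_of_central_commutator:
  assumes "x \<in> carrier G" "s \<in> carrier G" "c \<in> carrier G"
    and "x \<otimes> s = c \<otimes> s \<otimes> x" "c \<otimes> x = x \<otimes> c" "c \<otimes> s = s \<otimes> c"
  shows "x [^] (m::nat) \<otimes> s = c [^] m \<otimes> s \<otimes> x [^] m"
proof (induction m)
  case 0
  show ?case using assms by simp
next
  case (Suc m)
  have cl: "x [^] m \<in> carrier G" "c [^] m \<in> carrier G" using assms by auto
  have cx: "c \<otimes> x [^] m = x [^] m \<otimes> c"
    using group_commutes_pow[of x c m] assms(1,3,5) by simp
  have "x [^] Suc m \<otimes> s = x [^] m \<otimes> (c \<otimes> s \<otimes> x)"
    using assms cl by (simp add: m_assoc)
  also have "\<dots> = c \<otimes> (x [^] m \<otimes> s) \<otimes> x"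
    using assms cl cx by (metis m_assoc m_closed)
  also have "\<dots> = c [^] Suc m \<otimes> s \<otimes> x [^] Suc m"
    unfolding Suc nat_pow_Suc2[OF assms(3)] nat_pow_Suc[of x m] using assms(1-3) cl
    by (simp only: m_assoc m_closed)
  finally show ?case .
qed


text \<open>The torsion of the centre climbs the series. The commutators of \<open>x\<close> with
  the generators lie one term lower than \<open>x\<close>, so powers of them lie two terms lower;
  finitely many generators admit one exponent \<open>k\<close> for all, and then
  \<open>x [^] k\<close> commutes with every generator modulo that term.\<close>

lemma (in group) pow_in_upper_central_series:
  assumes S: "finite S" "S \<subseteq> carrier G" "generate G S = carrier G"
    and center: "\<And>x. x \<in> upper_central_series G 1 \<Longrightarrow> \<exists>m::nat. m > 0 \<and> x [^] m = \<one>"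
    and x: "x \<in> upper_central_series G (Suc n)"
  shows "\<exists>m::nat. m > 0 \<and> x [^] m \<in> upper_central_series G n"
  using x
proof (induction n arbitrary: x)
  case 0
  then show ?case using center[of x] by auto
next
  case (Suc n)
  let ?N = "upper_central_series G n"
  let ?Q = "G Mod ?N" let ?q = "\<lambda>x. ?N #> x"
  interpret N: normal ?N G by (rule normal_upper_central_series)
  interpret q: group_hom G ?Q ?q by (rule N.group_hom_rcoset)
  have xc: "x \<in> carrier G" using Suc.prems by auto
  define d where "d s = x \<otimes> s \<otimes> inv x \<otimes> inv s" for s
  have d: "d s \<in> upper_central_series G (Suc n)" if "s \<in> S" for s
    using Suc.prems that S(2) unfolding d_def by auto
  then have "\<forall>s\<in>S. \<exists>m::nat. m > 0 \<and> d s [^] m \<in> ?N" using Suc.IH by blast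
  then obtain m :: "_ \<Rightarrow> nat" where m: "\<And>s. s \<in> S \<Longrightarrow> m s > 0 \<and> d s [^] m s \<in> ?N" by metis
  \<comment> \<open>A common multiple of all \<open>m s\<close>, so that one exponent serves every
    generator.\<close>
  define k where "k = (\<Prod>s\<in>S. m s)"
  have k0: "k > 0" using m unfolding k_def by (simp add: prod_pos)
  have dk: "d s [^] k \<in> ?N" if s: "s \<in> S" for s
  proof -
    obtain l where "k = m s * l" using S(1) s unfolding k_def by (meson dvd_prodI dvdE)
    moreover have "d s \<in> carrier G" using d[OF s] by auto
    ultimately have "d s [^] k = (d s [^] m s) [^] l" by (simp add: nat_pow_pow)
    also have "\<dots> \<in> ?N"
    proof (induction l)
      case (Suc l)
      then show ?case using m[OF s] by (simp add: N.m_closed)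
    qed (use m[OF s] in simp)
    finally show ?thesis .
  qed
  have comm_s: "?q (x [^] k) \<otimes>\<^bsub>?Q\<^esub> ?q s = ?q s \<otimes>\<^bsub>?Q\<^esub> ?q (x [^] k)" if s: "s \<in> S" for s
  proof -
    have sc: "s \<in> carrier G" and dc: "d s \<in> carrier G" using s S(2) d[OF s] by auto
    have "x \<otimes> s = d s \<otimes> s \<otimes> x" unfolding d_def using xc sc by (simp add: m_assoc)
    then have e: "?q x \<otimes>\<^bsub>?Q\<^esub> ?q s = ?q (d s) \<otimes>\<^bsub>?Q\<^esub> ?q s \<otimes>\<^bsub>?Q\<^esub> ?q x"
      using xc sc dc by (metis m_closed q.hom_mult)
    have c: "?q (d s) \<otimes>\<^bsub>?Q\<^esub> ?q y = ?q y \<otimes>\<^bsub>?Q\<^esub> ?q (d s)" if "y \<in> carrier G" for y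
      using d[OF s] that by (simp only: N.commutator_in_iff[symmetric] dc) simp
    have "?q x [^]\<^bsub>?Q\<^esub> k \<otimes>\<^bsub>?Q\<^esub> ?q s = ?q (d s) [^]\<^bsub>?Q\<^esub> k \<otimes>\<^bsub>?Q\<^esub> ?q s \<otimes>\<^bsub>?Q\<^esub> ?q x [^]\<^bsub>?Q\<^esub> k"
      by (rule q.H.pow_commute_of_central_commutator[OF _ _ _ e c[OF xc] c[OF sc]])
        (use xc sc dc in \<open>auto intro: q.hom_closed\<close>)
    moreover have "?q (d s) [^]\<^bsub>?Q\<^esub> k = \<one>\<^bsub>?Q\<^esub>"
    proof -
      have "?q (d s) [^]\<^bsub>?Q\<^esub> k = ?q (d s [^] k)" using dc by (simp only: q.hom_nat_pow)
      also have "\<dots> = ?N" using dk[OF s] by (rule N.rcos_const[OF is_group])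
      finally show ?thesis by simp
    qed
    moreover have "?q x [^]\<^bsub>?Q\<^esub> k = ?q (x [^] k)" using xc by (simp only: q.hom_nat_pow)
    moreover have "?q s \<in> carrier ?Q" using sc by (rule q.hom_closed)
    ultimately show ?thesis by (simp only: q.H.l_one)
  qed
  have "x [^] k \<in> upper_central_series G (Suc n)"
  proof -
    have "?q (x [^] k) \<otimes>\<^bsub>?Q\<^esub> ?q y = ?q y \<otimes>\<^bsub>?Q\<^esub> ?q (x [^] k)" if "y \<in> carrier G" for y
    proof (rule q.H.commute_generate[of "?q ` S"])
      show "?q ` S \<subseteq> carrier ?Q" using S(2) q.hom_closed by blast
      show "?q (x [^] k) \<in> carrier ?Q" using xc by (intro q.hom_closed nat_pow_closed)
      show "?q y \<in> generate ?Q (?q ` S)"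
        using q.generate_img[OF S(2)] that S(3) by blast
    qed (use comm_s in blast)
    then have "x [^] k \<otimes> y \<otimes> inv (x [^] k) \<otimes> inv y \<in> ?N" if "y \<in> carrier G" for y
      using N.commutator_in_iff[OF nat_pow_closed[OF xc] that] that by blast
    then show ?thesis using xc by simp
  qed
  then show ?case using k0 by blast
qed

lemma (in group) torsion_of_center_torsion:
  assumes S: "finite S" "S \<subseteq> carrier G" "generate G S = carrier G"
    and center: "\<And>x. x \<in> upper_central_series G 1 \<Longrightarrow> \<exists>m::nat. m > 0 \<and> x [^] m = \<one>"
    and nil: "upper_central_series G c = carrier G"
    and x: "x \<in> carrier G"
  shows "\<exists>m::nat. m > 0 \<and> x [^] m = \<one>"
proof -
  have "x \<in> upper_central_series G n \<Longrightarrow> \<exists>m::nat. m > 0 \<and> x [^] m = \<one>" for n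
  proof (induction n arbitrary: x)
    case 0
    then show ?case by (intro exI[of _ 1]) auto
  next
    case (Suc n)
    have xc: "x \<in> carrier G" using Suc.prems by auto
    obtain m :: nat where m: "m > 0" "x [^] m \<in> upper_central_series G n"
      using pow_in_upper_central_series[OF S center Suc.prems] by blast
    then obtain l :: nat where "l > 0" "(x [^] m) [^] l = \<one>" using Suc.IH by blast
    then show ?case using m xc by (intro exI[of _ "m * l"]) (auto simp: nat_pow_pow)
  qed
  then show ?thesis using x nil by auto
qed

text \<open>In a torsion group the inverse of a generator is a nonnegative power of it, so stability
  under right multiplication by generators already gives stability under their inverses.\<close>

lemma (in group) carrier_subset_of_right_closed:
  assumes S: "S \<subseteq> carrier G" "generate G S = carrier G"
    and torsion: "\<And>x. x \<in> carrier G \<Longrightarrow> \<exists>m::nat. m > 0 \<and> x [^] m = \<one>"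
    and Y: "Y \<subseteq> carrier G" "\<one> \<in> Y" "\<And>y s. y \<in> Y \<Longrightarrow> s \<in> S \<Longrightarrow> y \<otimes> s \<in> Y"
  shows "carrier G \<subseteq> Y"
proof
  fix g assume "g \<in> carrier G"
  then have g: "g \<in> generate G S" using S by simp
  have "\<forall>y\<in>Y. y \<otimes> g \<in> Y"
    using g
  proof (induction rule: generate.induct)
    case one
    then show ?case using Y by auto
  next
    case (incl h)
    then show ?case using Y by auto
  next
    case (inv h)
    then have h: "h \<in> carrier G" using S by auto
    obtain m :: nat where m: "m > 0" "h [^] m = \<one>" using torsion[OF h] by blast
    then obtain k where k: "m = Suc k" by (cases m) auto
    have "inv h = h [^] k"
      using m h unfolding k by (metis inv_equality nat_pow_Suc nat_pow_closed)
    moreover have "y \<otimes> h [^] k \<in> Y" if "y \<in> Y" for y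
    proof (induction k)
      case 0
      then show ?case using that Y by auto
    next
      case (Suc k)
      have "y \<in> carrier G" using that Y by auto
      then show ?case using Y(3)[OF Suc inv] h by (simp add: m_assoc)
    qed
    ultimately show ?case by simp
  next
    case (eng h1 h2)
    then have "h1 \<in> carrier G" "h2 \<in> carrier G" using generate_in_carrier[OF S(1)] by auto
    then show ?case using eng Y(1) by (metis m_assoc subsetD)
  qed
  then have "\<one> \<otimes> g \<in> Y" using Y by blast
  then show "g \<in> Y" using \<open>g \<in> carrier G\<close> by simp
qed

text \<open>Stands in for the finiteness of the subgroup generated by \<open>C\<close>. A new
  element \<open>c\<close> is adjoined by multiplying with its powers below some exponent
  \<open>m\<close> with \<open>c [^] m = \<one>\<close>; as \<open>c\<close> is central, the powers
  stay in front.\<close>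

lemma (in group) finite_closure_of_central_torsion:
  assumes "finite C" "C \<subseteq> Z"
    and Z: "Z = {a \<in> carrier G. \<forall>x\<in>carrier G. a \<otimes> x = x \<otimes> a}"
    and torsion: "\<And>x. x \<in> carrier G \<Longrightarrow> \<exists>m::nat. m > 0 \<and> x [^] m = \<one>"
  shows "\<exists>B. finite B \<and> B \<subseteq> carrier G \<and> \<one> \<in> B \<and> (\<forall>b\<in>B. \<forall>c\<in>C. b \<otimes> c \<in> B)"
  using assms(1,2)
proof (induction rule: finite_induct)
  case empty
  show ?case by (intro exI[of _ "{\<one>}"]) auto
next
  case (insert c C)
  then obtain B where B: "finite B" "B \<subseteq> carrier G" "\<one> \<in> B" "\<And>b c. b \<in> B \<Longrightarrow> c \<in> C \<Longrightarrow> b \<otimes> c \<in> B"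
    by blast
  have c: "c \<in> carrier G" "\<And>x. x \<in> carrier G \<Longrightarrow> c \<otimes> x = x \<otimes> c" using insert.prems Z by auto
  obtain m :: nat where m: "m > 0" "c [^] m = \<one>" using torsion[OF c(1)] by blast
  define B' where "B' = (\<lambda>(k, b). c [^] k \<otimes> b) ` ({..<m} \<times> B)"
  have in_B': "c [^] k \<otimes> b \<in> B'" if "k < m" "b \<in> B" for k :: nat and b
    using that unfolding B'_def by (auto intro!: image_eqI[of _ _ "(k, b)"])
  show ?case
  proof (intro exI[of _ B'] conjI ballI)
    show "finite B'" unfolding B'_def using B(1) by auto
    show "B' \<subseteq> carrier G" unfolding B'_def using B(2) c(1) by auto
    show "\<one> \<in> B'" using in_B'[of 0 \<one>] m(1) B(3) by simp
    fix b' c' assume "b' \<in> B'" "c' \<in> insert c C"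
    then obtain k b where k: "k < m" "b \<in> B" "b' = c [^] k \<otimes> b" unfolding B'_def by auto
    have bc: "b \<in> carrier G" "c [^] k \<in> carrier G" using k B c by auto
    show "b' \<otimes> c' \<in> B'"
    proof (cases "c' = c")
      case True
      have "b' \<otimes> c' = c [^] k \<otimes> (c \<otimes> b)" using bc c k True by (simp add: m_assoc)
      also have "\<dots> = c [^] Suc k \<otimes> b" using bc c by (simp add: m_assoc)
      \<comment> \<open>At \<open>Suc k = m\<close> the power wraps round to \<open>\<one>\<close>,
        that is, to exponent 0.\<close>
      also have "\<dots> \<in> B'"
        using in_B'[of "Suc k" b] in_B'[of 0 b] m k by (cases "Suc k = m") auto
      finally show ?thesis .
    next
      case False
      then have c': "c' \<in> C" "c' \<in> carrier G" using \<open>c' \<in> insert c C\<close> insert.prems Z by auto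
      then have "b' \<otimes> c' = c [^] k \<otimes> (b \<otimes> c')" using bc k by (simp add: m_assoc)
      also have "\<dots> \<in> B'" using in_B' k B(4) c' by blast
      finally show ?thesis .
    qed
  qed
qed

text \<open>
  Schreier's argument: the elements \<open>a\<close> in \<open>t s = t' a\<close>, with \<open>t, t'\<close> coset representatives and
  \<open>s\<close> a generator, generate a finite central subgroup of finite index.
\<close>

lemma (in group) finite_of_central_finite_index:
  assumes S: "finite S" "S \<subseteq> carrier G" "generate G S = carrier G"
    and torsion: "\<And>x. x \<in> carrier G \<Longrightarrow> \<exists>m::nat. m > 0 \<and> x [^] m = \<one>"
    and Z: "Z = {a \<in> carrier G. \<forall>x\<in>carrier G. a \<otimes> x = x \<otimes> a}"
    and T: "finite T" "T \<subseteq> carrier G" "\<And>x. x \<in> carrier G \<Longrightarrow> \<exists>t\<in>T. \<exists>a\<in>Z. x = t \<otimes> a"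
  shows "finite (carrier G)"
proof -
  have "\<forall>x. \<exists>t a. x \<in> carrier G \<longrightarrow> t \<in> T \<and> a \<in> Z \<and> x = t \<otimes> a" using T(3) by blast
  then obtain t a where ta: "\<And>x. x \<in> carrier G \<Longrightarrow> t x \<in> T \<and> a x \<in> Z \<and> x = t x \<otimes> a x"
    by metis
  \<comment> \<open>The element \<open>a \<one>\<close> is added so that
    \<open>\<one> = t \<one> \<otimes> a \<one>\<close> becomes a member of \<open>Y\<close>,
    whichever representative \<open>t \<one>\<close> is.\<close>
  define C where "C = insert (a \<one>) ((\<lambda>(t, s). a (t \<otimes> s)) ` (T \<times> S))"
  have "finite C" unfolding C_def using T S by auto
  moreover have "C \<subseteq> Z"
  proof -
    have aZ: "a x \<in> Z" if "x \<in> carrier G" for x using ta[OF that] by simp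
    have "a (t \<otimes> s) \<in> Z" if "t \<in> T" "s \<in> S" for t s
      using that T(2) S(2) by (intro aZ m_closed) auto
    then show ?thesis using aZ[OF one_closed] unfolding C_def by auto
  qed
  ultimately obtain B where B: "finite B" "B \<subseteq> carrier G" "\<one> \<in> B"
    "\<And>b c. b \<in> B \<Longrightarrow> c \<in> C \<Longrightarrow> b \<otimes> c \<in> B"
    using finite_closure_of_central_torsion[OF _ _ Z torsion] by metis
  have Zc: "z \<in> carrier G" "\<And>x. x \<in> carrier G \<Longrightarrow> z \<otimes> x = x \<otimes> z" if "z \<in> Z" for z
    using that Z by auto
  \<comment> \<open>\<open>B\<close> is only known to lie in the carrier; intersecting with
    \<open>Z\<close> keeps the second factor central, so that it can be moved past the next
    generator.\<close>
  define Y where "Y = (\<lambda>(t, b). t \<otimes> b) ` (T \<times> (B \<inter> Z))"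
  have "carrier G \<subseteq> Y"
  proof (rule carrier_subset_of_right_closed[OF S(2,3) torsion])
    show "Y \<subseteq> carrier G" unfolding Y_def using T B by auto
    have Z1: "\<one> \<in> Z" using Z by auto
    have a1: "a \<one> \<in> B" using B(4)[OF B(3), of "a \<one>"] ta[of \<one>] Zc[of "a \<one>"] unfolding C_def by auto
    have "\<one> = t \<one> \<otimes> a \<one>" "t \<one> \<in> T" "a \<one> \<in> Z" using ta[of \<one>] by auto
    then show "\<one> \<in> Y" unfolding Y_def using a1 by (intro image_eqI[of _ _ "(t \<one>, a \<one>)"]) auto
    fix y s assume "y \<in> Y" and s: "s \<in> S"
    then obtain r b where r: "r \<in> T" "b \<in> B" "b \<in> Z" "y = r \<otimes> b" unfolding Y_def by auto
    have cl: "r \<in> carrier G" "s \<in> carrier G" "b \<in> carrier G" using r s S T B by auto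
    let ?x = "r \<otimes> s"
    have x: "t ?x \<in> T" "a ?x \<in> Z" "?x = t ?x \<otimes> a ?x" using ta[of ?x] cl by auto
    have tc: "t ?x \<in> carrier G" "a ?x \<in> carrier G" using x T Zc by auto
    have ba: "b \<otimes> a ?x \<in> B" using B(4)[OF r(2)] r(1) s unfolding C_def by auto
    have "(b \<otimes> a ?x) \<otimes> y = y \<otimes> (b \<otimes> a ?x)" if y: "y \<in> carrier G" for y
    proof -
      have "(b \<otimes> a ?x) \<otimes> y = b \<otimes> (y \<otimes> a ?x)"
        using y cl(3) tc(2) Zc(2)[OF x(2) y] by (simp only: m_assoc)
      also have "\<dots> = (b \<otimes> y) \<otimes> a ?x" using y cl(3) tc(2) by (simp only: m_assoc)
      also have "\<dots> = y \<otimes> (b \<otimes> a ?x)"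
        using y cl(3) tc(2) Zc(2)[OF r(3) y] by (simp only: m_assoc)
      finally show ?thesis .
    qed
    then have baZ: "b \<otimes> a ?x \<in> Z" unfolding Z using cl(3) tc(2) by simp
    have "y \<otimes> s = ?x \<otimes> b" using r cl Zc[OF r(3)] by (simp add: m_assoc)
    also have "\<dots> = t ?x \<otimes> (b \<otimes> a ?x)"
      using tc cl(3) Zc(2)[OF r(3) tc(2)] by (subst x(3)) (simp only: m_assoc)
    finally show "y \<otimes> s \<in> Y" unfolding Y_def using x(1) ba baZ
      by (intro image_eqI[of _ _ "(t ?x, b \<otimes> a ?x)"]) auto
  qed
  moreover have "finite Y" unfolding Y_def using T B by auto
  ultimately show ?thesis by (rule finite_subset)
qed


text \<open>Descends from the quotient by the whole group to the quotient by the trivial one. Modulo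
  term \<open>i\<close> of the upper series, term \<open>Suc i\<close> becomes central, and its
  index is finite by the previous stage, so \<open>finite_of_central_finite_index\<close> applies to
  the quotient.\<close>

lemma (in group) finite_of_torsion_nilpotent:
  assumes S: "finite S" "S \<subseteq> carrier G" "generate G S = carrier G"
    and torsion: "\<And>x. x \<in> carrier G \<Longrightarrow> \<exists>m::nat. m > 0 \<and> x [^] m = \<one>"
    and nil: "upper_central_series G c = carrier G"
  shows "finite (carrier G)"
proof -
  have Mod_carrier: "carrier (G Mod N) = (\<lambda>x. N #> x) ` carrier G" for N
    by (auto simp: FactGroup_def RCOSETS_def)
  have "j \<le> c \<Longrightarrow> finite (carrier (G Mod upper_central_series G (c - j)))" for j
  proof (induction j)
    case 0
    have "carrier (G Mod carrier G) \<subseteq> {carrier G}"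
      unfolding Mod_carrier using coset_join2[OF _ subgroup_self] by auto
    then show ?case using nil finite_subset by auto
  next
    case (Suc j)
    define i where "i = c - Suc j"
    have ci: "c - j = Suc i" using Suc.prems by (simp add: i_def)
    define N M where NM: "N = upper_central_series G i" "M = upper_central_series G (Suc i)"
    let ?Q = "G Mod N" let ?q = "\<lambda>x. N #> x"
    interpret N: normal N G unfolding NM by (rule normal_upper_central_series)
    interpret M: normal M G unfolding NM by (rule normal_upper_central_series)
    interpret q: group_hom G ?Q ?q by (rule N.group_hom_rcoset)
    have fin: "finite (carrier (G Mod M))" using Suc.IH[OF Suc_leD[OF Suc.prems]] unfolding ci NM .
    define r where "r C = (SOME x. x \<in> carrier G \<and> C = M #> x)" for C
    have r: "r C \<in> carrier G \<and> C = M #> r C" if "C \<in> carrier (G Mod M)" for C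
      unfolding r_def by (rule someI_ex) (use that in \<open>unfold Mod_carrier, blast\<close>)
    define Z where "Z = {a \<in> carrier ?Q. \<forall>X\<in>carrier ?Q. a \<otimes>\<^bsub>?Q\<^esub> X = X \<otimes>\<^bsub>?Q\<^esub> a}"
    have "finite (carrier ?Q)"
    proof (rule q.H.finite_of_central_finite_index[of "?q ` S" Z "?q ` r ` carrier (G Mod M)"])
      show "finite (?q ` S)" using S by simp
      show "?q ` S \<subseteq> carrier ?Q" using S(2) q.hom_closed by blast
      show "generate ?Q (?q ` S) = carrier ?Q"
        using q.generate_img[OF S(2)] S(3) Mod_carrier by metis
      show "Z = {a \<in> carrier ?Q. \<forall>X\<in>carrier ?Q. a \<otimes>\<^bsub>?Q\<^esub> X = X \<otimes>\<^bsub>?Q\<^esub> a}"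
        by (rule Z_def)
      show "finite (?q ` r ` carrier (G Mod M))" using fin by simp
      show "?q ` r ` carrier (G Mod M) \<subseteq> carrier ?Q" using r q.hom_closed by blast
    next
      fix X assume "X \<in> carrier ?Q"
      then obtain x where x: "X = ?q x" "x \<in> carrier G" unfolding Mod_carrier by (rule imageE)
      obtain m :: nat where m: "m > 0" "x [^] m = \<one>" using torsion[OF x(2)] by blast
      have "X [^]\<^bsub>?Q\<^esub> m = ?q (x [^] m)" unfolding x(1) using x(2) by (simp only: q.hom_nat_pow)
      then show "\<exists>m::nat. m > 0 \<and> X [^]\<^bsub>?Q\<^esub> m = \<one>\<^bsub>?Q\<^esub>"
        using m q.hom_one by (intro exI[of _ m]) simp
      let ?C = "M #> x"
      have C: "?C \<in> carrier (G Mod M)" unfolding Mod_carrier using x(2) by blast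
      have rC: "r ?C \<in> carrier G" "M #> x = M #> r ?C" using r[OF C] by blast+
      \<comment> \<open>Cosets are right cosets, so the representative comes second:
        \<open>x = a \<otimes> r ?C\<close> with \<open>a\<close> in \<open>M\<close>. Modulo
        \<open>N\<close> the class of \<open>a\<close> is central, which allows the two factors to
        be swapped.\<close>
      define a where "a = x \<otimes> inv (r ?C)"
      have ac: "a \<in> carrier G" unfolding a_def using x(2) rC(1) by simp
      have aM: "a \<in> M" unfolding a_def using M.rcos_eq_iff[OF x(2) rC(1)] rC(2) by blast
      have comm: "?q a \<otimes>\<^bsub>?Q\<^esub> ?q y = ?q y \<otimes>\<^bsub>?Q\<^esub> ?q a" if "y \<in> carrier G" for y
        using aM that N.commutator_in_iff[OF ac that] unfolding NM by auto
      have "?q a \<in> Z"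
        unfolding Z_def
      proof (intro CollectI conjI ballI)
        show "?q a \<in> carrier ?Q" by (rule q.hom_closed[OF ac])
        fix X assume "X \<in> carrier ?Q"
        then obtain y where "X = ?q y" "y \<in> carrier G" unfolding Mod_carrier by (rule imageE)
        then show "?q a \<otimes>\<^bsub>?Q\<^esub> X = X \<otimes>\<^bsub>?Q\<^esub> ?q a" using comm by simp
      qed
      moreover have "X = ?q (r ?C) \<otimes>\<^bsub>?Q\<^esub> ?q a"
      proof -
        have "x = a \<otimes> r ?C" unfolding a_def using x(2) rC(1) by (simp add: m_assoc)
        then have "X = ?q (a \<otimes> r ?C)" using x(1) by simp
        also have "\<dots> = ?q a \<otimes>\<^bsub>?Q\<^esub> ?q (r ?C)" using ac rC(1) by (rule q.hom_mult)
        finally show ?thesis using comm[OF rC(1)] by simp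
      qed
      ultimately show "\<exists>t\<in>?q ` r ` carrier (G Mod M). \<exists>a\<in>Z. X = t \<otimes>\<^bsub>?Q\<^esub> a"
        using C by blast
    qed
    then show ?case unfolding i_def NM .
  qed
  \<comment> \<open>The quotient by term 0 is a copy of \<open>G\<close>.\<close>
  from this[of c] have "finite ((\<lambda>x. {\<one>} #> x) ` carrier G)" unfolding Mod_carrier by simp
  moreover have "inj_on (\<lambda>x. {\<one>} #> x) (carrier G)"
    by (rule inj_onI) (auto simp: r_coset_def)
  ultimately show ?thesis by (rule finite_imageD)
qed

section \<open>Normal subgroups avoiding a finite set\<close>

lemma (in group) maximal_normal_avoiding:
  assumes "\<one> \<notin> F"
  obtains M where "M \<lhd> G" "M \<inter> F = {}" "\<And>N. N \<lhd> G \<Longrightarrow> N \<inter> F = {} \<Longrightarrow> M \<subseteq> N \<Longrightarrow> N = M"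
proof -
  let ?A = "{N. N \<lhd> G \<and> N \<inter> F = {}}"
  have "\<exists>M\<in>?A. \<forall>N\<in>?A. M \<subseteq> N \<longrightarrow> N = M"
  \<comment> \<open>Normality and disjointness from \<open>F\<close> both survive unions of chains,
    and \<open>{\<one>}\<close> is a starting point because
    \<open>\<one> \<notin> F\<close>.\<close>
  proof (rule subset_Zorn_nonempty)
    have "{\<one>} \<in> ?A" using assms one_is_normal by auto
    then show "?A \<noteq> {}" by blast
    fix C assume C: "C \<noteq> {}" "subset.chain ?A C"
    then have CA: "N \<lhd> G" "N \<inter> F = {}" if "N \<in> C" for N
      using that unfolding subset_chain_def by auto
    have sub: "subgroup N G" if "N \<in> C" for N using CA(1)[OF that] by (rule normal_imp_subgroup)
    have "subgroup (\<Union>C) G"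
    proof
      show "\<Union>C \<subseteq> carrier G" using subgroup.subset[OF sub] by blast
      show "\<one> \<in> \<Union>C" using C(1) subgroup.one_closed[OF sub] by blast
      fix x assume "x \<in> \<Union>C"
      then obtain N where N: "N \<in> C" "x \<in> N" by blast
      then show "inv x \<in> \<Union>C" using subgroup.m_inv_closed[OF sub] by blast
      fix y assume "y \<in> \<Union>C"
      then obtain N' where N': "N' \<in> C" "y \<in> N'" by blast
      have "N \<subseteq> N' \<or> N' \<subseteq> N" using C(2) N(1) N'(1) unfolding subset_chain_def by blast
      then show "x \<otimes> y \<in> \<Union>C"
        using N N' subgroup.m_closed[OF sub[OF N(1)]] subgroup.m_closed[OF sub[OF N'(1)]] by blast
    qed
    then have "\<Union>C \<lhd> G"
    proof (rule normal_invI)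
      fix g h assume g: "g \<in> carrier G" and "h \<in> \<Union>C"
      then obtain N where N: "N \<in> C" "h \<in> N" by blast
      then show "g \<otimes> h \<otimes> inv g \<in> \<Union>C" using normal.inv_op_closed2[OF CA(1)[OF N(1)] g N(2)] by blast
    qed
    moreover have "\<Union>C \<inter> F = {}" using CA(2) by blast
    ultimately show "\<Union>C \<in> ?A" by simp
  qed
  then show thesis using that by auto
qed

lemma (in group_hom) normal_vimage:
  assumes "L \<lhd> H"
  shows "{x \<in> carrier G. h x \<in> L} \<lhd> G"
proof -
  interpret L: normal L H by fact
  have "subgroup {x \<in> carrier G. h x \<in> L} G"
    by standard (auto simp: L.m_closed)
  then show ?thesis
  proof (rule G.normal_invI)
    fix g x assume g: "g \<in> carrier G" and x: "x \<in> {x \<in> carrier G. h x \<in> L}"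
    then have "h (g \<otimes> x \<otimes> inv g) = h g \<otimes>\<^bsub>H\<^esub> h x \<otimes>\<^bsub>H\<^esub> inv\<^bsub>H\<^esub> (h g)" by simp
    also have "\<dots> \<in> L" using g x by (intro L.inv_op_closed2) auto
    finally show "g \<otimes> x \<otimes> inv g \<in> {x \<in> carrier G. h x \<in> L}" using g x by simp
  qed
qed

text \<open>An element \<open>z\<close> of infinite order would have a power \<open>z\<^sup>n\<close> whose span misses \<open>F\<close>.\<close>

lemma (in group) center_torsion_of_normal_meets:
  assumes F: "finite F" "\<one> \<notin> F"
    and meets: "\<And>L. L \<lhd> G \<Longrightarrow> L \<noteq> {\<one>} \<Longrightarrow> L \<inter> F \<noteq> {}"
    and z: "z \<in> carrier G" "\<And>x. x \<in> carrier G \<Longrightarrow> z \<otimes> x = x \<otimes> z"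
  shows "\<exists>m::nat. m > 0 \<and> z [^] m = \<one>"
proof (rule ccontr)
  assume "\<not> ?thesis"
  then have inf: "z [^] (m::nat) \<noteq> \<one>" if "m > 0" for m using that by blast
  have inf': "z [^] (k::int) \<noteq> \<one>" if k: "k \<noteq> 0" for k
  proof
    assume e: "z [^] k = \<one>"
    have "z [^] (- k) = \<one>" using e z(1) int_pow_neg by simp
    then have "z [^] \<bar>k\<bar> = \<one>" using e by (simp add: abs_if)
    then have "z [^] nat \<bar>k\<bar> = \<one>" by (metis abs_ge_zero int_nat_eq int_pow_int)
    then show False using inf[of "nat \<bar>k\<bar>"] k by simp
  qed
  have "inj (\<lambda>k::int. z [^] k)"
  proof (rule injI)
    fix i j :: int assume "z [^] i = z [^] j"
    then have "z [^] (i - j) = \<one>" using z(1) by (simp add: int_pow_diff)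
    then show "i = j" using inf'[of "i - j"] by auto
  qed
  then have fin: "finite {k::int. z [^] k \<in> F}" using F(1) finite_vimageI[of F "\<lambda>k::int. z [^] k"]
    by (simp add: vimage_def)
  then obtain n :: nat where n: "\<And>k. z [^] (k::int) \<in> F \<Longrightarrow> nat \<bar>k\<bar> \<le> n"
    using finite_nat_set_iff_bounded_le[of "(\<lambda>k. nat \<bar>k\<bar>) ` {k::int. z [^] k \<in> F}"] by auto
  \<comment> \<open>Exponents of \<open>z\<close> that hit \<open>F\<close> are at most
    \<open>n\<close> in absolute value, while the powers of \<open>w\<close> other than
    \<open>\<one>\<close> have exponents that are nonzero multiples of \<open>Suc n\<close>.\<close>
  define w where "w = z [^] Suc n"
  have w: "w \<in> carrier G" unfolding w_def using z by simp
  have wc: "w \<otimes> x = x \<otimes> w" if "x \<in> carrier G" for x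
    unfolding w_def by (rule group_commutes_pow) (use z that in auto)
  have "generate G {w} \<lhd> G"
  proof (rule normal_generateI)
    fix h g assume "h \<in> {w}" and g: "g \<in> carrier G"
    then have "g \<otimes> h \<otimes> inv g = w" using w wc[OF g, symmetric] by (simp add: m_assoc)
    then show "g \<otimes> h \<otimes> inv g \<in> {w}" by simp
  qed (use w in simp)
  moreover have "generate G {w} \<noteq> {\<one>}"
    using generate.incl[of w "{w}" G] inf[of "Suc n"] unfolding w_def by auto
  ultimately obtain f where "f \<in> generate G {w}" "f \<in> F" using meets by blast
  then obtain k :: int where k: "w [^] k \<in> F" using generate_pow[OF w] by auto
  have "w [^] k = z [^] (int (Suc n) * k)"
    unfolding w_def using z(1) by (simp only: int_pow_int[symmetric] int_pow_pow)
  then have "nat \<bar>int (Suc n) * k\<bar> \<le> n" using n k by simp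
  then have "int (Suc n) * \<bar>k\<bar> \<le> int n" by (simp add: abs_mult)
  moreover have "int (Suc n) * 1 \<le> int (Suc n) * \<bar>k\<bar>" if "k \<noteq> 0"
    using that by (intro mult_left_mono) auto
  ultimately have "k = 0" unfolding mult_1_right of_nat_Suc by linarith
  then show False using k F(2) by simp
qed

lemma (in group) residually_finite_of_nilpotent:
  assumes S: "finite S" "S \<subseteq> carrier G" "generate G S = carrier G"
    and nil: "upper_central_series G c = carrier G"
    and F: "finite F" "F \<subseteq> carrier G" "\<one> \<notin> F"
  obtains N where "N \<lhd> G" "finite (carrier (G Mod N))" "N \<inter> F = {}"
proof -
  obtain M where M: "M \<lhd> G" "M \<inter> F = {}"
    and max: "\<And>N. N \<lhd> G \<Longrightarrow> N \<inter> F = {} \<Longrightarrow> M \<subseteq> N \<Longrightarrow> N = M"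
    using maximal_normal_avoiding[OF F(3)] by blast
  let ?Q = "G Mod M" let ?q = "\<lambda>x. M #> x"
  interpret M: normal M G by (rule M(1))
  interpret q: group_hom G ?Q ?q by (rule M.group_hom_rcoset)
  have one: "\<one>\<^bsub>?Q\<^esub> = M" by simp
  have surj: "?q ` carrier G = carrier ?Q" by (auto simp: FactGroup_def RCOSETS_def)
  have ker: "?q x = M \<longleftrightarrow> x \<in> M" if "x \<in> carrier G" for x
    using that M.rcos_const[OF is_group] coset_join1[OF _ that M.is_subgroup] by blast
  have SQ: "finite (?q ` S)" "?q ` S \<subseteq> carrier ?Q" "generate ?Q (?q ` S) = carrier ?Q"
    using S surj q.generate_img[OF S(2)] by (auto simp del: q.hom_mult)
  have "upper_central_series ?Q c \<subseteq> carrier ?Q"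
    by (rule subgroup.subset[OF normal_imp_subgroup[OF q.H.normal_upper_central_series]])
  then have nilQ: "upper_central_series ?Q c = carrier ?Q"
    using q.upper_central_series_surj_hom[OF surj, of c] unfolding nil surj by (rule subset_antisym)
  \<comment> \<open>Maximality of \<open>M\<close> read in the quotient: if \<open>L\<close> missed
    the image of \<open>F\<close>, its preimage would be a normal subgroup above \<open>M\<close>
    missing \<open>F\<close>, hence equal to \<open>M\<close>, and \<open>L\<close> would be
    trivial.\<close>
  have meets: "L \<inter> ?q ` F \<noteq> {}" if L: "L \<lhd> ?Q" "L \<noteq> {\<one>\<^bsub>?Q\<^esub>}" for L
  proof
    assume "L \<inter> ?q ` F = {}"
    let ?P = "{x \<in> carrier G. ?q x \<in> L}"
    interpret L: normal L ?Q by (rule L(1))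
    have "?P \<inter> F = {}" using \<open>L \<inter> ?q ` F = {}\<close> by blast
    moreover have "M \<subseteq> ?P"
    proof
      fix x assume "x \<in> M"
      then show "x \<in> ?P" using ker[of x] L.one_closed M.subset unfolding one by auto
    qed
    ultimately have P: "?P = M" using max[OF q.normal_vimage[OF L(1)]] by blast
    have "X = \<one>\<^bsub>?Q\<^esub>" if "X \<in> L" for X
    proof -
      have "X \<in> ?q ` carrier G" using that L.subset unfolding surj by blast
      then obtain x where x: "X = ?q x" "x \<in> carrier G" by (rule imageE)
      then show ?thesis using P that ker unfolding one by blast
    qed
    then show False using L(2) L.one_closed by blast
  qed
  have "\<exists>m::nat. m > 0 \<and> z [^]\<^bsub>?Q\<^esub> m = \<one>\<^bsub>?Q\<^esub>" if z: "z \<in> upper_central_series ?Q 1" for z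
  proof (rule q.H.center_torsion_of_normal_meets[OF _ _ meets])
    show "finite (?q ` F)" using F by simp
    show "\<one>\<^bsub>?Q\<^esub> \<notin> ?q ` F" using M(2) F(2) ker unfolding one by blast
    show zc: "z \<in> carrier ?Q" using z by simp
    fix x assume x: "x \<in> carrier ?Q"
    have "z \<otimes>\<^bsub>?Q\<^esub> x \<otimes>\<^bsub>?Q\<^esub> inv\<^bsub>?Q\<^esub> z \<otimes>\<^bsub>?Q\<^esub> inv\<^bsub>?Q\<^esub> x = \<one>\<^bsub>?Q\<^esub>"
      using z x by (simp del: one_FactGroup mult_FactGroup)
    then have "(z \<otimes>\<^bsub>?Q\<^esub> x) \<otimes>\<^bsub>?Q\<^esub> inv\<^bsub>?Q\<^esub> (x \<otimes>\<^bsub>?Q\<^esub> z) = \<one>\<^bsub>?Q\<^esub>"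
      using zc x by (simp only: q.H.inv_mult_group q.H.m_assoc q.H.m_closed q.H.inv_closed)
    then show "z \<otimes>\<^bsub>?Q\<^esub> x = x \<otimes>\<^bsub>?Q\<^esub> z"
      using zc x q.H.inv_equality q.H.inv_inv by (metis q.H.inv_closed q.H.m_closed)
  qed assumption+
  then have "finite (carrier ?Q)"
    by (intro q.H.finite_of_torsion_nilpotent[OF SQ q.H.torsion_of_center_torsion[OF SQ _ nilQ] nilQ])
  then show thesis using that M by blast
qed

section \<open>Linear algebra in sequence spaces\<close>

lemma sum_fun_apply: "(\<Sum>b\<in>B. f b) i = (\<Sum>b\<in>B. f b i)" for f :: "'b \<Rightarrow> 'i \<Rightarrow> 'c::comm_monoid_add"
  by (induction B rule: infinite_finite_induct) auto

lemma fscale_apply: "fscale c x i = c * x i"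
  by (simp add: fscale_def)

text \<open>Termwise, twice the product of two moduli is at most the sum of their squares.\<close>

lemma ell2_abs_summable:
  assumes "x \<in> ell2 I" "y \<in> ell2 J"
  shows "(\<lambda>i. norm (x i * cnj (y i))) summable_on UNIV"
proof (rule Infinite_Sum.abs_summable_on_comparison_test')
  show "(\<lambda>i. (cmod (x i))\<^sup>2 + (cmod (y i))\<^sup>2) summable_on UNIV"
    using assms by (intro summable_on_add) (auto simp: ell2_def)
  fix i
  have "0 \<le> (cmod (x i) - cmod (y i))\<^sup>2" by simp
  then have "2 * (cmod (x i) * cmod (y i)) \<le> (cmod (x i))\<^sup>2 + (cmod (y i))\<^sup>2"
    by (simp add: power2_eq_square algebra_simps)
  moreover have "0 \<le> cmod (x i) * cmod (y i)" by simp
  ultimately show "norm (x i * cnj (y i)) \<le> (cmod (x i))\<^sup>2 + (cmod (y i))\<^sup>2"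
    unfolding norm_mult complex_mod_cnj by linarith
qed

lemmas ell2_summable = abs_summable_summable[OF ell2_abs_summable]

lemma ell2_subspace: "fvs.subspace (ell2 I)"
proof (rule fvs.subspaceI)
  show "0 \<in> ell2 I" by (simp add: ell2_def)
  fix x y assume xy: "x \<in> ell2 I" "y \<in> ell2 I"
  have "(\<lambda>i. norm ((cmod (x i + y i))\<^sup>2)) summable_on UNIV"
  proof (rule Infinite_Sum.abs_summable_on_comparison_test')
    show "(\<lambda>i. 2 * (cmod (x i))\<^sup>2 + 2 * (cmod (y i))\<^sup>2) summable_on UNIV"
      using xy by (intro summable_on_add summable_on_cmult_right) (auto simp: ell2_def)
    fix i
    have "(cmod (x i + y i))\<^sup>2 \<le> (cmod (x i) + cmod (y i))\<^sup>2"
      by (intro power_mono norm_triangle_ineq) auto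
    moreover have "0 \<le> (cmod (x i) - cmod (y i))\<^sup>2" by simp
    ultimately have "(cmod (x i + y i))\<^sup>2 \<le> 2 * (cmod (x i))\<^sup>2 + 2 * (cmod (y i))\<^sup>2"
      by (simp add: power2_eq_square algebra_simps)
    then show "norm ((cmod (x i + y i))\<^sup>2) \<le> 2 * (cmod (x i))\<^sup>2 + 2 * (cmod (y i))\<^sup>2" by simp
  qed
  then show "x + y \<in> ell2 I" using xy by (simp add: ell2_def)
next
  fix c x assume x: "x \<in> ell2 I"
  then show "fscale c x \<in> ell2 I"
    by (auto simp: ell2_def fscale_apply norm_mult power_mult_distrib intro!: summable_on_cmult_right)
qed

lemma l2_inner_cnj: "l2_inner y x = cnj (l2_inner x y)"
proof -
  have "cnj (l2_inner x y) = (\<Sum>\<^sub>\<infinity>i. cnj (x i * cnj (y i)))"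
    unfolding l2_inner_def by (rule infsum_cnj[symmetric])
  then show ?thesis by (simp add: l2_inner_def mult.commute)
qed

lemma l2_inner_scale_left: "l2_inner (fscale c x) y = c * l2_inner x y"
  unfolding l2_inner_def by (simp add: fscale_apply mult.assoc infsum_cmult_right')

lemma l2_inner_scale_right: "l2_inner x (fscale c y) = cnj c * l2_inner x y"
  by (subst (1 2) l2_inner_cnj) (simp add: l2_inner_scale_left)

lemma l2_inner_zero_left [simp]: "l2_inner 0 y = 0"
  by (simp add: l2_inner_def)

text \<open>Membership in \<open>ell2\<close> is asked for because a non-summable series has
  \<open>infsum\<close> 0, and with this default value additivity can fail.\<close>

lemma l2_inner_add_left:
  assumes "x \<in> ell2 I" "y \<in> ell2 I" "z \<in> ell2 J"
  shows "l2_inner (x + y) z = l2_inner x z + l2_inner y z"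
  unfolding l2_inner_def using ell2_summable[OF assms(1,3)] ell2_summable[OF assms(2,3)]
  by (subst infsum_add[symmetric]) (auto simp: algebra_simps)

lemma l2_inner_diff_left:
  assumes "x \<in> ell2 I" "y \<in> ell2 I" "z \<in> ell2 J"
  shows "l2_inner (x - y) z = l2_inner x z - l2_inner y z"
proof -
  have "x - y \<in> ell2 I" using assms by (intro fvs.subspace_diff[OF ell2_subspace])
  from l2_inner_add_left[OF this assms(2,3)] show ?thesis by simp
qed

lemma l2_inner_diff_right:
  assumes "x \<in> ell2 I" "y \<in> ell2 I" "z \<in> ell2 J"
  shows "l2_inner z (x - y) = l2_inner z x - l2_inner z y"
  by (subst (1 2 3) l2_inner_cnj) (simp add: l2_inner_diff_left[OF assms])

lemma l2_inner_sum_left: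
  assumes "\<And>b. b \<in> B \<Longrightarrow> v b \<in> ell2 I" "z \<in> ell2 J"
  shows "l2_inner (\<Sum>b\<in>B. fscale (c b) (v b)) z = (\<Sum>b\<in>B. c b * l2_inner (v b) z)"
  using assms(1)
proof (induction B rule: infinite_finite_induct)
  case (insert b B)
  have "(\<Sum>b\<in>B. fscale (c b) (v b)) \<in> ell2 I"
    using insert by (intro fvs.subspace_sum[OF ell2_subspace] fvs.subspace_scale[OF ell2_subspace]) auto
  moreover have "fscale (c b) (v b) \<in> ell2 I"
    using insert by (intro fvs.subspace_scale[OF ell2_subspace]) auto
  ultimately have "l2_inner (fscale (c b) (v b) + (\<Sum>b\<in>B. fscale (c b) (v b))) z =
      l2_inner (fscale (c b) (v b)) z + l2_inner (\<Sum>b\<in>B. fscale (c b) (v b)) z"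
    using assms(2) by (intro l2_inner_add_left)
  moreover have "l2_inner (\<Sum>b\<in>B. fscale (c b) (v b)) z = (\<Sum>b\<in>B. c b * l2_inner (v b) z)"
    using insert by blast
  ultimately show ?case unfolding sum.insert[OF insert.hyps] l2_inner_scale_left by (simp only:)
qed auto

lemma l2_inner_sum_right:
  assumes "\<And>b. b \<in> B \<Longrightarrow> v b \<in> ell2 I" "z \<in> ell2 J"
  shows "l2_inner z (\<Sum>b\<in>B. fscale (c b) (v b)) = (\<Sum>b\<in>B. cnj (c b) * l2_inner z (v b))"
proof -
  have "l2_inner z (\<Sum>b\<in>B. fscale (c b) (v b)) = (\<Sum>b\<in>B. cnj (c b) * cnj (l2_inner (v b) z))"
    by (subst l2_inner_cnj) (simp add: l2_inner_sum_left[OF assms])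
  then show ?thesis by (simp add: l2_inner_cnj[symmetric])
qed

lemma infsum_complex_of_real: "(\<Sum>\<^sub>\<infinity>x\<in>A. complex_of_real (f x)) = of_real (\<Sum>\<^sub>\<infinity>x\<in>A. f x)"
proof (rule infsum_bounded_linear_strong[OF _ bounded_linear_of_real])
  show "(\<lambda>x. complex_of_real (f x)) summable_on A \<longleftrightarrow> f summable_on A"
    by (metis (no_types, lifting) Re_complex_of_real summable_on_Re summable_on_cong summable_on_of_real)
qed

lemma l2_inner_self: "l2_inner x x = of_real (\<Sum>\<^sub>\<infinity>i. (cmod (x i))\<^sup>2)"
  unfolding l2_inner_def complex_norm_square[symmetric] infsum_complex_of_real ..

lemma l2_inner_self_norm: "l2_inner x x = of_real ((l2_norm x)\<^sup>2)"
  by (simp add: l2_inner_self l2_norm_def infsum_nonneg)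

lemma l2_inner_self_eq_0:
  assumes "x \<in> ell2 I" "l2_inner x x = 0"
  shows "x = 0"
proof
  fix i
  have "(\<Sum>\<^sub>\<infinity>i. (cmod (x i))\<^sup>2) = 0" using assms(2) unfolding l2_inner_self by simp
  then have "(cmod (x i))\<^sup>2 = 0"
    using assms(1) by (intro nonneg_infsum_le_0D[of "\<lambda>i. (cmod (x i))\<^sup>2" UNIV]) (auto simp: ell2_def)
  then show "x i = 0 i" by simp
qed

section \<open>Finite orthonormal bases, projections and Gram-Schmidt\<close>

locale onb =
  fixes I :: "'i set" and H B :: "('i \<Rightarrow> complex) set"
  assumes onb: "orthonormal_basis H B" and sub: "H \<subseteq> ell2 I"
begin

lemma finite_B [simp, intro]: "finite B"
  and span_B: "fvs.span B = H"
  and inner_B: "u \<in> B \<Longrightarrow> v \<in> B \<Longrightarrow> l2_inner u v = (if u = v then 1 else 0)"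
  using onb by (auto simp: orthonormal_basis_def)

lemma subspace_H: "fvs.subspace H"
  using fvs.subspace_span span_B by metis

lemma B_sub: "b \<in> B \<Longrightarrow> b \<in> H"
  using span_B fvs.span_base by blast

lemma in_ell2: "v \<in> H \<Longrightarrow> v \<in> ell2 I"
  using sub by blast

lemma B_ell2: "b \<in> B \<Longrightarrow> b \<in> ell2 I"
  using B_sub in_ell2 by blast

lemma comb_in: "(\<Sum>b\<in>B. fscale (c b) b) \<in> H"
  using B_sub by (intro fvs.subspace_sum[OF subspace_H] fvs.subspace_scale[OF subspace_H])

lemma inner_comb:
  assumes "b \<in> B"
  shows "l2_inner (\<Sum>a\<in>B. fscale (c a) a) b = c b"
proof -
  have "l2_inner (\<Sum>a\<in>B. fscale (c a) a) b = (\<Sum>a\<in>B. c a * l2_inner a b)"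
    using assms by (intro l2_inner_sum_left) (auto intro: B_ell2)
  also have "\<dots> = (\<Sum>a\<in>B. if a = b then c a else 0)"
    using assms by (intro sum.cong) (auto simp: inner_B)
  finally show ?thesis using assms by simp
qed

lemma expand:
  assumes "v \<in> H"
  shows "v = (\<Sum>b\<in>B. fscale (l2_inner v b) b)"
proof -
  obtain u where u: "v = (\<Sum>b\<in>B. fscale (u b) b)"
    using assms span_B fvs.span_finite[OF finite_B] by blast
  then have "l2_inner v b = u b" if "b \<in> B" for b using inner_comb[OF that] by simp
  then show ?thesis using u by simp
qed

lemma eq_by_inner:
  assumes "u \<in> H" "v \<in> H" "\<And>b. b \<in> B \<Longrightarrow> l2_inner u b = l2_inner v b"
  shows "u = v"
  using expand[OF assms(1)] expand[OF assms(2)] assms(3) by simp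

lemma parseval:
  assumes "v \<in> H" "w \<in> ell2 I"
  shows "l2_inner v w = (\<Sum>b\<in>B. l2_inner v b * l2_inner b w)"
  by (subst expand[OF assms(1)], rule l2_inner_sum_left) (use assms B_ell2 in auto)

lemma independent_B: "fvs.independent B"
proof (rule fvs.independent_if_scalars_zero)
  fix c b assume c: "(\<Sum>x\<in>B. fscale (c x) x) = 0" and b: "b \<in> B"
  then show "c b = 0" using inner_comb[OF b, of c] by simp
qed simp

lemma dim_H: "fvs.dim H = card B"
  using fvs.dim_eq_card[OF _ independent_B, of H] fvs.span_span[of B] unfolding span_B by simp

text \<open>By \<open>parseval\<close> the squared moduli of the coordinates of a unit vector add up
  to 1. Applied to \<open>\<pi> g b\<close>, this bounds the matrix coefficients uniformly in
  \<open>g\<close>.\<close>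

lemma inner_le_1:
  assumes "v \<in> H" "l2_inner v v = 1" "b \<in> B"
  shows "cmod (l2_inner v b) \<le> 1"
proof -
  have "l2_inner v b * l2_inner b v = of_real ((cmod (l2_inner v b))\<^sup>2)" for b
    by (subst (2) l2_inner_cnj) (simp only: complex_norm_square)
  then have "of_real (\<Sum>b\<in>B. (cmod (l2_inner v b))\<^sup>2) = (1::complex)"
    using parseval[OF assms(1) in_ell2[OF assms(1)]] assms(2) by simp
  then have "(\<Sum>b\<in>B. (cmod (l2_inner v b))\<^sup>2) = 1" by (simp only: of_real_eq_1_iff)
  moreover have "(cmod (l2_inner v b))\<^sup>2 \<le> (\<Sum>b\<in>B. (cmod (l2_inner v b))\<^sup>2)"
    using assms(3) by (intro member_le_sum) auto
  ultimately have "(cmod (l2_inner v b))\<^sup>2 \<le> 1\<^sup>2" by simp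
  then show ?thesis by (rule power2_le_imp_le) simp
qed

definition proj :: "('i \<Rightarrow> complex) \<Rightarrow> 'i \<Rightarrow> complex" where
  "proj v = (\<Sum>b\<in>B. fscale (l2_inner v b) b)"

lemma proj_in: "proj v \<in> H"
  unfolding proj_def by (rule comb_in)

lemma proj_orth:
  assumes "v \<in> ell2 I" "u \<in> H"
  shows "l2_inner (v - proj v) u = 0"
proof -
  have p: "proj v \<in> ell2 I" by (rule in_ell2[OF proj_in])
  then have d: "v - proj v \<in> ell2 I" using assms by (intro fvs.subspace_diff[OF ell2_subspace])
  have 0: "l2_inner (v - proj v) b = 0" if "b \<in> B" for b
    using l2_inner_diff_left[OF assms(1) p B_ell2[OF that]] inner_comb[OF that, of "l2_inner v"]
    by (simp add: proj_def)
  have "l2_inner u (v - proj v) = (\<Sum>b\<in>B. l2_inner u b * l2_inner b (v - proj v))"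
    by (rule parseval[OF assms(2) d])
  also have "\<dots> = 0" by (intro sum.neutral ballI) (subst (2) l2_inner_cnj, simp add: 0)
  finally show ?thesis by (subst l2_inner_cnj) simp
qed

text \<open>If \<open>X n\<close> in \<open>H\<close> tends to \<open>x\<close>, Pythagoras shows
  that \<open>x - proj x\<close> is no longer than \<open>X n - x\<close>, so its norm is 0 and
  \<open>x\<close> equals its projection. Finite-dimensional invariant subspaces thus meet the
  closedness demanded of representations.\<close>

lemma closed: "closed_subspace I H"
  unfolding closed_subspace_def
proof (intro conjI allI ballI impI sub subspace_H)
  fix X x assume x: "x \<in> ell2 I" and X: "\<forall>n::nat. X n \<in> H" and lim: "(\<lambda>n. l2_norm (X n - x)) \<longlonglongrightarrow> 0"
  let ?y = "x - proj x"
  have px: "proj x \<in> ell2 I" by (rule in_ell2[OF proj_in])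
  have y: "?y \<in> ell2 I" using x px by (intro fvs.subspace_diff[OF ell2_subspace])
  have le: "l2_norm ?y \<le> l2_norm (X n - x)" for n
  proof -
    let ?u = "X n - proj x"
    have u: "?u \<in> H" using X proj_in by (intro fvs.subspace_diff[OF subspace_H]) auto
    note u' = in_ell2[OF u]
    have e: "X n - x = ?u - ?y" by simp
    have d: "?u - ?y \<in> ell2 I" by (rule fvs.subspace_diff[OF ell2_subspace u' y])
    have yu: "l2_inner ?y ?u = 0" by (rule proj_orth[OF x u])
    then have uy: "l2_inner ?u ?y = 0" by (subst l2_inner_cnj) simp
    have "l2_inner (?u - ?y) (?u - ?y) = l2_inner ?u (?u - ?y) - l2_inner ?y (?u - ?y)"
      by (rule l2_inner_diff_left[OF u' y d])
    also have "\<dots> = l2_inner ?u ?u + l2_inner ?y ?y"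
      using l2_inner_diff_right[OF u' y u'] l2_inner_diff_right[OF u' y y] yu uy by simp
    finally have "l2_inner (X n - x) (X n - x) = l2_inner ?u ?u + l2_inner ?y ?y" unfolding e .
    then have "(l2_norm (X n - x))\<^sup>2 = (l2_norm ?u)\<^sup>2 + (l2_norm ?y)\<^sup>2"
      unfolding l2_inner_self_norm of_real_add[symmetric] of_real_eq_iff .
    then have "(l2_norm ?y)\<^sup>2 \<le> (l2_norm (X n - x))\<^sup>2" by simp
    then show ?thesis by (rule power2_le_imp_le) (simp add: l2_norm_def infsum_nonneg)
  qed
  have "l2_norm ?y \<le> 0" using le by (intro LIMSEQ_le_const[OF lim]) auto
  moreover have "l2_norm ?y \<ge> 0" by (simp add: l2_norm_def infsum_nonneg)
  ultimately have "l2_norm ?y = 0" by simp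
  then have "l2_inner ?y ?y = 0" by (simp add: l2_inner_self_norm)
  then have "?y = 0" by (rule l2_inner_self_eq_0[OF y])
  then show "x \<in> H" using proj_in[of x] by simp
qed

text \<open>The last half of a Gram-Schmidt step: \<open>w\<close> is already orthogonal to
  \<open>H\<close>, and only its length remains to be corrected.\<close>

lemma insert_normalized:
  assumes w: "w \<in> ell2 I" "w \<noteq> 0" "\<And>u. u \<in> H \<Longrightarrow> l2_inner w u = 0"
  shows "orthonormal_basis (fvs.span (insert w B)) (insert (fscale (of_real (1 / l2_norm w)) w) B)"
proof -
  let ?c = "of_real (1 / l2_norm w) :: complex"
  let ?w = "fscale ?c w"
  have ww: "l2_inner w w \<noteq> 0" using l2_inner_self_eq_0[OF w(1)] w(2) by blast
  then have n0: "l2_norm w \<noteq> 0" by (auto simp: l2_inner_self_norm)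
  have "l2_inner ?w ?w = ?c * (cnj ?c * l2_inner w w)"
    by (simp only: l2_inner_scale_left l2_inner_scale_right mult.left_commute)
  then have 1: "l2_inner ?w ?w = 1"
    unfolding l2_inner_self_norm[of w] using n0 by (simp add: power2_eq_square)
  have 2: "l2_inner ?w u = 0" "l2_inner u ?w = 0" if "u \<in> H" for u
  proof -
    show "l2_inner ?w u = 0" using w(3)[OF that] by (simp add: l2_inner_scale_left)
    then show "l2_inner u ?w = 0" by (subst l2_inner_cnj) simp
  qed
  have "?w \<notin> H" using 2 1 by (metis zero_neq_one)
  have "fvs.span (insert ?w B) = fvs.span (insert w B)"
  proof (rule fvs.span_eq[THEN iffD2], intro conjI subsetI)
    fix x assume "x \<in> insert ?w B"
    then show "x \<in> fvs.span (insert w B)"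
      by (auto intro: fvs.span_scale fvs.span_base)
  next
    fix x assume x: "x \<in> insert w B"
    have "w = fscale (of_real (l2_norm w)) ?w" using n0 by (auto simp: fun_eq_iff fscale_apply)
    moreover have "fscale (of_real (l2_norm w)) ?w \<in> fvs.span (insert ?w B)"
      by (intro fvs.span_scale fvs.span_base) simp
    ultimately have "w \<in> fvs.span (insert ?w B)" by metis
    then show "x \<in> fvs.span (insert ?w B)" using x fvs.span_base[of x "insert ?w B"] by blast
  qed
  moreover have "l2_inner u v = (if u = v then 1 else 0)" if "u \<in> insert ?w B" "v \<in> insert ?w B" for u v
    using that 1 2 inner_B B_sub \<open>?w \<notin> H\<close> by auto
  ultimately show ?thesis unfolding orthonormal_basis_def by simp
qed

end

text \<open>Gram-Schmidt. The new vector is replaced by its residue \<open>v - proj v\<close>, which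
  spans the same space together with the old vectors; a zero residue adds no basis vector.\<close>

lemma onb_span_exists:
  assumes "finite C" "C \<subseteq> ell2 I"
  shows "\<exists>B. orthonormal_basis (fvs.span C) B"
  using assms
proof (induction rule: finite_induct)
  case empty
  have "orthonormal_basis (fvs.span {}) {}" by (simp add: orthonormal_basis_def)
  then show ?case by blast
next
  case (insert v C)
  then obtain B where B: "orthonormal_basis (fvs.span C) B" by auto
  have "fvs.span C \<subseteq> ell2 I" using insert.prems by (intro fvs.span_minimal ell2_subspace) auto
  with B interpret onb I "fvs.span C" B by unfold_locales
  let ?w = "v - proj v"
  have v: "v \<in> ell2 I" using insert.prems by simp
  have w: "?w \<in> ell2 I" by (intro fvs.subspace_diff[OF ell2_subspace] v in_ell2 proj_in)
  have "fvs.span (insert v C) = fvs.span (insert ?w C)"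
    by (rule fvs.eq_span_insert_eq) (simp add: proj_in)
  also have "\<dots> = fvs.span (insert ?w B)"
    unfolding fvs.span_insert span_B ..
  finally have e: "fvs.span (insert v C) = fvs.span (insert ?w B)" .
  show ?case
  proof (cases "?w = 0")
    case True
    then show ?thesis unfolding e using B by (auto simp: span_B)
  next
    case False
    show ?thesis unfolding e using insert_normalized[OF w False proj_orth[OF v]] by blast
  qed
qed

lemma finite_dimensional_onb:
  assumes "finite_dimensional H" "H \<subseteq> ell2 I"
  obtains B where "onb I H B"
proof -
  obtain C where C: "finite C" "fvs.span C = H" using assms(1) by (auto simp: finite_dimensional_def)
  then have "C \<subseteq> ell2 I" using assms(2) fvs.span_superset by blast
  then show thesis using onb_span_exists[OF C(1)] C(2) assms(2) that by (auto simp: onb_def)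
qed

lemma (in onb) finite_dimensional: "finite_dimensional H"
  unfolding finite_dimensional_def using finite_B span_B by blast

lemma (in onb) subspace_onb:
  assumes "fvs.subspace K" "K \<subseteq> H"
  obtains C where "onb I K C"
proof -
  obtain D where D: "D \<subseteq> K" "fvs.independent D" "K \<subseteq> fvs.span D" by (rule fvs.basis_exists)
  have "finite D" using fvs.independent_span_bound[OF finite_B D(2)] D(1) assms(2) span_B by blast
  moreover have "fvs.span D = K" using D assms(1) by (intro subset_antisym fvs.span_minimal)
  ultimately have "finite_dimensional K" unfolding finite_dimensional_def by blast
  then show thesis by (rule finite_dimensional_onb[OF _ subset_trans[OF assms(2) sub] that])
qed

section \<open>Operators on a subspace and their trace\<close>

definition linear_into :: "('i \<Rightarrow> complex) set \<Rightarrow> ('j \<Rightarrow> complex) set \<Rightarrow> (('i \<Rightarrow> complex) \<Rightarrow> 'j \<Rightarrow> complex) \<Rightarrow> bool" where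
  "linear_into H K T \<longleftrightarrow> (\<forall>v\<in>H. T v \<in> K) \<and> (\<forall>u\<in>H. \<forall>v\<in>H. T (u + v) = T u + T v) \<and>
     (\<forall>c. \<forall>v\<in>H. T (fscale c v) = fscale c (T v))"

lemma linear_into_comp:
  "linear_into H K T \<Longrightarrow> linear_into K L S \<Longrightarrow> linear_into H L (S \<circ> T)"
  by (simp add: linear_into_def)

lemma linear_into_sum:
  assumes "linear_into H K T" "fvs.subspace H" "\<And>b. b \<in> B \<Longrightarrow> v b \<in> H"
  shows "T (\<Sum>b\<in>B. fscale (c b) (v b)) = (\<Sum>b\<in>B. fscale (c b) (T (v b)))"
proof -
  have "T (fscale 0 0) = fscale 0 (T 0)"
    using assms(1) fvs.subspace_0[OF assms(2)] unfolding linear_into_def by blast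
  then have T0: "T 0 = 0" unfolding fvs.scale_zero_left .
  show ?thesis
    using assms(3)
  proof (induction B rule: infinite_finite_induct)
    case (infinite B)
    show ?case unfolding sum.infinite[OF infinite(1)] by (rule T0)
  next
    case empty
    show ?case unfolding sum.empty by (rule T0)
  next
    case (insert b B)
    have "(\<Sum>b\<in>B. fscale (c b) (v b)) \<in> H" "fscale (c b) (v b) \<in> H"
      using insert by (auto intro!: fvs.subspace_sum[OF assms(2)] fvs.subspace_scale[OF assms(2)])
    then have "T (fscale (c b) (v b) + (\<Sum>b\<in>B. fscale (c b) (v b))) =
        T (fscale (c b) (v b)) + T (\<Sum>b\<in>B. fscale (c b) (v b))"
      using assms(1) unfolding linear_into_def by blast
    moreover have "T (fscale (c b) (v b)) = fscale (c b) (T (v b))"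
      using assms(1) insert.prems unfolding linear_into_def by blast
    moreover have "T (\<Sum>b\<in>B. fscale (c b) (v b)) = (\<Sum>b\<in>B. fscale (c b) (T (v b)))"
      using insert by blast
    ultimately show ?case unfolding sum.insert[OF insert.hyps] by (simp only:)
  qed
qed

text \<open>Expand each \<open>T b\<close> along \<open>C\<close>, swap the sums, and recognise the
  expansion of \<open>T c\<close> along \<open>B\<close>. This frees \<open>op_trace\<close> from
  its choice by \<open>SOME\<close>, and later compares the basis of point masses with a basis
  adapted to a decomposition.\<close>

lemma sum_inner_basis_independent:
  assumes "onb I H B" "onb I H C" and T: "linear_into H H T"
  shows "(\<Sum>b\<in>B. l2_inner (T b) b) = (\<Sum>c\<in>C. l2_inner (T c) c)"
proof -
  interpret B: onb I H B by fact
  interpret C: onb I H C by fact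
  have Tin: "T v \<in> H" if "v \<in> H" for v using T that by (auto simp: linear_into_def)
  have "(\<Sum>b\<in>B. l2_inner (T b) b) = (\<Sum>b\<in>B. \<Sum>c\<in>C. l2_inner (T b) c * l2_inner c b)"
    using B.B_sub by (intro sum.cong C.parseval) (auto intro: Tin B.in_ell2)
  also have "\<dots> = (\<Sum>c\<in>C. \<Sum>b\<in>B. l2_inner c b * l2_inner (T b) c)"
    by (subst sum.swap) (simp add: mult.commute)
  also have "\<dots> = (\<Sum>c\<in>C. l2_inner (T c) c)"
  proof (rule sum.cong)
    fix c assume c: "c \<in> C"
    have "T c = T (\<Sum>b\<in>B. fscale (l2_inner c b) b)" using B.expand[OF C.B_sub[OF c]] by simp
    also have "\<dots> = (\<Sum>b\<in>B. fscale (l2_inner c b) (T b))"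
      by (rule linear_into_sum[OF T B.subspace_H B.B_sub])
    finally have "l2_inner (T c) c = (\<Sum>b\<in>B. l2_inner c b * l2_inner (T b) c)"
      using l2_inner_sum_left[of B T I c I "\<lambda>b. l2_inner c b"] Tin B.B_sub C.B_ell2[OF c] B.in_ell2 by simp
    then show "(\<Sum>b\<in>B. l2_inner c b * l2_inner (T b) c) = l2_inner (T c) c" by simp
  qed simp
  finally show ?thesis .
qed

lemma (in onb) op_trace_eq:
  assumes "linear_into H H T"
  shows "op_trace H T = (\<Sum>b\<in>B. l2_inner (T b) b)"
proof -
  have "orthonormal_basis H (SOME B. orthonormal_basis H B)" using onb by (rule someI)
  then have "onb I H (SOME B. orthonormal_basis H B)" using sub by (simp add: onb_def)
  then show ?thesis unfolding op_trace_def
    by (rule sum_inner_basis_independent[OF _ onb_axioms assms])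
qed

lemma unitary_linear: "unitary_map H K U \<Longrightarrow> linear_into H K U"
  unfolding unitary_map_def linear_into_def bij_betw_def by blast

lemma (in onb) unitary_image:
  assumes U: "unitary_map H K U" and K: "fvs.subspace K" "K \<subseteq> ell2 J"
  shows "onb J K (U ` B)" and "inj_on U B"
proof -
  have inj: "inj_on U H" and im: "U ` H = K" using U by (auto simp: unitary_map_def bij_betw_def)
  have BH: "B \<subseteq> H" using B_sub by blast
  show "inj_on U B" using inj BH by (rule inj_on_subset)
  have "fvs.span (U ` B) = K"
  proof
    show "fvs.span (U ` B) \<subseteq> K" using im BH K(1) by (intro fvs.span_minimal) auto
    show "K \<subseteq> fvs.span (U ` B)"
    proof
      fix w assume "w \<in> K"
      then obtain v where v: "v \<in> H" "w = U v" using im by blast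
      have "U v = U (\<Sum>b\<in>B. fscale (l2_inner v b) b)" using expand[OF v(1)] by simp
      also have "\<dots> = (\<Sum>b\<in>B. fscale (l2_inner v b) (U b))"
        by (rule linear_into_sum[OF unitary_linear[OF U] subspace_H B_sub])
      also have "\<dots> \<in> fvs.span (U ` B)" by (intro fvs.span_sum fvs.span_scale fvs.span_base) auto
      finally show "w \<in> fvs.span (U ` B)" using v by simp
    qed
  qed
  moreover have "l2_inner u v = (if u = v then 1 else 0)" if "u \<in> U ` B" "v \<in> U ` B" for u v
  proof -
    obtain a b where ab: "u = U a" "v = U b" "a \<in> B" "b \<in> B" using \<open>u \<in> _\<close> \<open>v \<in> _\<close> by blast
    have "l2_inner u v = l2_inner a b"
      using U ab BH unfolding unitary_map_def by blast
    moreover have "u = v \<longleftrightarrow> a = b" using ab inj_on_eq_iff[OF \<open>inj_on U B\<close>] by simp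
    ultimately show ?thesis using inner_B[OF ab(3,4)] by simp
  qed
  ultimately show "onb J K (U ` B)" using K(2) by (simp add: onb_def orthonormal_basis_def)
qed

section \<open>Finite-dimensional unitary representations\<close>

lemma summable_on_bounded_mult:
  fixes f g :: "'a \<Rightarrow> complex"
  assumes "(\<lambda>x. cmod (f x)) summable_on A" "\<And>x. x \<in> A \<Longrightarrow> cmod (g x) \<le> M"
  shows "(\<lambda>x. cmod (f x * g x)) summable_on A" "(\<lambda>x. f x * g x) summable_on A"
proof -
  show "(\<lambda>x. cmod (f x * g x)) summable_on A"
  proof (rule Infinite_Sum.abs_summable_on_comparison_test')
    show "(\<lambda>x. cmod (f x) * M) summable_on A" by (intro summable_on_cmult_left assms)
  qed (use assms(2) in \<open>auto simp: norm_mult intro: mult_left_mono\<close>)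
  then show "(\<lambda>x. f x * g x) summable_on A" by (rule abs_summable_summable)
qed

lemma norm_infsum_bounded_mult_le:
  fixes f g :: "'a \<Rightarrow> complex"
  assumes "(\<lambda>x. cmod (f x)) summable_on A" "\<And>x. x \<in> A \<Longrightarrow> cmod (g x) \<le> M"
  shows "cmod (\<Sum>\<^sub>\<infinity>x\<in>A. f x * g x) \<le> M * (\<Sum>\<^sub>\<infinity>x\<in>A. cmod (f x))"
proof (rule norm_infsum_le)
  show "((\<lambda>x. f x * g x) has_sum (\<Sum>\<^sub>\<infinity>x\<in>A. f x * g x)) A"
    using summable_on_bounded_mult(2)[OF assms] by (rule has_sum_infsum)
  show "((\<lambda>x. M * cmod (f x)) has_sum M * (\<Sum>\<^sub>\<infinity>x\<in>A. cmod (f x))) A"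
    using assms(1) by (intro has_sum_cmult_right has_sum_infsum)
qed (use assms(2) in \<open>auto simp: norm_mult mult.commute[of M] intro: mult_left_mono\<close>)

lemma infsum_sum_swap:
  fixes f :: "'a \<Rightarrow> 'b \<Rightarrow> complex"
  assumes "\<And>b. b \<in> B \<Longrightarrow> (\<lambda>x. f x b) summable_on A"
  shows "(\<Sum>\<^sub>\<infinity>x\<in>A. \<Sum>b\<in>B. f x b) = (\<Sum>b\<in>B. \<Sum>\<^sub>\<infinity>x\<in>A. f x b)"
proof -
  have "((\<lambda>x. \<Sum>b\<in>B. f x b) has_sum (\<Sum>b\<in>B. \<Sum>\<^sub>\<infinity>x\<in>A. f x b)) A"
    using assms
  proof (induction B rule: infinite_finite_induct)
    case (insert b B)
    then show ?case by (simp add: has_sum_add)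
  qed auto
  then show ?thesis by (rule infsumI)
qed

section \<open>Unitary representations and invariant subspaces\<close>

locale unitary_rep_loc = group G for G :: "('a, 'b) monoid_scheme" (structure) +
  fixes I :: "'i set" and H :: "('i \<Rightarrow> complex) set" and \<pi> :: "'a \<Rightarrow> ('i \<Rightarrow> complex) \<Rightarrow> 'i \<Rightarrow> complex"
  assumes rep: "unitary_rep G I (H, \<pi>)"
begin

lemma closed_H: "closed_subspace I H"
  and unitary: "g \<in> carrier G \<Longrightarrow> unitary_map H H (\<pi> g)"
  and pi_mult: "g \<in> carrier G \<Longrightarrow> h \<in> carrier G \<Longrightarrow> v \<in> H \<Longrightarrow> \<pi> (g \<otimes> h) v = \<pi> g (\<pi> h v)"
  using rep by (auto simp: unitary_rep_def)

lemma H_sub: "H \<subseteq> ell2 I"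
  and subspace_H': "fvs.subspace H"
  using closed_H by (auto simp: closed_subspace_def)

lemma pi_linear: "g \<in> carrier G \<Longrightarrow> linear_into H H (\<pi> g)"
  by (rule unitary_linear[OF unitary])

lemma pi_in: "g \<in> carrier G \<Longrightarrow> v \<in> H \<Longrightarrow> \<pi> g v \<in> H"
  using pi_linear by (auto simp: linear_into_def)

lemma pi_inner:
  "g \<in> carrier G \<Longrightarrow> u \<in> H \<Longrightarrow> v \<in> H \<Longrightarrow> l2_inner (\<pi> g u) (\<pi> g v) = l2_inner u v"
  using unitary[of g] by (auto simp: unitary_map_def)

text \<open>\<open>unitary_rep\<close> does not list this as an axiom: multiplicativity makes
  \<open>\<pi> \<one>\<close> idempotent, and an injective idempotent is the identity.\<close>

lemma pi_one:
  assumes "v \<in> H"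
  shows "\<pi> \<one> v = v"
proof -
  have "\<pi> \<one> (\<pi> \<one> v) = \<pi> \<one> v" using pi_mult[of \<one> \<one> v] assms by simp
  moreover have "inj_on (\<pi> \<one>) H" using unitary[of \<one>] by (auto simp: unitary_map_def bij_betw_def)
  ultimately show ?thesis using assms pi_in[of \<one>] by (auto dest: inj_onD)
qed

lemma pi_inv: "g \<in> carrier G \<Longrightarrow> v \<in> H \<Longrightarrow> \<pi> g (\<pi> (inv g) v) = v"
  using pi_mult[of g "inv g" v] pi_one by simp

lemma pi_adj:
  assumes "g \<in> carrier G" "u \<in> H" "v \<in> H"
  shows "l2_inner (\<pi> g u) v = l2_inner u (\<pi> (inv g) v)"
  using pi_inner[of g u "\<pi> (inv g) v"] pi_inv[of g v] pi_in[of "inv g" v] assms by simp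

lemma subrep:
  assumes K: "closed_subspace I K" "K \<subseteq> H" "\<And>g. g \<in> carrier G \<Longrightarrow> \<pi> g ` K \<subseteq> K"
  shows "unitary_rep G I (K, \<pi>)"
proof -
  have "unitary_map K K (\<pi> g)" if g: "g \<in> carrier G" for g
  proof -
    have "inj_on (\<pi> g) K"
      using unitary[OF g] K(2) by (auto simp: unitary_map_def bij_betw_def intro: inj_on_subset)
    \<comment> \<open>Invariance under \<open>\<pi> g\<close> gives one inclusion; invariance under
      \<open>\<pi> (inv g)\<close> gives the other.\<close>
    moreover have "K \<subseteq> \<pi> g ` K"
    proof
      fix v assume v: "v \<in> K"
      then have "\<pi> (inv g) v \<in> K" using K(3)[of "inv g"] g by auto
      moreover have "v = \<pi> g (\<pi> (inv g) v)" using pi_inv[OF g] v K(2) by auto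
      ultimately show "v \<in> \<pi> g ` K" by blast
    qed
    ultimately have "bij_betw (\<pi> g) K K" using K(3)[OF g] by (auto simp: bij_betw_def)
    then show ?thesis using unitary[OF g] K(2) unfolding unitary_map_def by blast
  qed
  then show ?thesis using K(1,2) pi_mult unfolding unitary_rep_def by blast
qed

end

section \<open>Finite-dimensional representations and the operators \<open>rep_ell1\<close>\<close>

locale fin_rep = unitary_rep_loc + onb
begin

lemma pi_coeff_le: "g \<in> carrier G \<Longrightarrow> b \<in> B \<Longrightarrow> c \<in> B \<Longrightarrow> cmod (l2_inner (\<pi> g b) c) \<le> 1"
  by (intro inner_le_1) (auto simp: pi_in pi_inner B_sub inner_B)

text \<open>A bound independent of \<open>g\<close> is what makes \<open>f \<gamma>\<close> times
  the coefficient summable. It is read off from the coordinates of \<open>v\<close> and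
  \<open>w\<close> in \<open>B\<close>, since coefficients between basis vectors have modulus at
  most 1.\<close>

lemma pi_coeff_bounded:
  assumes "v \<in> H" "w \<in> H"
  obtains M where "\<And>g. g \<in> carrier G \<Longrightarrow> cmod (l2_inner (\<pi> g v) w) \<le> M"
proof
  fix g assume g: "g \<in> carrier G"
  have "\<pi> g v = \<pi> g (\<Sum>b\<in>B. fscale (l2_inner v b) b)" using expand[OF assms(1)] by simp
  also have "\<dots> = (\<Sum>b\<in>B. fscale (l2_inner v b) (\<pi> g b))"
    by (rule linear_into_sum[OF pi_linear[OF g] subspace_H B_sub])
  finally have "l2_inner (\<pi> g v) w = (\<Sum>b\<in>B. l2_inner v b * l2_inner (\<pi> g b) w)"
    using l2_inner_sum_left[of B "\<pi> g" I w I "l2_inner v"] g assms(2) by (simp add: pi_in B_sub in_ell2)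
  also have "\<dots> = (\<Sum>b\<in>B. l2_inner v b * (\<Sum>c\<in>B. l2_inner (\<pi> g b) c * l2_inner c w))"
    using g assms(2) by (intro sum.cong) (auto simp: parseval[symmetric] pi_in B_sub in_ell2)
  finally have "cmod (l2_inner (\<pi> g v) w) \<le>
      (\<Sum>b\<in>B. cmod (l2_inner v b * (\<Sum>c\<in>B. l2_inner (\<pi> g b) c * l2_inner c w)))"
    by (simp add: norm_sum)
  also have "\<dots> \<le> (\<Sum>b\<in>B. cmod (l2_inner v b) * (\<Sum>c\<in>B. cmod (l2_inner c w)))"
  proof (rule sum_mono)
    fix b assume b: "b \<in> B"
    have "cmod (\<Sum>c\<in>B. l2_inner (\<pi> g b) c * l2_inner c w) \<le> (\<Sum>c\<in>B. cmod (l2_inner c w))"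
    proof (rule order_trans[OF norm_sum], rule sum_mono)
      fix c assume "c \<in> B"
      then show "cmod (l2_inner (\<pi> g b) c * l2_inner c w) \<le> cmod (l2_inner c w)"
        using pi_coeff_le[OF g b] by (simp add: norm_mult mult_left_le_one_le)
    qed
    then show "cmod (l2_inner v b * (\<Sum>c\<in>B. l2_inner (\<pi> g b) c * l2_inner c w)) \<le>
        cmod (l2_inner v b) * (\<Sum>c\<in>B. cmod (l2_inner c w))"
      by (simp add: norm_mult mult_left_mono)
  qed
  finally show "cmod (l2_inner (\<pi> g v) w) \<le> (\<Sum>b\<in>B. cmod (l2_inner v b) * (\<Sum>c\<in>B. cmod (l2_inner c w)))" .
qed

lemma normalized_trace_eq:
  "linear_into H H T \<Longrightarrow> normalized_trace H T = (\<Sum>b\<in>B. l2_inner (T b) b) / of_nat (card B)"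
  by (simp add: normalized_trace_def op_trace_eq dim_H)

lemma normalized_trace_le_1:
  assumes "g \<in> carrier G"
  shows "cmod (normalized_trace H (\<pi> g)) \<le> 1"
proof -
  have "cmod (\<Sum>b\<in>B. l2_inner (\<pi> g b) b) \<le> (\<Sum>b\<in>B. 1)"
    using pi_coeff_le[OF assms] by (intro order_trans[OF norm_sum] sum_mono) auto
  \<comment> \<open>If \<open>B\<close> is empty, the normalised trace is 0 divided by 0, which is
    0.\<close>
  then show ?thesis
    by (cases "card B = 0") (auto simp: normalized_trace_eq[OF pi_linear[OF assms]] norm_divide divide_le_eq)
qed

context
  fixes f :: "'a \<Rightarrow> complex"
  assumes f: "(\<lambda>\<gamma>. cmod (f \<gamma>)) summable_on carrier G"
begin

lemma coeff_summable:
  assumes "v \<in> H" "w \<in> H"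
  shows "(\<lambda>\<gamma>. f \<gamma> * l2_inner (\<pi> \<gamma> v) w) summable_on carrier G"
  by (rule pi_coeff_bounded[OF assms]) (rule summable_on_bounded_mult(2)[OF f])

text \<open>\<open>rep_ell1\<close> is defined by one series per coordinate \<open>i\<close>.
  Writing \<open>\<pi> \<gamma> v\<close> in the basis turns these into finitely many series of
  coefficients, which also shows that the result lies in \<open>H\<close>.\<close>

lemma rep_ell1_expand:
  assumes v: "v \<in> H"
  shows "rep_ell1 G \<pi> f v = (\<Sum>c\<in>B. fscale (\<Sum>\<^sub>\<infinity>\<gamma>\<in>carrier G. f \<gamma> * l2_inner (\<pi> \<gamma> v) c) c)"
proof
  fix i
  have "rep_ell1 G \<pi> f v i = (\<Sum>\<^sub>\<infinity>\<gamma>\<in>carrier G. \<Sum>c\<in>B. f \<gamma> * l2_inner (\<pi> \<gamma> v) c * c i)"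
    unfolding rep_ell1_def
  proof (rule infsum_cong)
    fix \<gamma> assume "\<gamma> \<in> carrier G"
    then have "\<pi> \<gamma> v i = (\<Sum>c\<in>B. fscale (l2_inner (\<pi> \<gamma> v) c) c) i"
      using expand[OF pi_in[OF _ v]] by simp
    then show "f \<gamma> * \<pi> \<gamma> v i = (\<Sum>c\<in>B. f \<gamma> * l2_inner (\<pi> \<gamma> v) c * c i)"
      by (simp add: sum_fun_apply fscale_apply sum_distrib_left mult.assoc)
  qed
  also have "\<dots> = (\<Sum>c\<in>B. \<Sum>\<^sub>\<infinity>\<gamma>\<in>carrier G. f \<gamma> * l2_inner (\<pi> \<gamma> v) c * c i)"
    using coeff_summable[OF v B_sub] by (intro infsum_sum_swap summable_on_cmult_left)
  also have "\<dots> = (\<Sum>c\<in>B. fscale (\<Sum>\<^sub>\<infinity>\<gamma>\<in>carrier G. f \<gamma> * l2_inner (\<pi> \<gamma> v) c) c) i"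
    by (simp add: sum_fun_apply fscale_apply infsum_cmult_left')
  finally show "rep_ell1 G \<pi> f v i = (\<Sum>c\<in>B. fscale (\<Sum>\<^sub>\<infinity>\<gamma>\<in>carrier G. f \<gamma> * l2_inner (\<pi> \<gamma> v) c) c) i" .
qed

lemma rep_ell1_in: "v \<in> H \<Longrightarrow> rep_ell1 G \<pi> f v \<in> H"
  by (simp only: rep_ell1_expand comb_in)

lemma inner_rep_ell1:
  assumes v: "v \<in> H" and w: "w \<in> H"
  shows "l2_inner (rep_ell1 G \<pi> f v) w = (\<Sum>\<^sub>\<infinity>\<gamma>\<in>carrier G. f \<gamma> * l2_inner (\<pi> \<gamma> v) w)"
proof -
  have "l2_inner (rep_ell1 G \<pi> f v) w =
      (\<Sum>c\<in>B. (\<Sum>\<^sub>\<infinity>\<gamma>\<in>carrier G. f \<gamma> * l2_inner (\<pi> \<gamma> v) c) * l2_inner c w)"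
    unfolding rep_ell1_expand[OF v] by (rule l2_inner_sum_left[OF B_ell2 in_ell2[OF w]])
  also have "\<dots> = (\<Sum>\<^sub>\<infinity>\<gamma>\<in>carrier G. \<Sum>c\<in>B. f \<gamma> * l2_inner (\<pi> \<gamma> v) c * l2_inner c w)"
    using coeff_summable[OF v B_sub]
    by (subst infsum_sum_swap) (auto simp: infsum_cmult_left' intro: summable_on_cmult_left)
  also have "\<dots> = (\<Sum>\<^sub>\<infinity>\<gamma>\<in>carrier G. f \<gamma> * l2_inner (\<pi> \<gamma> v) w)"
    by (intro infsum_cong) (simp add: parseval[OF pi_in[OF _ v] in_ell2[OF w]] sum_distrib_left mult.assoc)
  finally show ?thesis .
qed

lemma rep_ell1_linear: "linear_into H H (rep_ell1 G \<pi> f)"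
  unfolding linear_into_def
proof (intro conjI ballI allI)
  fix u v assume uv: "u \<in> H" "v \<in> H"
  note uv' = fvs.subspace_add[OF subspace_H uv]
  have lin: "\<pi> \<gamma> (u + v) = \<pi> \<gamma> u + \<pi> \<gamma> v" if "\<gamma> \<in> carrier G" for \<gamma>
    using pi_linear[OF that] uv by (auto simp: linear_into_def)
  show "rep_ell1 G \<pi> f (u + v) = rep_ell1 G \<pi> f u + rep_ell1 G \<pi> f v"
  proof (rule eq_by_inner)
    fix b assume b: "b \<in> B"
    have "l2_inner (rep_ell1 G \<pi> f (u + v)) b =
        (\<Sum>\<^sub>\<infinity>\<gamma>\<in>carrier G. f \<gamma> * l2_inner (\<pi> \<gamma> u) b + f \<gamma> * l2_inner (\<pi> \<gamma> v) b)"
      unfolding inner_rep_ell1[OF uv' B_sub[OF b]]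
      by (intro infsum_cong)
        (simp only: lin l2_inner_add_left[OF in_ell2[OF pi_in[OF _ uv(1)]] in_ell2[OF pi_in[OF _ uv(2)]] B_ell2[OF b]]
          distrib_left)
    also have "\<dots> = l2_inner (rep_ell1 G \<pi> f u) b + l2_inner (rep_ell1 G \<pi> f v) b"
      unfolding inner_rep_ell1[OF uv(1) B_sub[OF b]] inner_rep_ell1[OF uv(2) B_sub[OF b]]
      using uv B_sub[OF b] by (intro infsum_add coeff_summable)
    also have "\<dots> = l2_inner (rep_ell1 G \<pi> f u + rep_ell1 G \<pi> f v) b"
      by (rule l2_inner_add_left[symmetric, OF in_ell2[OF rep_ell1_in[OF uv(1)]]
          in_ell2[OF rep_ell1_in[OF uv(2)]] B_ell2[OF b]])
    finally show "l2_inner (rep_ell1 G \<pi> f (u + v)) b = l2_inner (rep_ell1 G \<pi> f u + rep_ell1 G \<pi> f v) b" .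
  qed (use uv uv' in \<open>auto intro: rep_ell1_in fvs.subspace_add[OF subspace_H]\<close>)
next
  fix c v assume v: "v \<in> H"
  note v' = fvs.subspace_scale[OF subspace_H v, of c]
  have lin: "\<pi> \<gamma> (fscale c v) = fscale c (\<pi> \<gamma> v)" if "\<gamma> \<in> carrier G" for \<gamma>
    using pi_linear[OF that] v by (auto simp: linear_into_def)
  show "rep_ell1 G \<pi> f (fscale c v) = fscale c (rep_ell1 G \<pi> f v)"
  proof (rule eq_by_inner)
    fix b assume b: "b \<in> B"
    have "l2_inner (rep_ell1 G \<pi> f (fscale c v)) b = (\<Sum>\<^sub>\<infinity>\<gamma>\<in>carrier G. c * (f \<gamma> * l2_inner (\<pi> \<gamma> v) b))"
      unfolding inner_rep_ell1[OF v' B_sub[OF b]]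
      by (intro infsum_cong) (simp only: lin l2_inner_scale_left mult.left_commute)
    also have "\<dots> = l2_inner (fscale c (rep_ell1 G \<pi> f v)) b"
      unfolding l2_inner_scale_left inner_rep_ell1[OF v B_sub[OF b]] by (rule infsum_cmult_right')
    finally show "l2_inner (rep_ell1 G \<pi> f (fscale c v)) b = l2_inner (fscale c (rep_ell1 G \<pi> f v)) b" .
  qed (use v v' in \<open>auto intro: rep_ell1_in fvs.subspace_scale[OF subspace_H]\<close>)
qed (rule rep_ell1_in)

text \<open>With \<open>\<pi> h\<close> moved across the inner product as
  \<open>\<pi> (inv h)\<close>, \<open>inner_rep_ell1\<close> applies; moving it back gives
  \<open>\<pi> (h \<otimes> \<gamma>)\<close>. Hence the inversion integrand depends on the
  representation through its character alone.\<close>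

lemma normalized_trace_pi_rep_ell1:
  assumes h: "h \<in> carrier G"
  shows "normalized_trace H (\<pi> h \<circ> rep_ell1 G \<pi> f) =
    (\<Sum>\<^sub>\<infinity>\<gamma>\<in>carrier G. f \<gamma> * normalized_trace H (\<pi> (h \<otimes> \<gamma>)))"
proof -
  have inner: "l2_inner (\<pi> h (rep_ell1 G \<pi> f b)) b =
      (\<Sum>\<^sub>\<infinity>\<gamma>\<in>carrier G. f \<gamma> * l2_inner (\<pi> \<gamma> b) (\<pi> (inv h) b))" if b: "b \<in> B" for b
    using pi_adj[OF h rep_ell1_in[OF B_sub[OF b]] B_sub[OF b]]
      inner_rep_ell1[OF B_sub[OF b] pi_in[OF inv_closed[OF h] B_sub[OF b]]] by simp
  have "(\<Sum>b\<in>B. l2_inner ((\<pi> h \<circ> rep_ell1 G \<pi> f) b) b) =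
      (\<Sum>\<^sub>\<infinity>\<gamma>\<in>carrier G. \<Sum>b\<in>B. f \<gamma> * l2_inner (\<pi> \<gamma> b) (\<pi> (inv h) b))"
    using inner B_sub pi_in[OF inv_closed[OF h]]
    by (subst infsum_sum_swap) (auto intro!: coeff_summable)
  also have "\<dots> = (\<Sum>\<^sub>\<infinity>\<gamma>\<in>carrier G. f \<gamma> * (\<Sum>b\<in>B. l2_inner (\<pi> (h \<otimes> \<gamma>) b) b))"
  proof (rule infsum_cong)
    fix \<gamma> assume \<gamma>: "\<gamma> \<in> carrier G"
    have "l2_inner (\<pi> \<gamma> b) (\<pi> (inv h) b) = l2_inner (\<pi> (h \<otimes> \<gamma>) b) b" if "b \<in> B" for b
      using pi_adj[OF h pi_in[OF \<gamma> B_sub[OF that]] B_sub[OF that]] pi_mult[OF h \<gamma> B_sub[OF that]] by simp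
    then show "(\<Sum>b\<in>B. f \<gamma> * l2_inner (\<pi> \<gamma> b) (\<pi> (inv h) b)) =
        f \<gamma> * (\<Sum>b\<in>B. l2_inner (\<pi> (h \<otimes> \<gamma>) b) b)"
      by (simp add: sum_distrib_left)
  qed
  finally show ?thesis
    using h unfolding normalized_trace_eq[OF linear_into_comp[OF rep_ell1_linear pi_linear[OF h]]]
    by (simp add: infsum_cmult_left'[symmetric] divide_inverse mult.assoc
        normalized_trace_eq[OF pi_linear] cong: infsum_cong)
qed

text \<open>\<open>hilbert_adjoint\<close> is a definite description, so a vector with the defining
  property has to be exhibited. Its coordinate at \<open>b\<close> is forced by testing that
  property on \<open>u = b\<close>.\<close>

lemma hilbert_adjoint_rep_ell1:
  assumes v: "v \<in> H"
  shows "hilbert_adjoint H (rep_ell1 G \<pi> f) v = (\<Sum>b\<in>B. fscale (l2_inner v (rep_ell1 G \<pi> f b)) b)" (is "_ = ?w")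
  unfolding hilbert_adjoint_def
proof (rule the_equality)
  let ?F = "rep_ell1 G \<pi> f"
  have "l2_inner (?F u) v = l2_inner u ?w" if u: "u \<in> H" for u
  proof -
    have "?F u = ?F (\<Sum>b\<in>B. fscale (l2_inner u b) b)" using expand[OF u] by simp
    also have "\<dots> = (\<Sum>b\<in>B. fscale (l2_inner u b) (?F b))"
      by (rule linear_into_sum[OF rep_ell1_linear subspace_H B_sub])
    finally have "l2_inner (?F u) v = (\<Sum>b\<in>B. l2_inner u b * l2_inner (?F b) v)"
      using l2_inner_sum_left[of B ?F I v I "l2_inner u"] v by (simp add: rep_ell1_in B_sub in_ell2)
    also have "\<dots> = (\<Sum>b\<in>B. cnj (l2_inner v (?F b)) * l2_inner u b)"
      by (simp add: l2_inner_cnj[symmetric] mult.commute)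
    also have "\<dots> = l2_inner u ?w"
      by (rule l2_inner_sum_right[OF B_ell2 in_ell2[OF u], symmetric])
    finally show ?thesis .
  qed
  then show *: "?w \<in> H \<and> (\<forall>u\<in>H. l2_inner (?F u) v = l2_inner u ?w)"
    by (intro conjI ballI comb_in)
  fix w assume w: "w \<in> H \<and> (\<forall>u\<in>H. l2_inner (?F u) v = l2_inner u w)"
  show "w = ?w"
  proof (rule eq_by_inner)
    fix b assume "b \<in> B"
    then have b: "b \<in> H" by (rule B_sub)
    have "l2_inner b w = l2_inner b ?w"
      using conjunct2[OF w, THEN bspec, OF b] conjunct2[OF *, THEN bspec, OF b] by (rule trans[OF sym])
    then show "l2_inner w b = l2_inner ?w b"
      unfolding l2_inner_cnj[of w b] l2_inner_cnj[of ?w b] by (rule arg_cong)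
  qed (rule conjunct1[OF w], rule comb_in)
qed

lemma hilbert_adjoint_linear: "linear_into H H (hilbert_adjoint H (rep_ell1 G \<pi> f))"
proof -
  let ?F = "rep_ell1 G \<pi> f"
  have F: "?F b \<in> ell2 I" if "b \<in> B" for b using that by (intro in_ell2 rep_ell1_in B_sub)
  show ?thesis
    unfolding linear_into_def
  proof (intro conjI ballI allI)
    fix v assume v: "v \<in> H"
    then show "hilbert_adjoint H ?F v \<in> H" by (simp only: hilbert_adjoint_rep_ell1 comb_in)
    fix c
    show "hilbert_adjoint H ?F (fscale c v) = fscale c (hilbert_adjoint H ?F v)"
      unfolding hilbert_adjoint_rep_ell1[OF v] hilbert_adjoint_rep_ell1[OF fvs.subspace_scale[OF subspace_H v]]
        fvs.scale_sum_right by (simp only: l2_inner_scale_left fvs.scale_scale)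
  next
    fix u v assume uv: "u \<in> H" "v \<in> H"
    have "(\<Sum>b\<in>B. fscale (l2_inner (u + v) (?F b)) b) =
        (\<Sum>b\<in>B. fscale (l2_inner u (?F b)) b + fscale (l2_inner v (?F b)) b)"
      by (intro sum.cong refl) (simp only: l2_inner_add_left[OF in_ell2[OF uv(1)] in_ell2[OF uv(2)] F]
          fvs.scale_left_distrib)
    then show "hilbert_adjoint H ?F (u + v) = hilbert_adjoint H ?F u + hilbert_adjoint H ?F v"
      unfolding hilbert_adjoint_rep_ell1[OF uv(1)] hilbert_adjoint_rep_ell1[OF uv(2)]
        hilbert_adjoint_rep_ell1[OF fvs.subspace_add[OF subspace_H uv]] sum.distrib .
  qed
qed

text \<open>The diagonal entry of the operator at \<open>b\<close> is the inner product of
  \<open>rep_ell1 G \<pi> f b\<close> with itself; expanding one of the two factors as a series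
  leaves traces of the kind treated in \<open>normalized_trace_pi_rep_ell1\<close>. So the
  Plancherel integrand is a series of inversion integrands.\<close>

lemma normalized_trace_adjoint:
  "normalized_trace H (hilbert_adjoint H (rep_ell1 G \<pi> f) \<circ> rep_ell1 G \<pi> f) =
    (\<Sum>\<^sub>\<infinity>\<gamma>\<in>carrier G. cnj (f \<gamma>) * normalized_trace H (\<pi> (inv \<gamma>) \<circ> rep_ell1 G \<pi> f))"
proof -
  let ?F = "rep_ell1 G \<pi> f"
  have FH: "?F b \<in> H" if "b \<in> B" for b using that by (intro rep_ell1_in B_sub)
  have 1: "l2_inner (hilbert_adjoint H ?F (?F b)) b =
      (\<Sum>\<^sub>\<infinity>\<gamma>\<in>carrier G. cnj (f \<gamma>) * l2_inner (\<pi> (inv \<gamma>) (?F b)) b)" if b: "b \<in> B" for b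
  proof -
    have "l2_inner (hilbert_adjoint H ?F (?F b)) b = l2_inner (?F b) (?F b)"
      unfolding hilbert_adjoint_rep_ell1[OF FH[OF b]] by (rule inner_comb[OF b])
    \<comment> \<open>The number equals its conjugate; conjugating makes the expansion of the first
      argument come out with \<open>cnj (f \<gamma>)\<close>.\<close>
    also have "\<dots> = cnj (l2_inner (?F b) (?F b))" by (rule l2_inner_cnj)
    also have "\<dots> = (\<Sum>\<^sub>\<infinity>\<gamma>\<in>carrier G. cnj (f \<gamma> * l2_inner (\<pi> \<gamma> b) (?F b)))"
      by (subst inner_rep_ell1[OF B_sub[OF b] FH[OF b]]) (rule infsum_cnj[symmetric])
    also have "\<dots> = (\<Sum>\<^sub>\<infinity>\<gamma>\<in>carrier G. cnj (f \<gamma>) * l2_inner (\<pi> (inv \<gamma>) (?F b)) b)"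
    proof (rule infsum_cong)
      fix \<gamma> assume "\<gamma> \<in> carrier G"
      then have "l2_inner (\<pi> (inv \<gamma>) (?F b)) b = l2_inner (?F b) (\<pi> \<gamma> b)"
        using pi_adj[OF inv_closed FH[OF b] B_sub[OF b]] by simp
      then show "cnj (f \<gamma> * l2_inner (\<pi> \<gamma> b) (?F b)) = cnj (f \<gamma>) * l2_inner (\<pi> (inv \<gamma>) (?F b)) b"
        by (simp add: l2_inner_cnj[symmetric])
    qed
    finally show ?thesis .
  qed
  have cf: "(\<lambda>\<gamma>. cmod (cnj (f \<gamma>))) summable_on carrier G" using f by simp
  have "(\<Sum>b\<in>B. l2_inner ((hilbert_adjoint H ?F \<circ> ?F) b) b) =
      (\<Sum>\<^sub>\<infinity>\<gamma>\<in>carrier G. \<Sum>b\<in>B. cnj (f \<gamma>) * l2_inner (\<pi> (inv \<gamma>) (?F b)) b)"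
  proof (subst infsum_sum_swap)
    fix b assume b: "b \<in> B"
    obtain M where "\<And>g. g \<in> carrier G \<Longrightarrow> cmod (l2_inner (\<pi> g (?F b)) b) \<le> M"
      using pi_coeff_bounded[OF FH[OF b] B_sub[OF b]] by blast
    then show "(\<lambda>\<gamma>. cnj (f \<gamma>) * l2_inner (\<pi> (inv \<gamma>) (?F b)) b) summable_on carrier G"
      by (intro summable_on_bounded_mult(2)[OF cf]) auto
  qed (simp add: 1)
  also have "\<dots> = (\<Sum>\<^sub>\<infinity>\<gamma>\<in>carrier G. cnj (f \<gamma>) * (\<Sum>b\<in>B. l2_inner ((\<pi> (inv \<gamma>) \<circ> ?F) b) b))"
    by (simp add: sum_distrib_left)
  finally show ?thesis
    unfolding normalized_trace_eq[OF linear_into_comp[OF rep_ell1_linear hilbert_adjoint_linear]]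
    by (simp add: infsum_cmult_left'[symmetric] divide_inverse mult.assoc
        normalized_trace_eq[OF linear_into_comp[OF rep_ell1_linear pi_linear]] cong: infsum_cong)
qed

end

end

text \<open>The intertwining unitary carries \<open>B\<close> to a basis of \<open>K\<close> with
  the same matrix coefficients. So normalised characters are functions of the class, and the
  representative chosen in \<open>on_class\<close> is immaterial.\<close>

lemma fin_rep_equivalent:
  assumes "fin_rep G I H \<pi> B" "unitary_rep G J (K, \<rho>)" "unitarily_equivalent G (H, \<pi>) (K, \<rho>)"
  shows "finite_dimensional K"
    and "g \<in> carrier G \<Longrightarrow> normalized_trace K (\<rho> g) = normalized_trace H (\<pi> g)"
proof -
  interpret H: fin_rep G I H \<pi> B by fact
  interpret K: unitary_rep_loc G J K \<rho> by unfold_locales (rule assms(2))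
  obtain U where U: "unitary_map H K U" "\<And>g v. g \<in> carrier G \<Longrightarrow> v \<in> H \<Longrightarrow> U (\<pi> g v) = \<rho> g (U v)"
    using assms(3) by (auto simp: unitarily_equivalent_def)
  note im = H.unitary_image[OF U(1) K.subspace_H' K.H_sub]
  interpret KB: fin_rep G J K \<rho> "U ` B"
    using im(1) by (intro fin_rep.intro K.unitary_rep_loc_axioms)
  show "finite_dimensional K" by (rule KB.finite_dimensional)
  assume g: "g \<in> carrier G"
  have "(\<Sum>b\<in>U ` B. l2_inner (\<rho> g b) b) = (\<Sum>b\<in>B. l2_inner (U (\<pi> g b)) (U b))"
    using im(2) U(2)[OF g H.B_sub] by (simp add: sum.reindex)
  also have "\<dots> = (\<Sum>b\<in>B. l2_inner (\<pi> g b) b)"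
    using U(1) H.B_sub H.pi_in[OF g H.B_sub] by (intro sum.cong) (auto simp: unitary_map_def)
  finally show "normalized_trace K (\<rho> g) = normalized_trace H (\<pi> g)"
    using im(2) by (simp add: KB.normalized_trace_eq[OF K.pi_linear[OF g]]
        H.normalized_trace_eq[OF H.pi_linear[OF g]] card_image)
qed

lemma (in onb) orthogonal_complement:
  assumes "onb I K C" "K \<subseteq> H"
    and K': "K' = {x \<in> H. \<forall>k\<in>K. l2_inner x k = 0}" and "onb I K' C'"
  shows "onb I H (C \<union> C')" "C \<inter> C' = {}"
proof -
  interpret C: onb I K C by fact
  interpret C': onb I K' C' by fact
  have orth: "l2_inner u v = 0" "l2_inner v u = 0" if "u \<in> C'" "v \<in> C" for u v
  proof -
    show "l2_inner u v = 0" using C'.B_sub[OF that(1)] C.B_sub[OF that(2)] K' by auto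
    then show "l2_inner v u = 0" by (subst l2_inner_cnj) simp
  qed
  show disj: "C \<inter> C' = {}"
    using orth C.inner_B by (metis disjoint_iff zero_neq_one)
  have "fvs.span (C \<union> C') = H"
  proof
    show "fvs.span (C \<union> C') \<subseteq> H"
      using C.B_sub C'.B_sub assms(2) K' by (intro fvs.span_minimal subspace_H) auto
    show "H \<subseteq> fvs.span (C \<union> C')"
    proof
      fix v assume v: "v \<in> H"
      have p: "C.proj v \<in> H" using C.proj_in assms(2) by blast
      have "v - C.proj v \<in> K'"
        unfolding K' using fvs.subspace_diff[OF subspace_H v p] C.proj_orth[OF in_ell2[OF v]] by blast
      then have "v - C.proj v \<in> fvs.span (C \<union> C')"
        using fvs.span_mono[of C' "C \<union> C'"] C'.span_B by blast
      moreover have "C.proj v \<in> fvs.span (C \<union> C')"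
        using C.proj_in fvs.span_mono[of C "C \<union> C'"] C.span_B by blast
      ultimately have "(v - C.proj v) + C.proj v \<in> fvs.span (C \<union> C')" by (rule fvs.span_add)
      then show "v \<in> fvs.span (C \<union> C')" by simp
    qed
  qed
  moreover have "l2_inner u v = (if u = v then 1 else 0)" if "u \<in> C \<union> C'" "v \<in> C \<union> C'" for u v
    using that orth C.inner_B C'.inner_B disj by (auto simp: disjoint_iff)
  ultimately show "onb I H (C \<union> C')" using sub by (simp add: onb_def orthonormal_basis_def)
qed

text \<open>Induction on the dimension: a proper invariant subspace and its orthogonal complement
  are both smaller. The pieces are recorded by disjoint bases \<open>D\<close> whose union is a
  basis of \<open>H\<close>, so that dimensions and traces become sums over a disjoint union and
  equivalent pieces stay apart.\<close>

lemma unitary_rep_decomposition: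
  assumes "fin_rep G I H \<pi> B"
  shows "\<exists>\<B>. finite \<B> \<and> disjoint \<B> \<and> onb I H (\<Union>\<B>) \<and>
    (\<forall>D\<in>\<B>. irreducible_rep G I (fvs.span D, \<pi>) \<and> onb I (fvs.span D) D)"
  using assms
proof (induction "card B" arbitrary: H B rule: less_induct)
  case less
  interpret H: fin_rep G I H \<pi> B by fact
  show ?case
  proof (cases "H = {0}")
    case True
    \<comment> \<open>The zero space is not irreducible; it gets the empty decomposition.\<close>
    have "onb I H (\<Union>{})" unfolding onb_def orthonormal_basis_def True
      using fvs.subspace_0[OF ell2_subspace] by simp
    then show ?thesis by (intro exI[of _ "{}"]) (simp add: disjoint_def)
  next
    case H0: False
    show ?thesis
    proof (cases "irreducible_rep G I (H, \<pi>)")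
      case True
      then show ?thesis using H.onb_axioms H.span_B
        by (intro exI[of _ "{B}"]) (simp add: disjoint_def)
    next
      case False
      then obtain K where K: "closed_subspace I K" "K \<subseteq> H" "\<And>g. g \<in> carrier G \<Longrightarrow> \<pi> g ` K \<subseteq> K"
        "K \<noteq> {0}" "K \<noteq> H"
        using H0 H.rep unfolding irreducible_rep_def prod.case by blast
      have Ks: "fvs.subspace K" using K(1) by (simp add: closed_subspace_def)
      define K' where "K' = {x \<in> H. \<forall>k\<in>K. l2_inner x k = 0}"
      have KI: "k \<in> ell2 I" if "k \<in> K" for k using that K(2) H.in_ell2 by blast
      have K's: "fvs.subspace K'"
        unfolding K'_def
      proof (rule fvs.subspaceI)
        show "0 \<in> {x \<in> H. \<forall>k\<in>K. l2_inner x k = 0}" using fvs.subspace_0[OF H.subspace_H] by simp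
      next
        fix x y assume "x \<in> {x \<in> H. \<forall>k\<in>K. l2_inner x k = 0}" "y \<in> {x \<in> H. \<forall>k\<in>K. l2_inner x k = 0}"
        then show "x + y \<in> {x \<in> H. \<forall>k\<in>K. l2_inner x k = 0}"
          using fvs.subspace_add[OF H.subspace_H] l2_inner_add_left[OF H.in_ell2 H.in_ell2 KI] by auto
      next
        fix c x assume "x \<in> {x \<in> H. \<forall>k\<in>K. l2_inner x k = 0}"
        then show "fscale c x \<in> {x \<in> H. \<forall>k\<in>K. l2_inner x k = 0}"
          using fvs.subspace_scale[OF H.subspace_H] by (auto simp: l2_inner_scale_left)
      qed
      have K'H: "K' \<subseteq> H" by (auto simp: K'_def)
      \<comment> \<open>The complement is invariant because the adjoint of \<open>\<pi> g\<close> is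
        \<open>\<pi> (inv g)\<close>, which preserves \<open>K\<close>.\<close>
      have K'inv: "\<pi> g ` K' \<subseteq> K'" if g: "g \<in> carrier G" for g
      proof
        fix y assume "y \<in> \<pi> g ` K'"
        then obtain x where x: "x \<in> K'" "y = \<pi> g x" by blast
        have xH: "x \<in> H" using x K'H by blast
        have "l2_inner (\<pi> g x) k = 0" if k: "k \<in> K" for k
        proof -
          have "\<pi> (inv\<^bsub>G\<^esub> g) k \<in> K" using K(3)[of "inv\<^bsub>G\<^esub> g"] g k by auto
          then show ?thesis using H.pi_adj[OF g xH] K(2) k x(1) by (auto simp: K'_def)
        qed
        then show "y \<in> K'" using H.pi_in[OF g xH] x(2) by (auto simp: K'_def)
      qed
      obtain C where C: "onb I K C" using H.subspace_onb[OF Ks K(2)] by blast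
      obtain C' where C': "onb I K' C'" using H.subspace_onb[OF K's K'H] by blast
      note comp = H.orthogonal_complement[OF C K(2) K'_def]
      interpret C: onb I K C by fact
      interpret C': onb I K' C' by fact
      have "card (C \<union> C') = card B"
        using onb.dim_H[OF comp(1)[OF C']] H.dim_H by simp
      then have card: "card C + card C' = card B"
        using comp(2)[OF C'] by (simp add: card_Un_disjoint)
      have "C \<noteq> {}" using C.span_B K(4) by auto
      moreover have "C' \<noteq> {}"
      proof
        assume "C' = {}"
        then have "onb I H C" using comp(1)[OF C'] by simp
        then show False using onb.span_B[of I H C] C.span_B K(5) by simp
      qed
      ultimately have lt: "card C < card B" "card C' < card B"
        using card card_gt_0_iff[of C] card_gt_0_iff[of C'] by auto
      have fr: "fin_rep G I K \<pi> C" "fin_rep G I K' \<pi> C'"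
        using H.subrep[OF K(1-3)] H.subrep[OF C'.closed K'H K'inv] C C' H.is_group
        by (auto intro!: fin_rep.intro unitary_rep_loc.intro simp: unitary_rep_loc_axioms_def)
      obtain \<B> where b: "finite \<B>" "disjoint \<B>" "onb I K (\<Union>\<B>)"
        "\<And>D. D \<in> \<B> \<Longrightarrow> irreducible_rep G I (fvs.span D, \<pi>) \<and> onb I (fvs.span D) D"
        using less.hyps[OF lt(1) fr(1)] by blast
      obtain \<B>' where b': "finite \<B>'" "disjoint \<B>'" "onb I K' (\<Union>\<B>')"
        "\<And>D. D \<in> \<B>' \<Longrightarrow> irreducible_rep G I (fvs.span D, \<pi>) \<and> onb I (fvs.span D) D"
        using less.hyps[OF lt(2) fr(2)] by blast
      note comp' = H.orthogonal_complement[OF b(3) K(2) K'_def b'(3)]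
      have "disjoint (\<B> \<union> \<B>')" by (rule disjoint_union[OF b(2) b'(2) comp'(2)])
      moreover have "\<Union>(\<B> \<union> \<B>') = \<Union>\<B> \<union> \<Union>\<B>'" by blast
      ultimately show ?thesis using b(1,4) b'(1,4) comp'(1)
        by (intro exI[of _ "\<B> \<union> \<B>'"]) auto
    qed
  qed
qed

section \<open>The regular representation of a finite quotient\<close>

definition unit_vec :: "'i \<Rightarrow> 'i \<Rightarrow> complex" where
  "unit_vec t = (\<lambda>i. if i = t then 1 else 0)"

lemma ell2_finite:
  assumes "finite T"
  shows "ell2 T = {x. \<forall>i. i \<notin> T \<longrightarrow> x i = 0}"
proof -
  have "(\<lambda>i. (cmod (x i))\<^sup>2) summable_on UNIV" if "\<forall>i. i \<notin> T \<longrightarrow> x i = 0" for x :: "'a \<Rightarrow> complex"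
  proof -
    have "(\<lambda>i. (cmod (x i))\<^sup>2) summable_on T" using assms by simp
    then show ?thesis using that by (subst summable_on_cong_neutral[of T UNIV]) auto
  qed
  then show ?thesis by (auto simp: ell2_def)
qed

lemma l2_inner_finite:
  assumes "finite T" "x \<in> ell2 T"
  shows "l2_inner x y = (\<Sum>t\<in>T. x t * cnj (y t))"
proof -
  have "l2_inner x y = (\<Sum>\<^sub>\<infinity>t\<in>T. x t * cnj (y t))"
    unfolding l2_inner_def using assms(2) by (intro infsum_cong_neutral) (auto simp: ell2_def)
  then show ?thesis using assms(1) by simp
qed

lemma ell2_mono: "T \<subseteq> I \<Longrightarrow> ell2 T \<subseteq> ell2 I"
  by (auto simp: ell2_def)

lemma unit_vec_in: "finite T \<Longrightarrow> t \<in> T \<Longrightarrow> unit_vec t \<in> ell2 T"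
  by (auto simp: ell2_finite unit_vec_def)

lemma inner_unit_vec:
  assumes "finite T" "x \<in> ell2 T" "t \<in> T"
  shows "l2_inner x (unit_vec t) = x t"
proof -
  have "(\<Sum>s\<in>T. x s * cnj (unit_vec t s)) = (\<Sum>s\<in>T. if s = t then x s else 0)"
    by (intro sum.cong) (auto simp: unit_vec_def)
  then show ?thesis using assms by (simp add: l2_inner_finite)
qed

lemma inj_unit_vec: "inj unit_vec"
  by (rule injI) (metis unit_vec_def zero_neq_one)

lemma onb_unit_vec:
  assumes T: "finite T" "T \<subseteq> I"
  shows "onb I (ell2 T) (unit_vec ` T)"
proof -
  have "fvs.span (unit_vec ` T) = ell2 T"
  proof
    show "fvs.span (unit_vec ` T) \<subseteq> ell2 T"
      using unit_vec_in[OF T(1)] by (intro fvs.span_minimal ell2_subspace) auto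
    show "ell2 T \<subseteq> fvs.span (unit_vec ` T)"
    proof
      fix x :: "'a \<Rightarrow> complex" assume x: "x \<in> ell2 T"
      have "x i = (\<Sum>t\<in>T. fscale (x t) (unit_vec t)) i" for i
      proof -
        have "(\<Sum>t\<in>T. fscale (x t) (unit_vec t)) i = (\<Sum>t\<in>T. if t = i then x t else 0)"
          unfolding sum_fun_apply by (intro sum.cong) (auto simp: fscale_apply unit_vec_def)
        also have "\<dots> = x i" using x T(1) by (auto simp: ell2_def)
        finally show ?thesis by simp
      qed
      then have "x = (\<Sum>t\<in>T. fscale (x t) (unit_vec t))" by (rule ext)
      also have "\<dots> \<in> fvs.span (unit_vec ` T)" by (intro fvs.span_sum fvs.span_scale fvs.span_base) auto
      finally show "x \<in> fvs.span (unit_vec ` T)" .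
    qed
  qed
  moreover have "l2_inner (unit_vec s) (unit_vec t) = (if unit_vec s = unit_vec t then 1 else 0)"
    if "s \<in> T" "t \<in> T" for s t
    using inner_unit_vec[OF T(1) unit_vec_in[OF T(1) that(1)] that(2)] inj_eq[OF inj_unit_vec, of s t]
    by (simp add: unit_vec_def)
  ultimately show ?thesis using T ell2_mono[OF T(2)]
    by (auto simp: onb_def orthonormal_basis_def)
qed

text \<open>
  The regular representation of \<open>G/N\<close>, carried by the functions on a transversal \<open>T\<close> of \<open>N\<close>:
  \<open>r g\<close> is the representative of the coset of \<open>g\<close>.
\<close>

locale transversal = normal N G for N and G :: "('a, 'b) monoid_scheme" (structure) +
  fixes T :: "'a set" and r :: "'a \<Rightarrow> 'a"
  assumes T: "finite T" "T \<subseteq> carrier G" "T \<noteq> {}"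
    and r: "g \<in> carrier G \<Longrightarrow> r g \<in> T" "g \<in> carrier G \<Longrightarrow> N #> r g = N #> g" "t \<in> T \<Longrightarrow> r t = t"
    and r_cong: "g \<in> carrier G \<Longrightarrow> h \<in> carrier G \<Longrightarrow> N #> g = N #> h \<Longrightarrow> r g = r h"
begin

text \<open>Left translation by \<open>g\<close>. It acts on functions of representatives rather
  than of cosets because \<open>irreps\<close> admits only spaces of functions on the element type
  of \<open>G\<close>; the value 0 off \<open>T\<close> keeps the result in \<open>ell2 T\<close>, a
  subspace of \<open>ell2 (carrier G)\<close>.\<close>

definition regular :: "'a \<Rightarrow> ('a \<Rightarrow> complex) \<Rightarrow> 'a \<Rightarrow> complex" where
  "regular g x = (\<lambda>t. if t \<in> T then x (r (inv g \<otimes> t)) else 0)"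

text \<open>As \<open>N\<close> is normal, the coset of a product depends only on the cosets of its
  factors. Inner occurrences of \<open>r\<close> can thus be dropped, which makes
  \<open>regular\<close> multiplicative.\<close>

lemma r_mult:
  assumes "g \<in> carrier G" "h \<in> carrier G"
  shows "r (g \<otimes> r h) = r (g \<otimes> h)"
proof (rule r_cong)
  have rh: "r h \<in> carrier G" using r(1)[OF assms(2)] T(2) by blast
  then show "g \<otimes> r h \<in> carrier G" "g \<otimes> h \<in> carrier G" using assms by auto
  show "N #> (g \<otimes> r h) = N #> (g \<otimes> h)"
    using rcos_sum[OF assms(1) rh] rcos_sum[OF assms] r(2)[OF assms(2)] by simp
qed

lemma r_cancel: "g \<in> carrier G \<Longrightarrow> t \<in> T \<Longrightarrow> r (g \<otimes> r (inv g \<otimes> t)) = t"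
  using r_mult[of g "inv g \<otimes> t"] r(3) T(2) by (auto simp: m_assoc[symmetric])

lemma regular_in: "regular g x \<in> ell2 T"
  by (simp add: ell2_finite[OF T(1)] regular_def)

lemma regular_mult:
  assumes g: "g \<in> carrier G" and h: "h \<in> carrier G"
  shows "regular (g \<otimes> h) x = regular g (regular h x)"
proof
  fix t
  have "r (inv g \<otimes> t) \<in> T" "r (inv (g \<otimes> h) \<otimes> t) = r (inv h \<otimes> r (inv g \<otimes> t))" if "t \<in> T"
  proof -
    have t: "t \<in> carrier G" using that T(2) by blast
    show "r (inv g \<otimes> t) \<in> T" using r(1) g t by simp
    show "r (inv (g \<otimes> h) \<otimes> t) = r (inv h \<otimes> r (inv g \<otimes> t))"
      using g h t r_mult[of "inv h" "inv g \<otimes> t"] by (simp add: inv_mult_group m_assoc)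
  qed
  then show "regular (g \<otimes> h) x t = regular g (regular h x) t" by (simp add: regular_def)
qed

lemma regular_one:
  assumes "x \<in> ell2 T"
  shows "regular \<one> x = x"
proof
  fix t
  have "r (inv \<one> \<otimes> t) = t" if "t \<in> T" using that T(2) r(3) by auto
  then show "regular \<one> x t = x t" using assms by (simp add: regular_def ell2_def)
qed

lemma regular_unitary:
  assumes g: "g \<in> carrier G"
  shows "unitary_map (ell2 T) (ell2 T) (regular g)"
  unfolding unitary_map_def
proof (intro conjI ballI allI)
  show "bij_betw (regular g) (ell2 T) (ell2 T)"
  proof (rule bij_betw_byWitness[of _ "regular (inv g)"])
    show "\<forall>x\<in>ell2 T. regular (inv g) (regular g x) = x"
      using regular_mult[of "inv g" g] regular_one g by auto
    show "\<forall>x\<in>ell2 T. regular g (regular (inv g) x) = x"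
      using regular_mult[of g "inv g"] regular_one g by auto
  qed (use regular_in in auto)
  fix x y :: "'a \<Rightarrow> complex" assume x: "x \<in> ell2 T" and y: "y \<in> ell2 T"
  have "l2_inner (regular g x) (regular g y) =
      (\<Sum>t\<in>T. x (r (inv g \<otimes> t)) * cnj (y (r (inv g \<otimes> t))))"
    unfolding l2_inner_finite[OF T(1) regular_in] by (simp add: regular_def)
  also have "\<dots> = (\<Sum>t\<in>T. x t * cnj (y t))"
  proof (rule sum.reindex_bij_witness[of _ "\<lambda>t. r (g \<otimes> t)" "\<lambda>t. r (inv g \<otimes> t)"])
    fix t assume t: "t \<in> T"
    then have tc: "t \<in> carrier G" using T(2) by blast
    show "r (g \<otimes> r (inv g \<otimes> t)) = t" using g t by (rule r_cancel)
    show "r (inv g \<otimes> t) \<in> T" "r (g \<otimes> t) \<in> T" using r(1) g tc by auto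
    show "r (inv g \<otimes> r (g \<otimes> t)) = t" using r_cancel[of "inv g" t] g t by simp
  qed simp
  also have "\<dots> = l2_inner x y" by (simp add: l2_inner_finite[OF T(1) x])
  finally show "l2_inner (regular g x) (regular g y) = l2_inner x y" .
qed (auto simp: regular_def fscale_apply fun_eq_iff)

lemma fin_rep_regular: "fin_rep G (carrier G) (ell2 T) regular (unit_vec ` T)"
proof -
  note B = onb_unit_vec[OF T(1,2)]
  have "unitary_rep G (carrier G) (ell2 T, regular)"
    unfolding unitary_rep_def using onb.closed[OF B] regular_unitary regular_mult by simp
  then show ?thesis
    using B is_group by (intro fin_rep.intro unitary_rep_loc.intro unitary_rep_loc_axioms.intro)
qed

text \<open>In the basis of point masses this is the trace of a permutation matrix: translation by
  \<open>g\<close> fixes every coset if \<open>g\<close> lies in \<open>N\<close>, and none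
  otherwise.\<close>

lemma regular_trace:
  assumes g: "g \<in> carrier G"
  shows "(\<Sum>b\<in>unit_vec ` T. l2_inner (regular g b) b) = (if g \<in> N then of_nat (card T) else 0)"
proof -
  have fix_iff: "r (inv g \<otimes> t) = t \<longleftrightarrow> g \<in> N" if t: "t \<in> T" for t
  proof -
    have tc: "t \<in> carrier G" "inv g \<otimes> t \<in> carrier G" using t T(2) g by auto
    have "r (inv g \<otimes> t) = t \<longleftrightarrow> N #> (inv g \<otimes> t) = N #> t"
      using r(2)[OF tc(2)] r(3)[OF t] r_cong[OF tc(2,1)] by metis
    also have "\<dots> \<longleftrightarrow> (inv g \<otimes> t) \<otimes> inv t \<in> N" using repr_independenceD repr_independence is_subgroup tc
      by (metis is_group group.rcos_self rcos_module)
    also have "\<dots> \<longleftrightarrow> inv g \<in> N" using g tc by (simp add: m_assoc)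
    also have "\<dots> \<longleftrightarrow> g \<in> N" using g m_inv_closed inv_inv by metis
    finally show ?thesis .
  qed
  have "(\<Sum>b\<in>unit_vec ` T. l2_inner (regular g b) b) = (\<Sum>t\<in>T. l2_inner (regular g (unit_vec t)) (unit_vec t))"
    by (simp add: sum.reindex[OF inj_on_subset[OF inj_unit_vec]])
  also have "\<dots> = (\<Sum>t\<in>T. if g \<in> N then 1 else 0)"
  proof (rule sum.cong)
    fix t assume t: "t \<in> T"
    have "l2_inner (regular g (unit_vec t)) (unit_vec t) = regular g (unit_vec t) t"
      by (rule inner_unit_vec[OF T(1) regular_in t])
    also have "\<dots> = (if r (inv g \<otimes> t) = t then 1 else 0)" using t by (simp add: regular_def unit_vec_def)
    finally show "l2_inner (regular g (unit_vec t)) (unit_vec t) = (if g \<in> N then 1 else 0)"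
      unfolding fix_iff[OF t] .
  qed simp
  finally show ?thesis by simp
qed

end

lemma (in normal) transversal_exists:
  assumes "finite (carrier (G Mod H))"
  obtains T r where "transversal H G T r"
proof -
  define s where "s C = (SOME x. x \<in> C)" for C :: "'a set"
  \<comment> \<open>The representative is picked from the coset as a set, so all elements of one
    coset get the same one.\<close>
  define r where "r g = s (H #> g)" for g
  have sub: "H #> g \<subseteq> carrier G" if "g \<in> carrier G" for g
    using that by (rule r_coset_subset_G[OF subset])
  have r_in: "r g \<in> H #> g" if "g \<in> carrier G" for g
    unfolding r_def s_def by (rule someI) (rule rcos_self[OF that is_subgroup])
  have r_rcos: "H #> r g = H #> g" if "g \<in> carrier G" for g
    using repr_independence[OF r_in[OF that] that is_subgroup] by simp
  have "transversal H G (r ` carrier G) r"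
  proof
    have "r ` carrier G = s ` carrier (G Mod H)" by (auto simp: r_def FactGroup_def RCOSETS_def)
    then show "finite (r ` carrier G)" using assms by simp
    show "r ` carrier G \<subseteq> carrier G" using r_in sub by blast
    show "r ` carrier G \<noteq> {}" by auto
    show "r g \<in> r ` carrier G" if "g \<in> carrier G" for g using that by blast
    show "H #> r g = H #> g" if "g \<in> carrier G" for g using that by (rule r_rcos)
    show "r t = t" if t: "t \<in> r ` carrier G" for t
    proof -
      obtain g where g: "t = r g" "g \<in> carrier G" using t by (rule imageE)
      show ?thesis unfolding g(1) r_def[of "r g"] r_rcos[OF g(2)] by (rule r_def[symmetric])
    qed
    show "r g = r h" if "H #> g = H #> h" for g h using that unfolding r_def by (rule arg_cong)
  qed
  then show thesis by (rule that)
qed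

text \<open>Two evaluations of one trace. In the point masses it is given by
  \<open>regular_trace\<close>; in the basis adapted to the decomposition it is the sum of the
  traces of the pieces, where the factor \<open>card D\<close> undoes the normalisation.\<close>

lemma (in normal) finite_quotient_decomposition:
  assumes "finite (carrier (G Mod H))"
  obtains \<B> \<pi> m where "finite \<B>" "m > 0" "(\<Sum>D\<in>\<B>. card D) = m"
    "\<And>D. D \<in> \<B> \<Longrightarrow> irreducible_rep G (carrier G) (fvs.span D, \<pi>)"
    "\<And>D. D \<in> \<B> \<Longrightarrow> fin_rep G (carrier G) (fvs.span D) \<pi> D"
    "\<And>g. g \<in> carrier G \<Longrightarrow>
      (\<Sum>D\<in>\<B>. of_nat (card D) * normalized_trace (fvs.span D) (\<pi> g)) = (if g \<in> H then of_nat m else 0)"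
proof -
  obtain T r where "transversal H G T r" using transversal_exists[OF assms] by blast
  then interpret transversal H G T r .
  interpret R: fin_rep G "carrier G" "ell2 T" regular "unit_vec ` T" by (rule fin_rep_regular)
  obtain \<B> where b: "finite \<B>" "disjoint \<B>" "onb (carrier G) (ell2 T) (\<Union>\<B>)"
    "\<And>D. D \<in> \<B> \<Longrightarrow> irreducible_rep G (carrier G) (fvs.span D, regular) \<and> onb (carrier G) (fvs.span D) D"
    using unitary_rep_decomposition[OF fin_rep_regular] by blast
  have fr: "fin_rep G (carrier G) (fvs.span D) regular D" if "D \<in> \<B>" for D
    using b(4)[OF that] is_group unfolding irreducible_rep_def
    by (intro fin_rep.intro unitary_rep_loc.intro unitary_rep_loc_axioms.intro) auto
  have finD: "finite D" if "D \<in> \<B>" for D using b(4)[OF that] onb.finite_B by blast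
  have disj: "\<forall>A\<in>\<B>. \<forall>B\<in>\<B>. A \<noteq> B \<longrightarrow> A \<inter> B = {}" using b(2) by (auto simp: disjoint_def)
  show thesis
  proof (rule that[of \<B> "card T" regular])
    show "finite \<B>" by (rule b(1))
    show "card T > 0" using T by (simp add: card_gt_0_iff)
    have "(\<Sum>D\<in>\<B>. card D) = card (\<Union>\<B>)"
      using card_Union_disjoint[of \<B>] b(2) finD by (simp add: disjoint_def pairwise_def disjnt_def)
    also have "\<dots> = card (unit_vec ` T)" using onb.dim_H[OF b(3)] R.dim_H by simp
    also have "\<dots> = card T" by (rule card_image[OF inj_on_subset[OF inj_unit_vec]]) simp
    finally show "(\<Sum>D\<in>\<B>. card D) = card T" .
    fix g assume g: "g \<in> carrier G"
    have "of_nat (card D) * normalized_trace (fvs.span D) (regular g) = (\<Sum>b\<in>D. l2_inner (regular g b) b)"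
      if D: "D \<in> \<B>" for D
    proof -
      interpret D: fin_rep G "carrier G" "fvs.span D" regular D by (rule fr[OF D])
      have "D = {}" if "card D = 0" using that finD[OF D] by simp
      then show ?thesis by (cases "card D = 0") (auto simp: D.normalized_trace_eq[OF D.pi_linear[OF g]])
    qed
    then have "(\<Sum>D\<in>\<B>. of_nat (card D) * normalized_trace (fvs.span D) (regular g)) =
        (\<Sum>D\<in>\<B>. \<Sum>b\<in>D. l2_inner (regular g b) b)" by simp
    also have "\<dots> = (\<Sum>b\<in>\<Union>\<B>. l2_inner (regular g b) b)"
      using sum.Union_disjoint[of \<B> "\<lambda>b. l2_inner (regular g b) b"] finD disj by simp
    also have "\<dots> = (\<Sum>b\<in>unit_vec ` T. l2_inner (regular g b) b)"
      by (rule sum_inner_basis_independent[OF b(3) R.onb_axioms R.pi_linear[OF g]])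
    finally show "(\<Sum>D\<in>\<B>. of_nat (card D) * normalized_trace (fvs.span D) (regular g)) =
        (if g \<in> H then of_nat (card T) else 0)"
      unfolding regular_trace[OF g] .
  qed (use b(4) fr in auto)
qed

section \<open>Limits of finitely supported measures\<close>

lemma infsum_split_finite:
  fixes f :: "'a \<Rightarrow> real"
  assumes "f summable_on A" "finite F" "F \<subseteq> A"
  shows "infsum f A = sum f F + infsum f (A - F)"
proof -
  have "infsum f (F \<union> (A - F)) = infsum f F + infsum f (A - F)"
    using assms by (intro infsum_Un_disjoint summable_on_Diff) auto
  moreover have "F \<union> (A - F) = A" using assms by blast
  ultimately show ?thesis using assms(2) by simp
qed

text \<open>Dominated convergence along an arbitrary filter, as a net of finite sets demands:
  outside a finite \<open>F\<close> the mass of \<open>f\<close> is at most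
  \<open>\<epsilon> / (2 * C)\<close>, which bounds the tail for every \<open>n\<close> at once, and
  on \<open>F\<close> only finitely many limits are taken.\<close>

lemma tendsto_infsum_dominated:
  fixes f :: "'a \<Rightarrow> complex" and h :: "'n \<Rightarrow> 'a \<Rightarrow> complex"
  assumes f: "(\<lambda>x. cmod (f x)) summable_on A"
    and h: "\<And>n x. x \<in> A \<Longrightarrow> cmod (h n x) \<le> M"
    and l: "\<And>x. x \<in> A \<Longrightarrow> cmod (l x) \<le> M"
    and lim: "\<And>x. x \<in> A \<Longrightarrow> ((\<lambda>n. h n x) \<longlongrightarrow> l x) \<F>"
  shows "((\<lambda>n. \<Sum>\<^sub>\<infinity>x\<in>A. f x * h n x) \<longlongrightarrow> (\<Sum>\<^sub>\<infinity>x\<in>A. f x * l x)) \<F>"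
proof (rule tendstoI)
  fix \<epsilon> :: real assume \<epsilon>: "\<epsilon> > 0"
  \<comment> \<open>\<open>2 * \<bar>M\<bar>\<close> bounds the difference of \<open>h\<close> and
    \<open>l\<close>; the summand 1 makes \<open>C\<close> positive, as it becomes a
    divisor.\<close>
  define C where "C = 2 * \<bar>M\<bar> + 1"
  have C: "C > 0" by (simp add: C_def)
  have diff: "cmod (h n x - l x) \<le> C" if "x \<in> A" for n x
  proof -
    have "cmod (h n x) \<le> M" using that by (rule h)
    then show ?thesis
      using norm_triangle_ineq4[of "h n x" "l x"] l[OF that] unfolding C_def by linarith
  qed
  let ?e = "\<lambda>n x. cmod (f x) * cmod (h n x - l x)"
  have es: "?e n summable_on A" for n
  proof -
    have "(\<lambda>x. cmod (f x * (h n x - l x))) summable_on A"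
      by (rule summable_on_bounded_mult(1)[OF f]) (rule diff)
    then show ?thesis by (simp add: norm_mult)
  qed
  have le: "dist (\<Sum>\<^sub>\<infinity>x\<in>A. f x * h n x) (\<Sum>\<^sub>\<infinity>x\<in>A. f x * l x) \<le> infsum (?e n) A" for n
  proof -
    have d: "(\<lambda>x. cmod (f x * (h n x - l x))) summable_on A"
      using es by (simp add: norm_mult)
    note d' = abs_summable_summable[OF d]
    have "(\<Sum>\<^sub>\<infinity>x\<in>A. f x * (h n x - l x) + f x * l x) =
        (\<Sum>\<^sub>\<infinity>x\<in>A. f x * (h n x - l x)) + (\<Sum>\<^sub>\<infinity>x\<in>A. f x * l x)"
      by (rule infsum_add[OF d' summable_on_bounded_mult(2)[OF f l]])
    then have "(\<Sum>\<^sub>\<infinity>x\<in>A. f x * h n x) - (\<Sum>\<^sub>\<infinity>x\<in>A. f x * l x) = (\<Sum>\<^sub>\<infinity>x\<in>A. f x * (h n x - l x))"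
      by (simp add: algebra_simps)
    then show ?thesis using norm_infsum_bound[OF d] by (simp add: dist_norm norm_mult)
  qed
  have "\<epsilon> / (2 * C) > 0" using \<epsilon> C by simp
  then obtain F where F: "finite F" "F \<subseteq> A"
    "dist (\<Sum>x\<in>F. cmod (f x)) (\<Sum>\<^sub>\<infinity>x\<in>A. cmod (f x)) \<le> \<epsilon> / (2 * C)"
    using infsum_finite_approximation[OF f] by blast
  have fs: "(\<lambda>x. cmod (f x)) summable_on (A - F)" using f F by (intro summable_on_Diff) auto
  have tail: "infsum (?e n) (A - F) \<le> \<epsilon> / 2" for n
  proof -
    have "infsum (?e n) (A - F) \<le> infsum (\<lambda>x. cmod (f x) * C) (A - F)"
    proof (rule infsum_mono)
      show "?e n summable_on (A - F)" using es F by (intro summable_on_Diff) auto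
      show "(\<lambda>x. cmod (f x) * C) summable_on (A - F)" using fs by (rule summable_on_cmult_left)
    qed (use diff in \<open>auto intro: mult_left_mono\<close>)
    also have "\<dots> = (\<Sum>\<^sub>\<infinity>x\<in>A - F. cmod (f x)) * C" by (rule infsum_cmult_left')
    also have "\<dots> \<le> \<epsilon> / (2 * C) * C"
      using F(3) C infsum_split_finite[OF f F(1,2)] by (intro mult_right_mono) (auto simp: dist_real_def)
    finally show ?thesis using C by simp
  qed
  have "((\<lambda>n. \<Sum>x\<in>F. ?e n x) \<longlongrightarrow> (\<Sum>x\<in>F. cmod (f x) * cmod (l x - l x))) \<F>"
    using lim F(2) by (intro tendsto_sum tendsto_mult tendsto_const tendsto_norm tendsto_diff) auto
  then have "((\<lambda>n. \<Sum>x\<in>F. ?e n x) \<longlongrightarrow> 0) \<F>" by simp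
  then have "eventually (\<lambda>n. (\<Sum>x\<in>F. ?e n x) < \<epsilon> / 2) \<F>"
    using \<epsilon> by (intro order_tendstoD(2)) auto
  then show "eventually (\<lambda>n. dist (\<Sum>\<^sub>\<infinity>x\<in>A. f x * h n x) (\<Sum>\<^sub>\<infinity>x\<in>A. f x * l x) < \<epsilon>) \<F>"
  proof eventually_elim
    case (elim n)
    then show ?case
      using le[of n] tail[of n] infsum_split_finite[OF es F(1,2), of n] by linarith
  qed
qed

text \<open>Compactness of the cube supplies a cluster point, but limits are wanted. Refining
  \<open>\<F>\<close> by the preimages of the neighbourhoods of \<open>\<mu>\<close> gives a proper
  filter along which the values at all \<open>A\<close> converge together.\<close>

lemma cluster_point_bounded:
  fixes \<nu> :: "'n \<Rightarrow> 'x \<Rightarrow> real"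
  assumes "\<F> \<noteq> bot" "\<And>n A. 0 \<le> \<nu> n A \<and> \<nu> n A \<le> 1"
  obtains \<mu> \<W> where "\<W> \<noteq> bot" "\<W> \<le> \<F>" "\<And>A. ((\<lambda>n. \<nu> n A) \<longlongrightarrow> \<mu> A) \<W>"
proof -
  let ?K = "PiE UNIV (\<lambda>_::'x. {0..1::real})"
  have "compact ?K"
    unfolding compactin_euclidean_iff[symmetric] euclidean_product_topology[symmetric] compactin_PiE by simp
  moreover have "filtermap \<nu> \<F> \<noteq> bot" using assms(1) by (simp add: filtermap_bot_iff)
  moreover have "eventually (\<lambda>x. x \<in> ?K) (filtermap \<nu> \<F>)"
    unfolding eventually_filtermap using assms(2) by (simp add: PiE_def)
  ultimately obtain \<mu> where \<mu>: "inf (nhds \<mu>) (filtermap \<nu> \<F>) \<noteq> bot"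
    unfolding compact_filter by blast
  define \<W> where "\<W> = inf (filtercomap \<nu> (nhds \<mu>)) \<F>"
  have "\<W> \<noteq> bot"
  proof
    assume "\<W> = bot"
    then have "eventually (\<lambda>_. False) \<W>" by simp
    then obtain P Q where P: "eventually P (nhds \<mu>)" and Q: "eventually Q \<F>"
      and PQ: "\<And>n. \<not> (P (\<nu> n) \<and> Q n)"
      unfolding \<W>_def eventually_inf eventually_filtercomap by blast
    have "eventually (\<lambda>x. \<not> P x) (filtermap \<nu> \<F>)"
      unfolding eventually_filtermap using Q by eventually_elim (use PQ in blast)
    with P have "eventually (\<lambda>_. False) (inf (nhds \<mu>) (filtermap \<nu> \<F>))"
      unfolding eventually_inf by blast
    then show False using \<mu> by (simp add: eventually_False)
  qed
  moreover have "\<W> \<le> \<F>" by (simp add: \<W>_def)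
  moreover have "((\<lambda>n. \<nu> n A) \<longlongrightarrow> \<mu> A) \<W>" for A
  proof -
    have "(\<nu> \<longlongrightarrow> \<mu>) \<W>"
      unfolding \<W>_def by (rule tendsto_mono[OF inf_le1 filterlim_filtercomap])
    then show ?thesis
      by (rule continuous_on_tendsto_compose[OF continuous_on_product_coordinates]) auto
  qed
  ultimately show thesis by (rule that)
qed

text \<open>A net of finitely supported probability measures on \<open>A\<close>, with atoms \<open>c n j\<close> of weight \<open>w n j\<close>.\<close>

locale finite_prob_net =
  fixes \<F> :: "'n filter" and J :: "'n \<Rightarrow> 'k set" and w :: "'n \<Rightarrow> 'k \<Rightarrow> real"
    and c :: "'n \<Rightarrow> 'k \<Rightarrow> 'x" and X A :: "'x set"
  assumes nonbot: "\<F> \<noteq> bot"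
    and J: "finite (J n)" "(\<Sum>j\<in>J n. w n j) = 1" "j \<in> J n \<Longrightarrow> w n j \<ge> 0" "j \<in> J n \<Longrightarrow> c n j \<in> A"
    and AX: "A \<subseteq> X"
begin

definition mass :: "'n \<Rightarrow> 'x set \<Rightarrow> real" where
  "mass n B = (\<Sum>j\<in>J n. w n j * indicator B (c n j))"

lemma mass_bounds: "0 \<le> mass n B \<and> mass n B \<le> 1"
proof -
  have "mass n B \<le> (\<Sum>j\<in>J n. w n j)"
    unfolding mass_def using J(3) by (intro sum_mono) (auto simp: indicator_def)
  then show ?thesis unfolding J(2) mass_def using J(3) by (auto intro!: sum_nonneg simp: indicator_def)
qed

lemma sum_mass_mult:
  "(\<Sum>B\<in>P. mass n B * h B) = (\<Sum>j\<in>J n. \<Sum>B\<in>P. w n j * (indicator B (c n j) * h B))"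
  unfolding mass_def by (simp add: sum_distrib_right mult.assoc) (rule sum.swap)

lemma partition_indicator:
  fixes h :: "'x set \<Rightarrow> real"
  assumes P: "finite P" "partition_on A P" and x: "x \<in> A"
  obtains B where "B \<in> P" "x \<in> B" "(\<Sum>B\<in>P. indicator B x * h B) = h B"
proof -
  obtain B where B: "B \<in> P" "x \<in> B" using x partition_onD1[OF P(2)] by blast
  have "indicator B' x * h B' = (if B' = B then h B' else 0)" if "B' \<in> P" for B'
  proof -
    have "x \<notin> B'" if "B' \<noteq> B" using \<open>B' \<in> P\<close> B that P(2) unfolding partition_on_def disjoint_def by blast
    then show ?thesis using B by auto
  qed
  then have "(\<Sum>B\<in>P. indicator B x * h B) = (\<Sum>B'\<in>P. if B' = B then h B' else 0)"
    by (rule sum.cong[OF refl])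
  then show thesis using that[OF B] P(1) B(1) by simp
qed

context
  fixes \<W> :: "'n filter" and \<mu> :: "'x set \<Rightarrow> real"
  assumes W: "\<W> \<noteq> bot" and mu: "\<And>B. ((\<lambda>n. mass n B) \<longlongrightarrow> \<mu> B) \<W>"
begin

text \<open>Each property is an equation or inequality between finitely many values of the measure,
  so it passes to the limit along \<open>\<W>\<close>.\<close>

lemma fin_add_prob_limit: "fin_add_prob X \<mu>" "\<mu> (X - A) = 0"
proof -
  have "\<mu> B \<ge> 0" for B
    using mass_bounds by (intro tendsto_lowerbound[OF mu _ W]) auto
  moreover have "\<mu> (B \<union> C) = \<mu> B + \<mu> C" if "B \<inter> C = {}" for B C
  proof -
    have "mass n (B \<union> C) = mass n B + mass n C" for n
      unfolding mass_def sum.distrib[symmetric]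
      using that by (intro sum.cong) (auto simp: indicator_def)
    then have "((\<lambda>n. mass n (B \<union> C)) \<longlongrightarrow> \<mu> B + \<mu> C) \<W>" using tendsto_add[OF mu mu] by simp
    then show ?thesis using tendsto_unique[OF W mu] by blast
  qed
  moreover have "\<mu> X = 1"
  proof -
    have "mass n X = 1" for n
      unfolding mass_def J(2)[of n, symmetric] using J(4) AX by (intro sum.cong) (auto simp: indicator_def)
    then have "((\<lambda>n. mass n X) \<longlongrightarrow> 1) \<W>" by simp
    then show ?thesis using tendsto_unique[OF W mu] by blast
  qed
  ultimately show "fin_add_prob X \<mu>" by (auto simp: fin_add_prob_def Measure_Space.additive_def)
  have "mass n (X - A) = 0" for n
    unfolding mass_def using J(4) by (intro sum.neutral) (auto simp: indicator_def)
  then have "((\<lambda>n. mass n (X - A)) \<longlongrightarrow> 0) \<W>" by simp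
  then show "\<mu> (X - A) = 0" using tendsto_unique[OF W mu] by blast
qed

text \<open>Convergence of masses set by set is enough because lower sums use finite partitions. At
  every stage a lower sum is at most the average of \<open>g\<close>, which gives the upper bound; a
  partition into thin level sets misses the average by at most \<open>\<epsilon>\<close> at every
  stage, which gives the lower one.\<close>

lemma fa_integral_real_limit:
  fixes g :: "'x \<Rightarrow> real"
  assumes g: "\<And>x. x \<in> A \<Longrightarrow> \<bar>g x\<bar> \<le> M"
    and L: "((\<lambda>n. \<Sum>j\<in>J n. w n j * g (c n j)) \<longlongrightarrow> L) \<W>"
  shows "fa_integral_real \<mu> A g = L"
proof -
  let ?S = "{(\<Sum>B\<in>P. \<mu> B * Inf (g ` B)) | P. finite P \<and> partition_on A P}"
  have lim: "((\<lambda>n. \<Sum>B\<in>P. mass n B * Inf (g ` B)) \<longlongrightarrow> (\<Sum>B\<in>P. \<mu> B * Inf (g ` B))) \<W>" for P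
    by (intro tendsto_sum tendsto_mult mu tendsto_const)
  have Inf_le: "Inf (g ` B) \<le> g x" if "B \<subseteq> A" "x \<in> B" for B x
  proof (rule cInf_lower)
    show "bdd_below (g ` B)"
    proof (rule bdd_belowI2)
      fix y assume "y \<in> B"
      then show "- M \<le> g y" using g[of y] \<open>B \<subseteq> A\<close> by (auto simp: abs_le_iff)
    qed
  qed (use that in auto)
  have upper: "s \<le> L" if s: "s \<in> ?S" for s
  proof -
    obtain P where P: "finite P" "partition_on A P" "s = (\<Sum>B\<in>P. \<mu> B * Inf (g ` B))" using s by blast
    have "(\<Sum>B\<in>P. mass n B * Inf (g ` B)) \<le> (\<Sum>j\<in>J n. w n j * g (c n j))" for n
      unfolding sum_mass_mult
    proof (rule sum_mono)
      fix j assume j: "j \<in> J n"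
      obtain B where "B \<in> P" "c n j \<in> B"
        "(\<Sum>B\<in>P. indicator B (c n j) * Inf (g ` B)) = Inf (g ` B)"
        using partition_indicator[OF P(1,2) J(4)[OF j], of "\<lambda>B. Inf (g ` B)"] by blast
      then have "(\<Sum>B\<in>P. indicator B (c n j) * Inf (g ` B)) \<le> g (c n j)"
        using Inf_le[of B "c n j"] P(2) by (auto simp: partition_on_def)
      then show "(\<Sum>B\<in>P. w n j * (indicator B (c n j) * Inf (g ` B))) \<le> w n j * g (c n j)"
        unfolding sum_distrib_left[symmetric] using J(3)[OF j] by (rule mult_left_mono)
    qed
    then show ?thesis unfolding P(3) by (intro tendsto_le[OF W L lim]) auto
  qed
  have lower: "\<exists>s\<in>?S. L \<le> s + \<epsilon>" if \<epsilon>: "\<epsilon> > 0" for \<epsilon>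
  proof -
    \<comment> \<open>Level sets of \<open>g\<close> on a grid of width \<open>\<epsilon>\<close>:
      boundedness of \<open>g\<close> leaves finitely many of them, and on each one \<open>g\<close>
      exceeds its infimum by at most \<open>\<epsilon>\<close>.\<close>
    let ?k = "\<lambda>x. \<lfloor>g x / \<epsilon>\<rfloor>"
    define P where "P = (\<lambda>k. {x \<in> A. ?k x = k}) ` ?k ` A"
    have "?k ` A \<subseteq> {\<lfloor>- M / \<epsilon>\<rfloor>..\<lfloor>M / \<epsilon>\<rfloor>}"
    proof
      fix k assume "k \<in> ?k ` A"
      then obtain x where x: "x \<in> A" "k = ?k x" by blast
      then have "- M \<le> g x" "g x \<le> M" using g[OF x(1)] by (auto simp: abs_le_iff)
      then show "k \<in> {\<lfloor>- M / \<epsilon>\<rfloor>..\<lfloor>M / \<epsilon>\<rfloor>}"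
        using floor_mono[OF divide_right_mono[of "- M" "g x" \<epsilon>]] floor_mono[OF divide_right_mono[of "g x" M \<epsilon>]]
          x(2) \<epsilon> by simp
    qed
    then have "finite (?k ` A)" by (rule finite_subset) simp
    then have P: "finite P" by (simp add: P_def)
    have P': "partition_on A P" unfolding partition_on_def disjoint_def P_def by auto
    have Inf_ge: "g x \<le> Inf (g ` B) + \<epsilon>" if B: "B \<in> P" "x \<in> B" for B x
    proof -
      obtain k where k: "B = {x \<in> A. ?k x = k}" using B(1) unfolding P_def by blast
      have "of_int k * \<epsilon> \<le> Inf (g ` B)"
      proof (rule cInf_greatest)
        show "g ` B \<noteq> {}" using B(2) by blast
        fix y assume "y \<in> g ` B"
        then obtain z where "y = g z" "?k z = k" unfolding k by blast
        then have "of_int k \<le> y / \<epsilon>" by (metis of_int_floor_le)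
        then show "of_int k * \<epsilon> \<le> y" using \<epsilon> by (simp add: le_divide_eq)
      qed
      moreover have "g x / \<epsilon> < of_int k + 1" using B(2) unfolding k by (simp add: floor_eq_iff)
      then have "g x < of_int k * \<epsilon> + \<epsilon>" using \<epsilon> by (simp add: divide_less_eq algebra_simps)
      ultimately show ?thesis by linarith
    qed
    have "(\<Sum>j\<in>J n. w n j * g (c n j)) \<le> (\<Sum>B\<in>P. mass n B * Inf (g ` B)) + \<epsilon>" for n
    proof -
      have "(\<Sum>j\<in>J n. w n j * g (c n j)) \<le>
          (\<Sum>j\<in>J n. (\<Sum>B\<in>P. w n j * (indicator B (c n j) * Inf (g ` B))) + w n j * \<epsilon>)"
      proof (rule sum_mono)
        fix j assume j: "j \<in> J n"
        obtain B where "B \<in> P" "c n j \<in> B"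
          "(\<Sum>B\<in>P. indicator B (c n j) * Inf (g ` B)) = Inf (g ` B)"
          using partition_indicator[OF P P' J(4)[OF j], of "\<lambda>B. Inf (g ` B)"] by blast
        then have "g (c n j) \<le> (\<Sum>B\<in>P. indicator B (c n j) * Inf (g ` B)) + \<epsilon>"
          using Inf_ge[of B "c n j"] by simp
        then show "w n j * g (c n j) \<le> (\<Sum>B\<in>P. w n j * (indicator B (c n j) * Inf (g ` B))) + w n j * \<epsilon>"
          unfolding sum_distrib_left[symmetric] distrib_left[symmetric] using J(3)[OF j] by (rule mult_left_mono)
      qed
      also have "\<dots> = (\<Sum>B\<in>P. mass n B * Inf (g ` B)) + \<epsilon>"
        unfolding sum_mass_mult sum.distrib sum_distrib_right[symmetric] J(2) by simp
      finally show ?thesis .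
    qed
    then have "L \<le> (\<Sum>B\<in>P. \<mu> B * Inf (g ` B)) + \<epsilon>"
      by (intro tendsto_le[OF W tendsto_add[OF lim tendsto_const] L]) auto
    then show ?thesis using P P' by blast
  qed
  have "?S \<noteq> {}" using lower[of 1] by auto
  then have "Sup ?S \<le> L" using upper by (rule cSup_least)
  moreover have "L \<le> Sup ?S"
  proof (rule field_le_epsilon)
    fix \<epsilon> :: real assume "\<epsilon> > 0"
    then obtain s where s: "s \<in> ?S" "L \<le> s + \<epsilon>" using lower by blast
    have "bdd_above ?S" using upper by (rule bdd_aboveI)
    then have "s \<le> Sup ?S" using s(1) by (intro cSup_upper)
    then show "L \<le> Sup ?S + \<epsilon>" using s(2) by simp
  qed
  ultimately show ?thesis unfolding fa_integral_real_def by (rule antisym)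
qed

end

text \<open>One \<open>\<mu>\<close> serves all bounded \<open>g\<close>, being fixed before
  \<open>g\<close>: the averages of \<open>g\<close> are assumed to converge along
  \<open>\<F>\<close>, hence they converge along the finer \<open>\<W>\<close>.\<close>

lemma fin_add_prob_limit_exists:
  obtains \<mu> where "fin_add_prob X \<mu>" "\<mu> (X - A) = 0"
    "\<And>(g :: 'x \<Rightarrow> complex) M L. (\<And>x. x \<in> A \<Longrightarrow> cmod (g x) \<le> M) \<Longrightarrow>
      ((\<lambda>n. \<Sum>j\<in>J n. of_real (w n j) * g (c n j)) \<longlongrightarrow> L) \<F> \<Longrightarrow> fa_integral \<mu> A g = L"
proof -
  obtain \<mu> \<W> where W: "\<W> \<noteq> bot" "\<W> \<le> \<F>" and mu: "\<And>B. ((\<lambda>n. mass n B) \<longlongrightarrow> \<mu> B) \<W>"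
    by (rule cluster_point_bounded[of \<F> mass, OF nonbot mass_bounds]) (rule that)
  show thesis
  proof (rule that[OF fin_add_prob_limit[OF W(1) mu]])
    fix g :: "'x \<Rightarrow> complex" and M L
    assume g: "\<And>x. x \<in> A \<Longrightarrow> cmod (g x) \<le> M"
      and "((\<lambda>n. \<Sum>j\<in>J n. of_real (w n j) * g (c n j)) \<longlongrightarrow> L) \<F>"
    then have L: "((\<lambda>n. \<Sum>j\<in>J n. of_real (w n j) * g (c n j)) \<longlongrightarrow> L) \<W>"
      by (intro tendsto_mono[OF W(2)])
    have "fa_integral_real \<mu> A (\<lambda>x. Re (g x)) = Re L"
    proof (rule fa_integral_real_limit[OF W(1) mu])
      show "\<bar>Re (g x)\<bar> \<le> M" if "x \<in> A" for x using g[OF that] abs_Re_le_cmod order_trans by blast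
      show "((\<lambda>n. \<Sum>j\<in>J n. w n j * Re (g (c n j))) \<longlongrightarrow> Re L) \<W>" using tendsto_Re[OF L] by simp
    qed
    moreover have "fa_integral_real \<mu> A (\<lambda>x. Im (g x)) = Im L"
    proof (rule fa_integral_real_limit[OF W(1) mu])
      show "\<bar>Im (g x)\<bar> \<le> M" if "x \<in> A" for x using g[OF that] abs_Im_le_cmod order_trans by blast
      show "((\<lambda>n. \<Sum>j\<in>J n. w n j * Im (g (c n j))) \<longlongrightarrow> Im L) \<W>" using tendsto_Im[OF L] by simp
    qed
    ultimately show "fa_integral \<mu> A g = L" by (simp add: fa_integral_def)
  qed
qed

end

section \<open>The Plancherel measure\<close>

abbreviation class_char :: "('a, 'i) rep set \<Rightarrow> 'a \<Rightarrow> complex" where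
  "class_char c g \<equiv> on_class (\<lambda>H \<pi>. normalized_trace H (\<pi> g)) c"

lemma unitarily_equivalent_refl: "unitarily_equivalent G r r"
proof -
  have "unitary_map H H (\<lambda>v. v)" for H :: "('i \<Rightarrow> complex) set"
    by (simp add: unitary_map_def bij_betw_def)
  then show ?thesis by (auto simp: unitarily_equivalent_def split: prod.split intro!: exI[of _ "\<lambda>v. v"])
qed

section \<open>Characters and traces on the finite-dimensional dual\<close>

context group
begin

lemma fin_dual_rep:
  assumes "c \<in> fin_dual G"
  obtains H \<pi> B where "(SOME r. r \<in> c) = (H, \<pi>)" "(H, \<pi>) \<in> c" "fin_rep G (carrier G) H \<pi> B"
proof -
  let ?R = "{(r, s). r \<in> irreps G \<and> s \<in> irreps G \<and> unitarily_equivalent G r s}"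
  have c: "c \<in> irreps G // ?R" and fd: "\<forall>(H, \<pi>)\<in>c. finite_dimensional H"
    using assms by (auto simp: fin_dual_def unitary_dual_def)
  obtain x where x: "x \<in> irreps G" "c = ?R `` {x}" using c by (rule quotientE)
  have "x \<in> c" unfolding x(2) using x(1) unitarily_equivalent_refl by blast
  then have r: "(SOME r. r \<in> c) \<in> c" by (rule someI)
  obtain H \<pi> where H: "(SOME r. r \<in> c) = (H, \<pi>)" by (cases "SOME r. r \<in> c")
  have r': "(H, \<pi>) \<in> c" using r unfolding H .
  then have "(H, \<pi>) \<in> irreps G" unfolding x(2) by blast
  then have rep: "unitary_rep G (carrier G) (H, \<pi>)" unfolding irreps_def irreducible_rep_def by simp
  then interpret R: unitary_rep_loc G "carrier G" H \<pi> by unfold_locales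
  have "finite_dimensional H" using fd r' by blast
  then obtain B where "onb (carrier G) H B" using R.H_sub by (rule finite_dimensional_onb)
  then have "fin_rep G (carrier G) H \<pi> B" by (intro fin_rep.intro R.unitary_rep_loc_axioms)
  then show thesis by (rule that[OF H r'])
qed

lemma class_char_le_1:
  assumes "c \<in> fin_dual G" "g \<in> carrier G"
  shows "cmod (class_char c g) \<le> 1"
proof -
  obtain H \<pi> B where H: "(SOME r. r \<in> c) = (H, \<pi>)" "(H, \<pi>) \<in> c" "fin_rep G (carrier G) H \<pi> B"
    by (rule fin_dual_rep[OF assms(1)])
  then show ?thesis using fin_rep.normalized_trace_le_1[OF H(3) assms(2)] by (simp add: on_class_def)
qed

lemma on_class_trace:
  assumes f: "(\<lambda>\<gamma>. cmod (f \<gamma>)) summable_on carrier G" and c: "c \<in> fin_dual G" and h: "h \<in> carrier G"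
  shows "on_class (\<lambda>H \<pi>. normalized_trace H (\<pi> h \<circ> rep_ell1 G \<pi> f)) c =
    (\<Sum>\<^sub>\<infinity>\<gamma>\<in>carrier G. f \<gamma> * class_char c (h \<otimes> \<gamma>))"
proof -
  obtain H \<pi> B where H: "(SOME r. r \<in> c) = (H, \<pi>)" "(H, \<pi>) \<in> c" "fin_rep G (carrier G) H \<pi> B"
    by (rule fin_dual_rep[OF c])
  then show ?thesis using fin_rep.normalized_trace_pi_rep_ell1[OF H(3) f h] by (simp add: on_class_def)
qed

lemma on_class_trace_adjoint:
  assumes f: "(\<lambda>\<gamma>. cmod (f \<gamma>)) summable_on carrier G" and c: "c \<in> fin_dual G"
  shows "on_class (\<lambda>H \<pi>. normalized_trace H (hilbert_adjoint H (rep_ell1 G \<pi> f) \<circ> rep_ell1 G \<pi> f)) c =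
    (\<Sum>\<^sub>\<infinity>\<gamma>\<in>carrier G. cnj (f \<gamma>) * on_class (\<lambda>H \<pi>. normalized_trace H (\<pi> (inv \<gamma>) \<circ> rep_ell1 G \<pi> f)) c)"
proof -
  obtain H \<pi> B where H: "(SOME r. r \<in> c) = (H, \<pi>)" "(H, \<pi>) \<in> c" "fin_rep G (carrier G) H \<pi> B"
    by (rule fin_dual_rep[OF c])
  then show ?thesis using fin_rep.normalized_trace_adjoint[OF H(3) f] by (simp add: on_class_def)
qed

text \<open>The representative picked from the class may act on another space \<open>K\<close>;
  \<open>fin_rep_equivalent\<close> transports finite dimension and the character to it.\<close>

lemma class_of_fin_rep:
  assumes "irreducible_rep G (carrier G) (H, \<pi>)" "fin_rep G (carrier G) H \<pi> B"
  obtains c where "c \<in> fin_dual G" "\<And>g. g \<in> carrier G \<Longrightarrow> class_char c g = normalized_trace H (\<pi> g)"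
proof -
  let ?R = "{(r, s). r \<in> irreps G \<and> s \<in> irreps G \<and> unitarily_equivalent G r s}"
  let ?c = "?R `` {(H, \<pi>)}"
  have irr: "(H, \<pi>) \<in> irreps G" using assms(1) by (simp add: irreps_def)
  have c: "?c \<in> unitary_dual G" unfolding unitary_dual_def using irr by (rule quotientI)
  have mem: "unitary_rep G (carrier G) (K, \<rho>) \<and> unitarily_equivalent G (H, \<pi>) (K, \<rho>)" if "(K, \<rho>) \<in> ?c" for K \<rho>
    using that by (auto simp: irreps_def irreducible_rep_def)
  have fin: "finite_dimensional K" if "(K, \<rho>) \<in> ?c" for K \<rho>
    using fin_rep_equivalent(1)[OF assms(2)] mem[OF that] by blast
  have cfin: "?c \<in> fin_dual G" unfolding fin_dual_def using c fin by blast
  show thesis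
  proof (rule that[OF cfin])
    fix g assume g: "g \<in> carrier G"
    obtain K \<rho> B' where K: "(SOME r. r \<in> ?c) = (K, \<rho>)" "(K, \<rho>) \<in> ?c" "fin_rep G (carrier G) K \<rho> B'"
      by (rule fin_dual_rep[OF cfin])
    show "class_char ?c g = normalized_trace H (\<pi> g)"
      unfolding on_class_def K(1) prod.case
      using mem[OF K(2)] by (intro fin_rep_equivalent(2)[OF assms(2) _ _ g]) auto
  qed
qed

text \<open>Divides \<open>finite_quotient_decomposition\<close> by \<open>m\<close>. Atoms are
  indexed by the pieces and not by their classes: pieces of one class contribute their weights to
  the same point.\<close>

lemma finite_quotient_measure:
  assumes "N \<lhd> G" "finite (carrier (G Mod N))"
  shows "\<exists>(J :: ('a \<Rightarrow> complex) set set) w c. finite J \<and> (\<Sum>j\<in>J. w j) = (1::real) \<and> (\<forall>j\<in>J. w j \<ge> 0) \<and>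
    (\<forall>j\<in>J. c j \<in> fin_dual G) \<and>
    (\<forall>g\<in>carrier G. (\<Sum>j\<in>J. of_real (w j) * class_char (c j) g) = (if g \<in> N then 1 else 0))"
proof -
  obtain \<B> \<pi> m where b: "finite \<B>" "m > 0" "(\<Sum>D\<in>\<B>. card D) = m"
    "\<And>D. D \<in> \<B> \<Longrightarrow> irreducible_rep G (carrier G) (fvs.span D, \<pi>)"
    "\<And>D. D \<in> \<B> \<Longrightarrow> fin_rep G (carrier G) (fvs.span D) \<pi> D"
    and sum: "\<And>g. g \<in> carrier G \<Longrightarrow>
      (\<Sum>D\<in>\<B>. of_nat (card D) * normalized_trace (fvs.span D) (\<pi> g)) = (if g \<in> N then of_nat m else 0)"
    by (rule normal.finite_quotient_decomposition[OF assms]) (rule that)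
  have "\<exists>c. c \<in> fin_dual G \<and> (\<forall>g\<in>carrier G. class_char c g = normalized_trace (fvs.span D) (\<pi> g))"
    if D: "D \<in> \<B>" for D
    by (rule class_of_fin_rep[OF b(4)[OF D] b(5)[OF D]]) blast
  then obtain c where c: "\<And>D. D \<in> \<B> \<Longrightarrow> c D \<in> fin_dual G"
    "\<And>D g. D \<in> \<B> \<Longrightarrow> g \<in> carrier G \<Longrightarrow> class_char (c D) g = normalized_trace (fvs.span D) (\<pi> g)"
    by metis
  have "(\<Sum>D\<in>\<B>. real (card D) / real m) = 1"
    unfolding sum_divide_distrib[symmetric] using b(2,3) by (simp flip: of_nat_sum)
  moreover have "(\<Sum>D\<in>\<B>. of_real (real (card D) / real m) * class_char (c D) g) = (if g \<in> N then 1 else 0)"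
    if g: "g \<in> carrier G" for g
  proof -
    have "(\<Sum>D\<in>\<B>. of_real (real (card D) / real m) * class_char (c D) g) =
        (\<Sum>D\<in>\<B>. of_nat (card D) * normalized_trace (fvs.span D) (\<pi> g)) / of_nat m"
      unfolding sum_divide_distrib using c(2)[OF _ g] by (intro sum.cong) auto
    then show ?thesis unfolding sum[OF g] using b(2) by simp
  qed
  ultimately show ?thesis using b(1) c(1)
    by (intro exI[of _ \<B>] exI[of _ "\<lambda>D. real (card D) / real m"] exI[of _ c]) simp
qed

text \<open>The net is indexed by the finite subsets \<open>F\<close> of the group, directed by
  inclusion. A fixed nontrivial element is excluded from \<open>N F\<close> as soon as it belongs to
  \<open>F\<close>, which gives pointwise convergence of the averaged characters.\<close>

lemma plancherel_of_residually_finite: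
  assumes res: "\<And>F. finite F \<Longrightarrow> F \<subseteq> carrier G \<Longrightarrow> \<one> \<notin> F \<Longrightarrow>
      \<exists>N. N \<lhd> G \<and> finite (carrier (G Mod N)) \<and> N \<inter> F = {}"
  shows "\<exists>\<mu> :: ('a, 'a) rep set set \<Rightarrow> real.
    fin_add_prob (unitary_dual G) \<mu> \<and>
    \<mu> (unitary_dual G - fin_dual G) = 0 \<and>
    (\<forall>f :: 'a \<Rightarrow> complex. (\<lambda>\<gamma>. cmod (f \<gamma>)) summable_on carrier G \<longrightarrow>
      (\<forall>\<sigma>\<in>carrier G.
        f \<sigma> = fa_integral \<mu> (fin_dual G)
          (on_class (\<lambda>H \<pi>. normalized_trace H (\<pi> (inv \<sigma>) \<circ> rep_ell1 G \<pi> f)))) \<and>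
      of_real (\<Sum>\<^sub>\<infinity>\<gamma>\<in>carrier G. (cmod (f \<gamma>))\<^sup>2) =
        fa_integral \<mu> (fin_dual G)
          (on_class (\<lambda>H \<pi>. normalized_trace H
            (hilbert_adjoint H (rep_ell1 G \<pi> f) \<circ> rep_ell1 G \<pi> f))))"
proof -
  let ?\<F> = "finite_subsets_at_top (carrier G)"
  \<comment> \<open>\<open>N\<close> has to be a function of all sets \<open>F\<close>, so foreign
    elements and the identity are removed, and an infinite \<open>F\<close> gets any normal subgroup
    of finite index.\<close>
  have "\<exists>N. N \<lhd> G \<and> finite (carrier (G Mod N)) \<and> (finite F \<longrightarrow> N \<inter> (F \<inter> carrier G - {\<one>}) = {})" for F
  proof (cases "finite F")
    case True
    then show ?thesis using res[of "F \<inter> carrier G - {\<one>}"] by auto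
  next
    case False
    then show ?thesis using res[of "{}"] by auto
  qed
  then obtain N where N: "\<And>F. N F \<lhd> G" "\<And>F. finite (carrier (G Mod N F))"
    "\<And>F. finite F \<Longrightarrow> N F \<inter> (F \<inter> carrier G - {\<one>}) = {}" by metis
  have "\<forall>F. \<exists>(J :: ('a \<Rightarrow> complex) set set) w c. finite J \<and> (\<Sum>j\<in>J. w j) = (1::real) \<and> (\<forall>j\<in>J. w j \<ge> 0) \<and>
    (\<forall>j\<in>J. c j \<in> fin_dual G) \<and>
    (\<forall>g\<in>carrier G. (\<Sum>j\<in>J. of_real (w j) * class_char (c j) g) = (if g \<in> N F then 1 else 0))"
    using finite_quotient_measure[OF N(1,2)] by blast
  then obtain J :: "'a set \<Rightarrow> ('a \<Rightarrow> complex) set set" and w c where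
    J: "\<And>F. finite (J F)" "\<And>F. (\<Sum>j\<in>J F. w F j) = (1::real)" "\<And>F j. j \<in> J F \<Longrightarrow> w F j \<ge> 0"
      "\<And>F j. j \<in> J F \<Longrightarrow> c F j \<in> fin_dual G"
    and avg: "\<And>F g. g \<in> carrier G \<Longrightarrow>
      (\<Sum>j\<in>J F. of_real (w F j) * class_char (c F j) g) = (if g \<in> N F then 1 else 0)"
    by (simp only: choice_iff) blast
  have "fin_dual G \<subseteq> unitary_dual G" by (auto simp: fin_dual_def)
  then interpret finite_prob_net ?\<F> J w c "unitary_dual G" "fin_dual G"
    using J by unfold_locales auto
  show ?thesis
  proof (rule fin_add_prob_limit_exists, intro exI conjI allI impI ballI)
    fix \<mu>
    assume "fin_add_prob (unitary_dual G) \<mu>" "\<mu> (unitary_dual G - fin_dual G) = 0"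
    then show "fin_add_prob (unitary_dual G) \<mu>" "\<mu> (unitary_dual G - fin_dual G) = 0" .
    assume integral: "\<And>(g :: ('a, 'a) rep set \<Rightarrow> complex) M L. (\<And>x. x \<in> fin_dual G \<Longrightarrow> cmod (g x) \<le> M) \<Longrightarrow>
      ((\<lambda>F. \<Sum>j\<in>J F. of_real (w F j) * g (c F j)) \<longlongrightarrow> L) ?\<F> \<Longrightarrow> fa_integral \<mu> (fin_dual G) g = L"
    fix f :: "'a \<Rightarrow> complex" assume f: "(\<lambda>\<gamma>. cmod (f \<gamma>)) summable_on carrier G"
    define M where "M = (\<Sum>\<^sub>\<infinity>\<gamma>\<in>carrier G. cmod (f \<gamma>))"
    define tr :: "'a \<Rightarrow> ('a, 'a) rep set \<Rightarrow> complex" where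
      "tr \<sigma> = on_class (\<lambda>H \<pi>. normalized_trace H (\<pi> (inv \<sigma>) \<circ> rep_ell1 G \<pi> f))" for \<sigma>
    have tr_eq: "tr \<sigma> x = (\<Sum>\<^sub>\<infinity>\<gamma>\<in>carrier G. f \<gamma> * class_char x (inv \<sigma> \<otimes> \<gamma>))"
      if "\<sigma> \<in> carrier G" "x \<in> fin_dual G" for \<sigma> x
      unfolding tr_def by (rule on_class_trace[OF f that(2) inv_closed[OF that(1)]])
    have tr_le: "cmod (tr \<sigma> x) \<le> M" if "\<sigma> \<in> carrier G" "x \<in> fin_dual G" for \<sigma> x
      using norm_infsum_bounded_mult_le[OF f, of "\<lambda>\<gamma>. class_char x (inv \<sigma> \<otimes> \<gamma>)" 1]
        class_char_le_1[OF that(2)] that(1)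
      by (simp add: tr_eq[OF that] M_def)
    \<comment> \<open>Uniform in \<open>F\<close>: this is the domination for the second limit,
      where the averages themselves take the role of the bounded factor.\<close>
    have avg_le: "cmod (\<Sum>j\<in>J F. of_real (w F j) * tr \<sigma> (c F j)) \<le> M" if \<sigma>: "\<sigma> \<in> carrier G" for F \<sigma>
    proof -
      have "cmod (\<Sum>j\<in>J F. of_real (w F j) * tr \<sigma> (c F j)) \<le> (\<Sum>j\<in>J F. w F j * M)"
        using J(3) tr_le[OF \<sigma> J(4)]
        by (intro order_trans[OF norm_sum] sum_mono) (auto simp: norm_mult intro!: mult_left_mono)
      then show ?thesis unfolding sum_distrib_right[symmetric] J(2) by simp
    qed
    have lim: "((\<lambda>F. \<Sum>j\<in>J F. of_real (w F j) * tr \<sigma> (c F j)) \<longlongrightarrow> f \<sigma>) ?\<F>"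
      if \<sigma>: "\<sigma> \<in> carrier G" for \<sigma>
    proof -
      have "(\<Sum>j\<in>J F. of_real (w F j) * tr \<sigma> (c F j)) =
          (\<Sum>\<^sub>\<infinity>\<gamma>\<in>carrier G. f \<gamma> * (if inv \<sigma> \<otimes> \<gamma> \<in> N F then 1 else 0))" for F
      proof -
        have "(\<Sum>j\<in>J F. of_real (w F j) * tr \<sigma> (c F j)) =
            (\<Sum>j\<in>J F. \<Sum>\<^sub>\<infinity>\<gamma>\<in>carrier G. of_real (w F j) * (f \<gamma> * class_char (c F j) (inv \<sigma> \<otimes> \<gamma>)))"
          using J(4) by (intro sum.cong) (auto simp: tr_eq[OF \<sigma>] infsum_cmult_right')
        also have "\<dots> = (\<Sum>\<^sub>\<infinity>\<gamma>\<in>carrier G. \<Sum>j\<in>J F. of_real (w F j) * (f \<gamma> * class_char (c F j) (inv \<sigma> \<otimes> \<gamma>)))"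
          using class_char_le_1[OF J(4)] \<sigma>
          by (intro infsum_sum_swap[symmetric] summable_on_cmult_right summable_on_bounded_mult(2)[OF f, where M = 1]) auto
        also have "\<dots> = (\<Sum>\<^sub>\<infinity>\<gamma>\<in>carrier G. f \<gamma> * (if inv \<sigma> \<otimes> \<gamma> \<in> N F then 1 else 0))"
          using \<sigma> by (intro infsum_cong)
            (simp add: avg[symmetric] sum_distrib_left mult.left_commute)
        finally show ?thesis .
      qed
      moreover have "((\<lambda>F. \<Sum>\<^sub>\<infinity>\<gamma>\<in>carrier G. f \<gamma> * (if inv \<sigma> \<otimes> \<gamma> \<in> N F then 1 else 0)) \<longlongrightarrow>
          (\<Sum>\<^sub>\<infinity>\<gamma>\<in>carrier G. f \<gamma> * (if \<gamma> = \<sigma> then 1 else 0))) ?\<F>"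
      proof (rule tendsto_infsum_dominated[OF f, where M = 1])
        fix \<gamma> assume \<gamma>: "\<gamma> \<in> carrier G"
        \<comment> \<open>Once \<open>F\<close> contains
          \<open>inv \<sigma> \<otimes> \<gamma>\<close>, that element lies in \<open>N F\<close>
          only if it is \<open>\<one>\<close>.\<close>
        have in_N: "inv \<sigma> \<otimes> \<gamma> \<in> N F \<longleftrightarrow> \<gamma> = \<sigma>" if F: "finite F" "inv \<sigma> \<otimes> \<gamma> \<in> F" for F
        proof
          assume "inv \<sigma> \<otimes> \<gamma> \<in> N F"
          then have "inv \<sigma> \<otimes> \<gamma> = \<one>" using N(3)[OF F(1)] F(2) \<sigma> \<gamma> by auto
          then have "\<gamma> = \<sigma> \<otimes> \<one>" using \<sigma> \<gamma> by (metis inv_solve_left' one_closed)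
          then show "\<gamma> = \<sigma>" using \<sigma> by simp
        next
          assume "\<gamma> = \<sigma>"
          then have "inv \<sigma> \<otimes> \<gamma> = \<one>" using \<sigma> by simp
          then show "inv \<sigma> \<otimes> \<gamma> \<in> N F" using subgroup.one_closed[OF normal_imp_subgroup[OF N(1)]] by simp
        qed
        have "eventually (\<lambda>F. (if inv \<sigma> \<otimes> \<gamma> \<in> N F then 1 else 0) = (if \<gamma> = \<sigma> then 1 else 0 :: complex)) ?\<F>"
          unfolding eventually_finite_subsets_at_top
          using in_N \<sigma> \<gamma> by (intro exI[of _ "{inv \<sigma> \<otimes> \<gamma>}"]) auto
        then show "((\<lambda>F. if inv \<sigma> \<otimes> \<gamma> \<in> N F then 1 else 0) \<longlongrightarrow> (if \<gamma> = \<sigma> then 1 else 0 :: complex)) ?\<F>"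
          by (rule tendsto_eventually)
      qed auto
      moreover have "(\<Sum>\<^sub>\<infinity>\<gamma>\<in>carrier G. f \<gamma> * (if \<gamma> = \<sigma> then 1 else 0)) = f \<sigma>"
      proof -
        have "(\<Sum>\<^sub>\<infinity>\<gamma>\<in>carrier G. f \<gamma> * (if \<gamma> = \<sigma> then 1 else 0)) =
            (\<Sum>\<^sub>\<infinity>\<gamma>\<in>{\<sigma>}. f \<gamma> * (if \<gamma> = \<sigma> then 1 else 0))"
          using \<sigma> by (intro infsum_cong_neutral) auto
        then show ?thesis by simp
      qed
      ultimately show ?thesis by simp
    qed
    show "f \<sigma> = fa_integral \<mu> (fin_dual G)
        (on_class (\<lambda>H \<pi>. normalized_trace H (\<pi> (inv \<sigma>) \<circ> rep_ell1 G \<pi> f)))" if "\<sigma> \<in> carrier G" for \<sigma>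
      unfolding tr_def[symmetric] by (rule integral[OF tr_le[OF that] lim[OF that], symmetric])
    let ?p = "on_class (\<lambda>H \<pi>. normalized_trace H (hilbert_adjoint H (rep_ell1 G \<pi> f) \<circ> rep_ell1 G \<pi> f))"
    have p_eq: "?p x = (\<Sum>\<^sub>\<infinity>\<gamma>\<in>carrier G. cnj (f \<gamma>) * tr \<gamma> x)" if "x \<in> fin_dual G" for x
      unfolding tr_def by (rule on_class_trace_adjoint[OF f that])
    have cf: "(\<lambda>\<gamma>. cmod (cnj (f \<gamma>))) summable_on carrier G" using f by simp
    \<comment> \<open>The bound passes from the averages to their limit
      \<open>f \<sigma>\<close>.\<close>
    have f_le: "cmod (f \<sigma>) \<le> M" if "\<sigma> \<in> carrier G" for \<sigma>
      using avg_le[OF that] by (intro tendsto_upperbound[OF tendsto_norm[OF lim[OF that]]]) auto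
    have "(\<Sum>j\<in>J F. of_real (w F j) * ?p (c F j)) =
        (\<Sum>\<^sub>\<infinity>\<gamma>\<in>carrier G. cnj (f \<gamma>) * (\<Sum>j\<in>J F. of_real (w F j) * tr \<gamma> (c F j)))" for F
    proof -
      have "(\<Sum>j\<in>J F. of_real (w F j) * ?p (c F j)) =
          (\<Sum>j\<in>J F. \<Sum>\<^sub>\<infinity>\<gamma>\<in>carrier G. of_real (w F j) * (cnj (f \<gamma>) * tr \<gamma> (c F j)))"
        using J(4) by (intro sum.cong) (auto simp: p_eq infsum_cmult_right')
      also have "\<dots> = (\<Sum>\<^sub>\<infinity>\<gamma>\<in>carrier G. \<Sum>j\<in>J F. of_real (w F j) * (cnj (f \<gamma>) * tr \<gamma> (c F j)))"
        using tr_le[OF _ J(4)]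
        by (intro infsum_sum_swap[symmetric] summable_on_cmult_right summable_on_bounded_mult(2)[OF cf, where M = M]) auto
      finally show ?thesis by (simp add: sum_distrib_left mult.left_commute)
    qed
    \<comment> \<open>The averages inside the series converge to \<open>f \<gamma>\<close> by the
      limit behind the inversion formula, applied at every \<open>\<gamma>\<close>.\<close>
    moreover have "((\<lambda>F. \<Sum>\<^sub>\<infinity>\<gamma>\<in>carrier G. cnj (f \<gamma>) * (\<Sum>j\<in>J F. of_real (w F j) * tr \<gamma> (c F j))) \<longlongrightarrow>
        (\<Sum>\<^sub>\<infinity>\<gamma>\<in>carrier G. cnj (f \<gamma>) * f \<gamma>)) ?\<F>"
      by (rule tendsto_infsum_dominated[OF cf avg_le f_le lim])
    moreover have "(\<Sum>\<^sub>\<infinity>\<gamma>\<in>carrier G. cnj (f \<gamma>) * f \<gamma>) = of_real (\<Sum>\<^sub>\<infinity>\<gamma>\<in>carrier G. (cmod (f \<gamma>))\<^sup>2)"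
      unfolding infsum_complex_of_real[symmetric] complex_norm_square by (simp add: mult.commute)
    ultimately have p_lim: "((\<lambda>F. \<Sum>j\<in>J F. of_real (w F j) * ?p (c F j)) \<longlongrightarrow>
        of_real (\<Sum>\<^sub>\<infinity>\<gamma>\<in>carrier G. (cmod (f \<gamma>))\<^sup>2)) ?\<F>" by simp
    have p_le: "cmod (?p x) \<le> M * (\<Sum>\<^sub>\<infinity>\<gamma>\<in>carrier G. cmod (cnj (f \<gamma>)))" if "x \<in> fin_dual G" for x
      unfolding p_eq[OF that] by (rule norm_infsum_bounded_mult_le[OF cf tr_le[OF _ that]])
    show "of_real (\<Sum>\<^sub>\<infinity>\<gamma>\<in>carrier G. (cmod (f \<gamma>))\<^sup>2) = fa_integral \<mu> (fin_dual G) ?p"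
      by (rule integral[OF p_le p_lim, symmetric])
  qed
qed

end

theorem theoremC:
  fixes G :: "('a, 'b) monoid_scheme"
  assumes "group G" and "torsion_free G" and "finitely_generated G" and "nilpotent G"
  shows "\<exists>\<mu> :: ('a, 'a) rep set set \<Rightarrow> real.
    fin_add_prob (unitary_dual G) \<mu> \<and>
    \<mu> (unitary_dual G - fin_dual G) = 0 \<and>
    (\<forall>f :: 'a \<Rightarrow> complex. (\<lambda>\<gamma>. cmod (f \<gamma>)) summable_on carrier G \<longrightarrow>
      (\<forall>\<sigma>\<in>carrier G.
        f \<sigma> = fa_integral \<mu> (fin_dual G)
          (on_class (\<lambda>H \<pi>. normalized_trace H (\<pi> (inv\<^bsub>G\<^esub> \<sigma>) \<circ> rep_ell1 G \<pi> f)))) \<and>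
      of_real (\<Sum>\<^sub>\<infinity>\<gamma>\<in>carrier G. (cmod (f \<gamma>))\<^sup>2) =
        fa_integral \<mu> (fin_dual G)
          (on_class (\<lambda>H \<pi>. normalized_trace H
            (hilbert_adjoint H (rep_ell1 G \<pi> f) \<circ> rep_ell1 G \<pi> f))))"
proof -
  interpret group G by (rule assms(1))
  obtain S where S: "finite S" "S \<subseteq> carrier G" "generate G S = carrier G"
    using assms(3) unfolding finitely_generated_def by blast
  obtain c where "lower_central_series G c = {\<one>\<^bsub>G\<^esub>}"
    using assms(4) unfolding nilpotent_def by blast
  then have c: "upper_central_series G c = carrier G" by (rule upper_central_series_eq_carrier)
  show ?thesis
  proof (rule plancherel_of_residually_finite)
    fix F assume "finite F" "F \<subseteq> carrier G" "\<one>\<^bsub>G\<^esub> \<notin> F"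
    then show "\<exists>N. N \<lhd> G \<and> finite (carrier (G Mod N)) \<and> N \<inter> F = {}"
      by (rule residually_finite_of_nilpotent[OF S c]) blast
  qed
qed

end
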